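(* Assume that $\mathbb{L}$ and its Green function $G^\Omega$ satisfy properties (L1)–(L4) and (G1)–(G3) listed in the context. Let $g:\mathbb{R}\to\mathbb{R}$ be a nondecreasing continuous function with $g(0)=0$ satisfying $$\int_1^\infty[g(t)-g(-t)]\,t^{-1-p^*}dt<+\infty,\qquad p^*:=\frac{N+\gamma}{N+\gamma-2s}.$$ Then for any $\mu\in\mathcal{M}(\Omega,\delta^\gamma)$, the problem $$\mathbb{L}u+g(u)=\mu\ \text{ in }\Omega,\qquad u=0\ \text{ on }\partial\Omega\ \text{ or in }\mathbb{R}^N\setminus\Omega\ \text{(if applicable)}$$ admits a unique weak-dual solution $u$. Furthermore, the solution satisfies $$-\mathbb{G}^\Omega[\mu^-]\le u\le\mathbb{G}^\Omega[\mu^+]\quad\text{a.e. in }\Omega$$ and $$\|u\|_{L^1(\Omega,\delta^\gamma)}+\|g(u)\|_{L^1(\Omega,\delta^\gamma)}\le C\|\mu\|_{\mathcal{M}(\Omega,\delta^\gamma)}$$ for a positive constant $C=C(N,\Omega,s,\gamma)$, and the map $\mu\mapsto u$ is nondecreasing (i.e. if $\mu_1\le\mu_2$ and $u_1,u_2$ are the corresponding solutions, then $u_1\le u_2$ a.e. in $\Omega$).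
   Context: Throughout, $N\ge 3$, $\Omega\subset\mathbb{R}^N$ is a bounded $C^2$ domain, $\delta(x)=\operatorname{dist}(x,\mathbb{R}^N\setminus\Omega)$, $D_\Omega=\{(x,x):x\in\Omega\}$, $a\wedge b=\min\{a,b\}$; $f\asymp g$ means $C^{-1}g\le f\le Cg$ for some constant $C>0$. Operator: (L1) $\mathbb{L}:C_c^\infty(\Omega)\to L^2(\Omega)$ is given by $\mathbb{L}u(x)=\lim_{\varepsilon\to0^+}\mathbb{L}_\varepsilon u(x)$, where $\mathbb{L}_\varepsilon u(x)=\int_{\{y\in\Omega:|x-y|>\varepsilon\}}J(x,y)(u(x)-u(y))\,dy+B(x)u(x)$; $J,B$ are measurable, $J$ is nonnegative, symmetric, finite on $(\Omega\times\Omega)\setminus D_\Omega$, $\int_\Omega\int_\Omega|x-y|^2J(x,y)\,dx\,dy<\infty$, and $B$ is nonnegative and locally bounded in $\Omega$. (L2) For every $u\in C_c^\infty(\Omega)$ there exist $\varphi_u\in L^1_{\rm loc}(\Omega)$ and $\varepsilon_0>0$ with $|\mathbb{L}_\varepsilon u|\le\varphi_u$ a.e. in $\Omega$ for all $\varepsilon\in(0,\varepsilon_0]$. Put $\mathcal{E}(u,v)=\frac12\int_\Omega\int_\Omega J(x,y)(u(x)-u(y))(v(x)-v(y))\,dx\,dy+\int_\Omega Buv\,dx$ on $\mathcal{D}(\mathcal{E})=\{u\in L^2(\Omega):\mathcal{E}(u,u)<\infty\}$, with inner product $\langle u,v\rangle_{L^2(\Omega)}+\mathcal{E}(u,v)$;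 $\mathbb{H}(\Omega)$ is the closure of $C_c^\infty(\Omega)$ in $\mathcal{D}(\mathcal{E})$. $\mathbb{L}$ also denotes its Friedrichs extension, the nonnegative self-adjoint operator on $L^2(\Omega)$ associated with $\mathcal{E}|_{\mathbb{H}(\Omega)}$. (L3) There is $\Lambda>0$ with $\|u\|_{L^2(\Omega)}^2\le\Lambda\langle\mathbb{L}u,u\rangle_{L^2(\Omega)}$ for all $u\in C_c^\infty(\Omega)$. (L4) $\mathbb{H}(\Omega)=H^s_{00}(\Omega):=\{u\in H^s(\Omega):u/\delta^s\in L^2(\Omega)\}$, a Banach space with norm $\|u\|^2_{H^s_{00}(\Omega)}=\int_\Omega(1+\delta^{-2s})|u|^2dx+\int_\Omega\int_\Omega\frac{|u(x)-u(y)|^2}{|x-y|^{N+2s}}dx\,dy$ ($s$ as in (G1)). Green operator: for $f\in L^2(\Omega)$, $\mathbb{G}^\Omega[f]$ is the unique $u\in\mathbb{H}(\Omega)$ with $\mathcal{E}(u,v)=\int_\Omega fv\,dx$ for all $v\in\mathbb{H}(\Omega)$. (G1) $\mathbb{G}^\Omega[f](x)=\int_\Omega G^\Omega(x,y)f(y)\,dy$, where $G^\Omega:(\Omega\times\Omega)\setminus D_\Omega\to(0,\infty)$ is Borel measurable, symmetric, and for some $s,\gamma\in(0,1]$, $N>2s$, $$G^\Omega(x,y)\asymp\frac{1}{|x-y|^{N-2s}}\Big(\frac{\delta(x)}{|x-y|}\wedge1\Big)^\gamma\Big(\frac{\delta(y)}{|x-y|}\wedge1\Big)^\gamma,\quad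 x\ne y.$$ (G2) $G^\Omega$ is jointly continuous in $(\Omega\times\Omega)\setminus D_\Omega$. (G3) For every $x_0\in\Omega$, $z_0\in\partial\Omega$ the limit $M^\Omega(x_0,z_0)=\lim_{(x,y)\to(x_0,z_0)}\frac{G^\Omega(x,y)}{\delta(y)^\gamma}$ exists, and $M^\Omega:\Omega\times\partial\Omega\to\mathbb{R}^+$ is continuous. Spaces: $L^1(\Omega,\delta^\gamma)$ has norm $\int_\Omega|u|\delta^\gamma dx$; $\delta^\gamma L^\infty(\Omega)=\{\delta^\gamma u:u\in L^\infty(\Omega)\}$; $\mathcal{M}(\Omega,\delta^\gamma)$ is the space of signed Radon measures on $\Omega$ with $\|\mu\|_{\mathcal{M}(\Omega,\delta^\gamma)}=\int_\Omega\delta^\gamma d|\mu|<\infty$; $\mu^\pm$ are the positive and negative parts of $\mu$. For such $\mu$, $\mathbb{G}^\Omega[\mu](x)=\int_\Omega G^\Omega(x,y)\,d\mu(y)$, and for $f\in L^1(\Omega,\delta^\gamma)$, $\mathbb{G}^\Omega[f](x)=\int_\Omega G^\Omega(x,y)f(y)\,dy$. Weak-dual solution: $u$ is a weak-dual solution of the problem if $u\in L^1(\Omega,\delta^\gamma)$, $g(u)\in L^1(\Omega,\delta^\gamma)$ and $$\int_\Omega u\xi\,dx+\int_\Omega g(u)\mathbb{G}^\Omega[\xi]\,dx=\int_\Omega\mathbb{G}^\Omega[\xi]\,d\mu\quad\text{for all }\xi\in\delta^\gamma L^\infty(\Omega).$$ The kernel $G^\Omega$ is fixed; the notation $C(\cdot)$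 for constants suppresses dependence on the comparison constants in (G1). *)

theory Defs
  imports "HOL-Analysis.Analysis"
begin

text \<open>
  The ambient space is a Euclidean space of type \<open>'a\<close>, with \<open>N = DIM('a)\<close>. Functions on \<open>\<Omega>\<close> are total
  functions on \<open>'a\<close> of which only the values on \<open>\<Omega>\<close> matter; ``measurable'' without further
  qualification is Lebesgue measurable.
\<close>

section \<open>Domains and function spaces\<close>

primrec Ck :: "nat \<Rightarrow> ('a::euclidean_space \<Rightarrow> real) \<Rightarrow> bool" where
  "Ck 0 f \<longleftrightarrow> continuous_on UNIV f"
| "Ck (Suc k) f \<longleftrightarrow> (\<forall>x. f differentiable (at x)) \<and>
     (\<forall>b\<in>Basis. Ck k (\<lambda>x. frechet_derivative f (at x) b))"

text \<open>
  Near each boundary point \<open>\<Omega>\<close> is the strict epigraph, in the direction of a unit vector \<open>e\<close>, of a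
  \<open>C\<^sup>2\<close> function of the variable \<open>x - (x \<bullet> e) e\<close> in the hyperplane orthogonal to \<open>e\<close>.
\<close>
definition C2_domain :: "'a::euclidean_space set \<Rightarrow> bool" where
  "C2_domain \<Omega> \<longleftrightarrow> open \<Omega> \<and> connected \<Omega> \<and> \<Omega> \<noteq> {} \<and>
     (\<forall>z\<in>frontier \<Omega>. \<exists>r>0. \<exists>e \<phi>. norm e = 1 \<and> Ck 2 \<phi> \<and>
        \<Omega> \<inter> ball z r = {x \<in> ball z r. \<phi> (x - (x \<bullet> e) *\<^sub>R e) < x \<bullet> e})"

definition bdist :: "'a::euclidean_space set \<Rightarrow> 'a \<Rightarrow> real" where
  "bdist \<Omega> x = infdist x (- \<Omega>)"

definition test_fun :: "'a::euclidean_space set \<Rightarrow> ('a \<Rightarrow> real) set" where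
  "test_fun \<Omega> = {u. (\<forall>k. Ck k u) \<and> compact (closure {x. u x \<noteq> 0}) \<and> closure {x. u x \<noteq> 0} \<subseteq> \<Omega>}"

definition L2 :: "'a::euclidean_space set \<Rightarrow> ('a \<Rightarrow> real) set" where
  "L2 \<Omega> = {u. set_borel_measurable lebesgue \<Omega> u \<and> set_integrable lebesgue \<Omega> (\<lambda>x. (u x)\<^sup>2)}"

definition L1_loc :: "'a::euclidean_space set \<Rightarrow> ('a \<Rightarrow> real) set" where
  "L1_loc \<Omega> = {u. \<forall>K. compact K \<and> K \<subseteq> \<Omega> \<longrightarrow> set_integrable lebesgue K u}"

definition Linf :: "'a::euclidean_space set \<Rightarrow> ('a \<Rightarrow> real) set" where
  "Linf \<Omega> = {u. set_borel_measurable lebesgue \<Omega> u \<and> (\<exists>M. AE x in lebesgue. x \<in> \<Omega> \<longrightarrow> \<bar>u x\<bar> \<le> M)}"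

definition L1w :: "'a::euclidean_space set \<Rightarrow> real \<Rightarrow> ('a \<Rightarrow> real) set" where
  "L1w \<Omega> \<gamma> = {u. set_borel_measurable lebesgue \<Omega> u \<and>
     set_integrable lebesgue \<Omega> (\<lambda>x. \<bar>u x\<bar> * bdist \<Omega> x powr \<gamma>)}"

definition L1w_norm :: "'a::euclidean_space set \<Rightarrow> real \<Rightarrow> ('a \<Rightarrow> real) \<Rightarrow> real" where
  "L1w_norm \<Omega> \<gamma> u = (LINT x:\<Omega>|lebesgue. \<bar>u x\<bar> * bdist \<Omega> x powr \<gamma>)"

definition weighted_Linf :: "'a::euclidean_space set \<Rightarrow> real \<Rightarrow> ('a \<Rightarrow> real) set" where
  "weighted_Linf \<Omega> \<gamma> = {\<xi>. \<exists>w\<in>Linf \<Omega>. \<forall>x\<in>\<Omega>. \<xi> x = bdist \<Omega> x powr \<gamma> * w x}"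

text \<open>
  For \<open>s < 1\<close> this is the Gagliardo (Slobodeckij) space. For \<open>s = 1\<close> it is the Sobolev space
  \<open>W\<^sup>1\<^sup>,\<^sup>2(\<Omega>)\<close>, defined by weak partial derivatives: there the Gagliardo seminorm is finite only for
  constants and does not describe \<open>H\<^sup>1(\<Omega>)\<close>.
\<close>
definition Hs :: "'a::euclidean_space set \<Rightarrow> real \<Rightarrow> ('a \<Rightarrow> real) set" where
  "Hs \<Omega> s = {u \<in> L2 \<Omega>.
     if s < 1 then
       set_integrable lebesgue (\<Omega> \<times> \<Omega>)
         (\<lambda>(x, y). (u x - u y)\<^sup>2 / dist x y powr (real DIM('a) + 2 * s))
     else
       (\<forall>b\<in>Basis. \<exists>w\<in>L2 \<Omega>. \<forall>\<phi>\<in>test_fun \<Omega>.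
          (LINT x:\<Omega>|lebesgue. u x * frechet_derivative \<phi> (at x) b) = - (LINT x:\<Omega>|lebesgue. w x * \<phi> x))}"

definition Hs00 :: "'a::euclidean_space set \<Rightarrow> real \<Rightarrow> ('a \<Rightarrow> real) set" where
  "Hs00 \<Omega> s = {u \<in> Hs \<Omega> s. (\<lambda>x. u x / bdist \<Omega> x powr s) \<in> L2 \<Omega>}"

section \<open>The operator\<close>

text \<open>
  The kernels \<open>J\<close> and \<open>G\<close> below are real-valued functions; their values on the diagonal are
  arbitrary and never constrained.
\<close>

definition L_eps :: "'a::euclidean_space set \<Rightarrow> ('a \<Rightarrow> 'a \<Rightarrow> real) \<Rightarrow> ('a \<Rightarrow> real) \<Rightarrow>
    real \<Rightarrow> ('a \<Rightarrow> real) \<Rightarrow> 'a \<Rightarrow> real" where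
  "L_eps \<Omega> J B \<epsilon> u x =
     (LINT y:{y\<in>\<Omega>. dist x y > \<epsilon>}|lebesgue. J x y * (u x - u y)) + B x * u x"

definition L_op :: "'a::euclidean_space set \<Rightarrow> ('a \<Rightarrow> 'a \<Rightarrow> real) \<Rightarrow> ('a \<Rightarrow> real) \<Rightarrow>
    ('a \<Rightarrow> real) \<Rightarrow> 'a \<Rightarrow> real" where
  "L_op \<Omega> J B u x = Lim (at_right 0) (\<lambda>\<epsilon>. L_eps \<Omega> J B \<epsilon> u x)"

definition cond_L1 :: "'a::euclidean_space set \<Rightarrow> ('a \<Rightarrow> 'a \<Rightarrow> real) \<Rightarrow> ('a \<Rightarrow> real) \<Rightarrow> bool" where
  "cond_L1 \<Omega> J B \<longleftrightarrow>
     set_borel_measurable lebesgue (\<Omega> \<times> \<Omega>) (\<lambda>(x, y). J x y) \<and>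
     (\<forall>x\<in>\<Omega>. \<forall>y\<in>\<Omega>. x \<noteq> y \<longrightarrow> 0 \<le> J x y \<and> J x y = J y x) \<and>
     set_integrable lebesgue (\<Omega> \<times> \<Omega>) (\<lambda>(x, y). (dist x y)\<^sup>2 * J x y) \<and>
     set_borel_measurable lebesgue \<Omega> B \<and>
     (\<forall>x\<in>\<Omega>. 0 \<le> B x) \<and>
     (\<forall>K. compact K \<and> K \<subseteq> \<Omega> \<longrightarrow> (\<exists>M. \<forall>x\<in>K. B x \<le> M)) \<and>
     (\<forall>u\<in>test_fun \<Omega>.
        (AE x in lebesgue. x \<in> \<Omega> \<longrightarrow> (\<exists>l. ((\<lambda>\<epsilon>. L_eps \<Omega> J B \<epsilon> u x) \<longlongrightarrow> l) (at_right 0))) \<and>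
        L_op \<Omega> J B u \<in> L2 \<Omega>)"

definition cond_L2 :: "'a::euclidean_space set \<Rightarrow> ('a \<Rightarrow> 'a \<Rightarrow> real) \<Rightarrow> ('a \<Rightarrow> real) \<Rightarrow> bool" where
  "cond_L2 \<Omega> J B \<longleftrightarrow>
     (\<forall>u\<in>test_fun \<Omega>. \<exists>\<phi>\<in>L1_loc \<Omega>. \<exists>\<epsilon>\<^sub>0>0. \<forall>\<epsilon>\<in>{0<..\<epsilon>\<^sub>0}.
        AE x in lebesgue. x \<in> \<Omega> \<longrightarrow> \<bar>L_eps \<Omega> J B \<epsilon> u x\<bar> \<le> \<phi> x)"

definition cond_L3 :: "'a::euclidean_space set \<Rightarrow> ('a \<Rightarrow> 'a \<Rightarrow> real) \<Rightarrow> ('a \<Rightarrow> real) \<Rightarrow> bool" where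
  "cond_L3 \<Omega> J B \<longleftrightarrow>
     (\<exists>\<Lambda>>0. \<forall>u\<in>test_fun \<Omega>.
        (LINT x:\<Omega>|lebesgue. (u x)\<^sup>2) \<le> \<Lambda> * (LINT x:\<Omega>|lebesgue. L_op \<Omega> J B u x * u x))"

definition form_E :: "'a::euclidean_space set \<Rightarrow> ('a \<Rightarrow> 'a \<Rightarrow> real) \<Rightarrow> ('a \<Rightarrow> real) \<Rightarrow>
    ('a \<Rightarrow> real) \<Rightarrow> ('a \<Rightarrow> real) \<Rightarrow> real" where
  "form_E \<Omega> J B u v =
     1/2 * (LINT p:\<Omega>\<times>\<Omega>|lebesgue. (case p of (x, y) \<Rightarrow> J x y * (u x - u y) * (v x - v y)))
     + (LINT x:\<Omega>|lebesgue. B x * u x * v x)"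

text \<open>The two integrability conditions express that \<open>form_E \<Omega> J B u u\<close> is finite.\<close>
definition dom_E :: "'a::euclidean_space set \<Rightarrow> ('a \<Rightarrow> 'a \<Rightarrow> real) \<Rightarrow> ('a \<Rightarrow> real) \<Rightarrow>
    ('a \<Rightarrow> real) set" where
  "dom_E \<Omega> J B = {u \<in> L2 \<Omega>.
     set_integrable lebesgue (\<Omega> \<times> \<Omega>) (\<lambda>(x, y). J x y * (u x - u y)\<^sup>2) \<and>
     set_integrable lebesgue \<Omega> (\<lambda>x. B x * (u x)\<^sup>2)}"

definition space_H :: "'a::euclidean_space set \<Rightarrow> ('a \<Rightarrow> 'a \<Rightarrow> real) \<Rightarrow> ('a \<Rightarrow> real) \<Rightarrow>
    ('a \<Rightarrow> real) set" where
  "space_H \<Omega> J B = {u \<in> dom_E \<Omega> J B. \<forall>e>0. \<exists>\<phi>\<in>test_fun \<Omega> \<inter> dom_E \<Omega> J B.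
     (LINT x:\<Omega>|lebesgue. (u x - \<phi> x)\<^sup>2)
       + form_E \<Omega> J B (\<lambda>x. u x - \<phi> x) (\<lambda>x. u x - \<phi> x) < e\<^sup>2}"

definition cond_L4 :: "'a::euclidean_space set \<Rightarrow> real \<Rightarrow> ('a \<Rightarrow> 'a \<Rightarrow> real) \<Rightarrow> ('a \<Rightarrow> real) \<Rightarrow> bool"
  where "cond_L4 \<Omega> s J B \<longleftrightarrow> space_H \<Omega> J B = Hs00 \<Omega> s"

section \<open>The Green kernel\<close>

definition variational_sol :: "'a::euclidean_space set \<Rightarrow> ('a \<Rightarrow> 'a \<Rightarrow> real) \<Rightarrow> ('a \<Rightarrow> real) \<Rightarrow>
    ('a \<Rightarrow> real) \<Rightarrow> ('a \<Rightarrow> real) \<Rightarrow> bool" where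
  "variational_sol \<Omega> J B f u \<longleftrightarrow> u \<in> space_H \<Omega> J B \<and>
     (\<forall>v\<in>space_H \<Omega> J B. form_E \<Omega> J B u v = (LINT x:\<Omega>|lebesgue. f x * v x))"

definition green_fun :: "'a::euclidean_space set \<Rightarrow> ('a \<Rightarrow> 'a \<Rightarrow> real) \<Rightarrow> ('a \<Rightarrow> real) \<Rightarrow> 'a \<Rightarrow> real"
  where "green_fun \<Omega> G f x = (LINT y:\<Omega>|lebesgue. G x y * f y)"

definition kernel_bound :: "'a::euclidean_space set \<Rightarrow> real \<Rightarrow> real \<Rightarrow> 'a \<Rightarrow> 'a \<Rightarrow> real" where
  "kernel_bound \<Omega> s \<gamma> x y =
     1 / dist x y powr (real DIM('a) - 2 * s)
     * (min (bdist \<Omega> x / dist x y) 1) powr \<gamma> * (min (bdist \<Omega> y / dist x y) 1) powr \<gamma>"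

text \<open>
  The parameter \<open>c\<close> is the comparison constant. That the variational solution with datum \<open>f\<close> is
  unique, so that it is the value at \<open>f\<close> of the Green operator, follows from \<open>cond_L3\<close>.
\<close>
definition cond_G1 :: "'a::euclidean_space set \<Rightarrow> real \<Rightarrow> real \<Rightarrow> real \<Rightarrow> ('a \<Rightarrow> 'a \<Rightarrow> real) \<Rightarrow>
    ('a \<Rightarrow> real) \<Rightarrow> ('a \<Rightarrow> 'a \<Rightarrow> real) \<Rightarrow> bool" where
  "cond_G1 \<Omega> s \<gamma> c J B G \<longleftrightarrow>
     (\<forall>f\<in>L2 \<Omega>. variational_sol \<Omega> J B f (green_fun \<Omega> G f)) \<and>
     (\<lambda>(x, y). G x y) \<in> borel_measurable (restrict_space borel {(x, y). x \<in> \<Omega> \<and> y \<in> \<Omega> \<and> x \<noteq> y}) \<and>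
     (\<forall>x\<in>\<Omega>. \<forall>y\<in>\<Omega>. x \<noteq> y \<longrightarrow> 0 < G x y \<and> G x y = G y x \<and>
        inverse c * kernel_bound \<Omega> s \<gamma> x y \<le> G x y \<and> G x y \<le> c * kernel_bound \<Omega> s \<gamma> x y)"

definition cond_G2 :: "'a::euclidean_space set \<Rightarrow> ('a \<Rightarrow> 'a \<Rightarrow> real) \<Rightarrow> bool" where
  "cond_G2 \<Omega> G \<longleftrightarrow> continuous_on {(x, y). x \<in> \<Omega> \<and> y \<in> \<Omega> \<and> x \<noteq> y} (\<lambda>(x, y). G x y)"

definition cond_G3 :: "'a::euclidean_space set \<Rightarrow> real \<Rightarrow> ('a \<Rightarrow> 'a \<Rightarrow> real) \<Rightarrow> bool" where
  "cond_G3 \<Omega> \<gamma> G \<longleftrightarrow>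
     (\<exists>M. (\<forall>x\<^sub>0\<in>\<Omega>. \<forall>z\<^sub>0\<in>frontier \<Omega>. 0 < M x\<^sub>0 z\<^sub>0 \<and>
             ((\<lambda>(x, y). G x y / bdist \<Omega> y powr \<gamma>) \<longlongrightarrow> M x\<^sub>0 z\<^sub>0) (at (x\<^sub>0, z\<^sub>0) within \<Omega> \<times> \<Omega>)) \<and>
          continuous_on (\<Omega> \<times> frontier \<Omega>) (\<lambda>(x, z). M x z))"

section \<open>Signed Radon measures\<close>

text \<open>
  A signed Radon measure on \<open>\<Omega>\<close> need not assign a value to every Borel subset of \<open>\<Omega>\<close>, since its
  positive and negative parts may both have infinite mass. It is a real-valued, countably additive
  function on the Borel sets that are relatively compact in \<open>\<Omega>\<close>.
\<close>
definition relcompact_borel :: "'a::euclidean_space set \<Rightarrow> 'a set set" where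
  "relcompact_borel \<Omega> = {A \<in> sets borel. compact (closure A) \<and> closure A \<subseteq> \<Omega>}"

definition signed_radon :: "'a::euclidean_space set \<Rightarrow> ('a set \<Rightarrow> real) \<Rightarrow> bool" where
  "signed_radon \<Omega> \<mu> \<longleftrightarrow>
     (\<forall>A :: nat \<Rightarrow> 'a set. range A \<subseteq> relcompact_borel \<Omega> \<and> disjoint_family A \<and>
        (\<Union>i. A i) \<in> relcompact_borel \<Omega> \<longrightarrow> (\<lambda>i. \<mu> (A i)) sums \<mu> (\<Union>i. A i))"

text \<open>
  The positive part is \<open>\<mu>\<^sup>+(A) = sup {\<mu>(B) | B \<subseteq> A}\<close>. The empty set is among the \<open>B\<close>, so it is
  harmless that \<open>ennreal\<close> truncates negative values to 0.
\<close>
definition pos_part :: "'a::euclidean_space set \<Rightarrow> ('a set \<Rightarrow> real) \<Rightarrow> 'a measure" where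
  "pos_part \<Omega> \<mu> = measure_of \<Omega> {A \<in> sets borel. A \<subseteq> \<Omega>}
     (\<lambda>A. SUP B\<in>{B \<in> relcompact_borel \<Omega>. B \<subseteq> A}. ennreal (\<mu> B))"

definition neg_part :: "'a::euclidean_space set \<Rightarrow> ('a set \<Rightarrow> real) \<Rightarrow> 'a measure" where
  "neg_part \<Omega> \<mu> = pos_part \<Omega> (\<lambda>A. - \<mu> A)"

text \<open>The weighted total variation, by \<open>\<bar>\<mu>\<bar> = \<mu>\<^sup>+ + \<mu>\<^sup>-\<close>.\<close>
definition weighted_var :: "'a::euclidean_space set \<Rightarrow> real \<Rightarrow> ('a set \<Rightarrow> real) \<Rightarrow> ennreal" where
  "weighted_var \<Omega> \<gamma> \<mu> =
     (\<integral>\<^sup>+x. ennreal (bdist \<Omega> x powr \<gamma>) \<partial>pos_part \<Omega> \<mu>) + (\<integral>\<^sup>+x. ennreal (bdist \<Omega> x powr \<gamma>) \<partial>neg_part \<Omega> \<mu>)"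

definition Mw :: "'a::euclidean_space set \<Rightarrow> real \<Rightarrow> ('a set \<Rightarrow> real) set" where
  "Mw \<Omega> \<gamma> = {\<mu>. signed_radon \<Omega> \<mu> \<and> weighted_var \<Omega> \<gamma> \<mu> < \<infinity>}"

definition Mw_norm :: "'a::euclidean_space set \<Rightarrow> real \<Rightarrow> ('a set \<Rightarrow> real) \<Rightarrow> real" where
  "Mw_norm \<Omega> \<gamma> \<mu> = enn2real (weighted_var \<Omega> \<gamma> \<mu>)"

definition signed_le :: "'a::euclidean_space set \<Rightarrow> ('a set \<Rightarrow> real) \<Rightarrow> ('a set \<Rightarrow> real) \<Rightarrow> bool" where
  "signed_le \<Omega> \<mu> \<nu> \<longleftrightarrow> (\<forall>A\<in>relcompact_borel \<Omega>. \<mu> A \<le> \<nu> A)"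

definition signed_integral :: "'a::euclidean_space set \<Rightarrow> ('a set \<Rightarrow> real) \<Rightarrow> ('a \<Rightarrow> real) \<Rightarrow> real" where
  "signed_integral \<Omega> \<mu> h = (\<integral>x. h x \<partial>pos_part \<Omega> \<mu>) - (\<integral>x. h x \<partial>neg_part \<Omega> \<mu>)"

section \<open>Weak-dual solutions\<close>

text \<open>Since \<open>G\<close> is undefined on the diagonal, this is meaningful only for \<open>x\<close> that is not an atom
  of the (nonnegative) measure \<open>\<nu>\<close>, hence for almost every \<open>x\<close>.\<close>
definition green_meas :: "('a::euclidean_space \<Rightarrow> 'a \<Rightarrow> real) \<Rightarrow> 'a measure \<Rightarrow> 'a \<Rightarrow> real" where
  "green_meas G \<nu> x = (\<integral>y. G x y \<partial>\<nu>)"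

definition weak_dual_sol :: "'a::euclidean_space set \<Rightarrow> real \<Rightarrow> ('a \<Rightarrow> 'a \<Rightarrow> real) \<Rightarrow>
    (real \<Rightarrow> real) \<Rightarrow> ('a set \<Rightarrow> real) \<Rightarrow> ('a \<Rightarrow> real) \<Rightarrow> bool" where
  "weak_dual_sol \<Omega> \<gamma> G g \<mu> u \<longleftrightarrow>
     u \<in> L1w \<Omega> \<gamma> \<and> (\<lambda>x. g (u x)) \<in> L1w \<Omega> \<gamma> \<and>
     (\<forall>\<xi>\<in>weighted_Linf \<Omega> \<gamma>.
        (LINT x:\<Omega>|lebesgue. u x * \<xi> x) + (LINT x:\<Omega>|lebesgue. g (u x) * green_fun \<Omega> G \<xi> x)
        = signed_integral \<Omega> \<mu> (green_fun \<Omega> G \<xi>))"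

definition p_star :: "nat \<Rightarrow> real \<Rightarrow> real \<Rightarrow> real" where
  "p_star N s \<gamma> = (real N + \<gamma>) / (real N + \<gamma> - 2 * s)"

end

theory Submission
  imports Defs
begin

text \<open>
  Uniqueness, comparison and the a priori bounds all come from one linear duality argument, which avoids
  Kato's inequality and any approximation of the measures. If \<open>w\<close> and \<open>f\<close> satisfy
  \<open>\<integral> w \<xi> + \<integral> f \<G>[\<xi>] \<le> 0\<close> whenever \<open>\<G>[\<xi>] \<ge> 0\<close>, and \<open>f \<ge> 0\<close> where \<open>w \<ge> 0\<close>, write \<open>f \<ge> a w\<close> with
  \<open>a \<ge> 0\<close>, truncate \<open>a\<close> at height \<open>n\<close>, solve \<open>q + a\<^sub>n \<G>[q] = \<xi>\<close> with \<open>0 \<le> \<G>[q] \<le> \<G>[\<xi>]\<close>, and test with \<open>q\<close>: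
  in the limit \<open>\<integral> w \<xi> \<le> 0\<close> for all \<open>\<xi> > 0\<close>, so \<open>w \<le> 0\<close>.

  Equations \<open>q = k(x, \<G>[q])\<close> with \<open>k\<close> Lipschitz and nonincreasing are solved by a relaxed iteration that
  contracts the energy \<open>\<integral> q \<G>[q]\<close>. A general \<open>g\<close> is reached by truncating its positive and
  negative parts separately; the solutions are monotone in each truncation parameter and stay between
  \<open>- \<G>[\<mu>\<^sup>-]\<close> and \<open>\<G>[\<mu>\<^sup>+]\<close>. Domination is supplied by \<open>g(\<plusminus>\<G>[\<mu>\<^sup>\<plusminus>]) \<in> L\<^sup>1(\<delta>\<^sup>\<gamma>)\<close>, which follows from the weak
  \<open>L\<^sup>p\<close> bound of exponent \<open>p\<^sup>*\<close> for Green potentials and the growth condition on \<open>g\<close>.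

  The operator enters only through the nonnegativity of \<open>\<integral> q \<G>[q]\<close> and the inequality
  \<open>\<integral> q (\<G>[q])\<^sup>- \<le> 0\<close>, obtained by testing the variational equation with smooth nonincreasing functions of
  test functions approximating \<open>\<G>[q]\<close>.
\<close>

section \<open>Green operators of symmetric kernels on weighted spaces\<close>

text \<open>One inequality carries the estimates: G[\<delta>^\<gamma>] is at most a constant times
  \<delta>^\<gamma>. It keeps the test class stable under the Green operator, it is the weight in
  Schur's test, and it bounds the norm of u. The reverse inequality bounds the norm of g(u). Both
  constants are made from \<Omega>, s, \<gamma> and the comparison constant alone, so C can be
  chosen before the operator and g are given. An iteration contracting in a norm of functions would
  restrict the Lipschitz constant of the nonlinearity. The energy does not: there the monotonicity
  of the nonlinearity gives the cross term a sign, and a small relaxation parameter absorbs the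
  rest. The obstacle is that the data may charge Lebesgue null sets, whereas the energy argument
  gives G[q] >= 0 only almost everywhere. Continuity of G[q] closes this gap, and for the same
  reason potentials of test functions are handled at every point. The converse difficulty, that the
  kernel has arbitrary values on the diagonal, is met by setting it to 0 there; a potential of a
  measure is affected only at atoms, which form a Lebesgue null set.\<close>

locale green_kernel = finite_measure M for M :: "'b measure" +
  fixes \<kappa> :: "'b \<Rightarrow> 'b \<Rightarrow> real" and d :: "'b \<Rightarrow> real" and K D :: real
  assumes kernel_measurable [measurable]: "case_prod \<kappa> \<in> borel_measurable (M \<Otimes>\<^sub>M M)"
    and kernel_nonneg: "\<And>x y. x \<in> space M \<Longrightarrow> y \<in> space M \<Longrightarrow> 0 \<le> \<kappa> x y"
    and kernel_sym: "\<And>x y. x \<in> space M \<Longrightarrow> y \<in> space M \<Longrightarrow> \<kappa> x y = \<kappa> y x"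
    and weight_measurable [measurable]: "d \<in> borel_measurable M"
    and weight_pos: "\<And>x. x \<in> space M \<Longrightarrow> 0 < d x"
    and weight_le: "\<And>x. x \<in> space M \<Longrightarrow> d x \<le> D"
    and K_pos: "0 < K"
    and kernel_weight: "\<And>x. x \<in> space M \<Longrightarrow> (\<integral>\<^sup>+y. ennreal (\<kappa> x y * d y) \<partial>M) \<le> ennreal (K * d x)"
begin

text \<open>The bound is imposed at every point, so that estimates on this class have no exceptional
  sets. \<open>weighted_Linf_S\<close> passes from the almost-everywhere class to this one.\<close>

definition S :: "('b \<Rightarrow> real) set" where
  "S = {\<xi> \<in> borel_measurable M. \<exists>m. \<forall>x\<in>space M. \<bar>\<xi> x\<bar> \<le> m * d x}"

definition L1d :: "('b \<Rightarrow> real) set" where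
  "L1d = {f \<in> borel_measurable M. integrable M (\<lambda>x. f x * d x)}"

definition green :: "('b \<Rightarrow> real) \<Rightarrow> 'b \<Rightarrow> real" where
  "green f x = (\<integral>y. \<kappa> x y * f y \<partial>M)"

lemma S_measurable [measurable_dest]: "\<xi> \<in> S \<Longrightarrow> \<xi> \<in> borel_measurable M"
  by (simp add: S_def)

lemma L1d_measurable [measurable_dest]: "f \<in> L1d \<Longrightarrow> f \<in> borel_measurable M"
  by (simp add: L1d_def)

lemma S_I: "\<xi> \<in> borel_measurable M \<Longrightarrow> (\<And>x. x \<in> space M \<Longrightarrow> \<bar>\<xi> x\<bar> \<le> m * d x) \<Longrightarrow> \<xi> \<in> S"
  by (auto simp: S_def)

lemma S_E:
  assumes "\<xi> \<in> S"
  obtains m where "0 < m" "\<And>x. x \<in> space M \<Longrightarrow> \<bar>\<xi> x\<bar> \<le> m * d x"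
proof -
  obtain m where m: "\<And>x. x \<in> space M \<Longrightarrow> \<bar>\<xi> x\<bar> \<le> m * d x"
    using assms by (auto simp: S_def)
  have "\<bar>\<xi> x\<bar> \<le> (max m 1) * d x" if "x \<in> space M" for x
    using m[OF that] weight_pos[OF that] mult_right_mono[of m "max m 1" "d x"] by linarith
  then show thesis using that[of "max m 1"] by auto
qed

lemma weight_in_S: "d \<in> S"
  by (rule S_I[where m=1]) (auto dest: weight_pos)

lemma S_add: assumes "\<xi> \<in> S" "\<eta> \<in> S" shows "(\<lambda>x. \<xi> x + \<eta> x) \<in> S"
proof -
  obtain m1 m2 where m: "\<And>x. x \<in> space M \<Longrightarrow> \<bar>\<xi> x\<bar> \<le> m1 * d x"
      "\<And>x. x \<in> space M \<Longrightarrow> \<bar>\<eta> x\<bar> \<le> m2 * d x"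
    using assms by (auto elim!: S_E)
  have "\<bar>\<xi> x + \<eta> x\<bar> \<le> (m1 + m2) * d x" if "x \<in> space M" for x
    using m[OF that] by (simp add: distrib_right)
  then show ?thesis using assms
    by (intro S_I[where m="m1 + m2"]) (auto intro!: borel_measurable_add S_measurable)
qed

lemma S_bound:
  assumes "\<xi> \<in> S" "\<eta> \<in> borel_measurable M" "\<And>x. x \<in> space M \<Longrightarrow> \<bar>\<eta> x\<bar> \<le> c * \<bar>\<xi> x\<bar>"
  shows "\<eta> \<in> S"
proof -
  obtain m where m: "0 < m" "\<And>x. x \<in> space M \<Longrightarrow> \<bar>\<xi> x\<bar> \<le> m * d x"
    using assms(1) by (auto elim!: S_E)
  have "\<bar>\<eta> x\<bar> \<le> (\<bar>c\<bar> * m) * d x" if "x \<in> space M" for x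
  proof -
    have "\<bar>\<eta> x\<bar> \<le> \<bar>c\<bar> * \<bar>\<xi> x\<bar>"
      by (rule order_trans[OF assms(3)[OF that]]) (simp add: mult_right_mono)
    also have "\<dots> \<le> \<bar>c\<bar> * (m * d x)" by (simp add: mult_left_mono m(2) that)
    finally show ?thesis by (simp add: mult.assoc)
  qed
  then show ?thesis using assms(2) S_I by blast
qed

lemma S_scale: "\<xi> \<in> S \<Longrightarrow> (\<lambda>x. a * \<xi> x) \<in> S"
  by (rule S_bound[where c="\<bar>a\<bar>"]) (auto simp: abs_mult)

lemma S_lincomb: "\<xi> \<in> S \<Longrightarrow> \<eta> \<in> S \<Longrightarrow> (\<lambda>x. a * \<xi> x + b * \<eta> x) \<in> S"
  by (intro S_add S_scale)

lemma L1d_times_S: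
  assumes "f \<in> L1d" "\<xi> \<in> S" shows "integrable M (\<lambda>x. f x * \<xi> x)"
proof -
  obtain m where m: "0 < m" "\<And>x. x \<in> space M \<Longrightarrow> \<bar>\<xi> x\<bar> \<le> m * d x"
    using assms(2) by (auto elim!: S_E)
  have "integrable M (\<lambda>x. m * (f x * d x))" using assms by (simp add: L1d_def)
  then show ?thesis
  proof (rule Bochner_Integration.integrable_bound)
    show "(\<lambda>x. f x * \<xi> x) \<in> borel_measurable M" using assms by measurable
    show "AE x in M. norm (f x * \<xi> x) \<le> norm (m * (f x * d x))"
    proof (rule AE_I2)
      fix x assume "x \<in> space M"
      then show "norm (f x * \<xi> x) \<le> norm (m * (f x * d x))"
        using m weight_pos[of x] mult_left_mono[of "\<bar>\<xi> x\<bar>" "m * d x" "\<bar>f x\<bar>"]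
        by (simp add: abs_mult mult_ac)
    qed
  qed
qed

lemma S_subset_L1d: assumes "\<xi> \<in> S" shows "\<xi> \<in> L1d"
proof -
  obtain m where m: "0 < m" "\<And>x. x \<in> space M \<Longrightarrow> \<bar>\<xi> x\<bar> \<le> m * d x"
    using assms by (auto elim!: S_E)
  have "integrable M (\<lambda>x. \<xi> x * d x)"
  proof (rule integrable_const_bound[where B="m * D * D"])
    show "AE x in M. norm (\<xi> x * d x) \<le> m * D * D"
    proof (rule AE_I2)
      fix x assume x: "x \<in> space M"
      have "\<bar>\<xi> x\<bar> * d x \<le> (m * D) * D"
        using m x weight_pos[OF x] weight_le[OF x]
        by (intro mult_mono order_trans[OF m(2)[OF x]] mult_left_mono) auto
      then show "norm (\<xi> x * d x) \<le> m * D * D" using weight_pos[OF x] by (simp add: abs_mult)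
    qed
  qed (use assms in measurable)
  then show ?thesis using assms by (simp add: L1d_def S_measurable)
qed

lemma L1d_bound:
  assumes "f \<in> L1d" "h \<in> borel_measurable M" "AE x in M. \<bar>h x\<bar> \<le> \<bar>f x\<bar>" shows "h \<in> L1d"
proof -
  have "integrable M (\<lambda>x. h x * d x)"
  proof (rule Bochner_Integration.integrable_bound)
    show "integrable M (\<lambda>x. f x * d x)" using assms by (simp add: L1d_def)
    show "AE x in M. norm (h x * d x) \<le> norm (f x * d x)"
      using assms(3) by eventually_elim (simp add: abs_mult mult_right_mono)
  qed (use assms in measurable)
  then show ?thesis using assms by (simp add: L1d_def)
qed

lemma L1d_add: "f \<in> L1d \<Longrightarrow> h \<in> L1d \<Longrightarrow> (\<lambda>x. f x + h x) \<in> L1d"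
  and L1d_diff: "f \<in> L1d \<Longrightarrow> h \<in> L1d \<Longrightarrow> (\<lambda>x. f x - h x) \<in> L1d"
  and L1d_minus: "f \<in> L1d \<Longrightarrow> (\<lambda>x. - f x) \<in> L1d"
  and L1d_abs: "f \<in> L1d \<Longrightarrow> (\<lambda>x. \<bar>f x\<bar>) \<in> L1d"
proof -
  show "f \<in> L1d \<Longrightarrow> h \<in> L1d \<Longrightarrow> (\<lambda>x. f x + h x) \<in> L1d"
    by (auto simp add: L1d_def distrib_right)
  show "f \<in> L1d \<Longrightarrow> h \<in> L1d \<Longrightarrow> (\<lambda>x. f x - h x) \<in> L1d"
    by (auto simp add: L1d_def left_diff_distrib)
  show "f \<in> L1d \<Longrightarrow> (\<lambda>x. - f x) \<in> L1d"
    by (simp add: L1d_def)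
  show "f \<in> L1d \<Longrightarrow> (\<lambda>x. \<bar>f x\<bar>) \<in> L1d"
    by (rule L1d_bound[of f]) (auto intro!: borel_measurable_abs L1d_measurable)
qed

lemma L1d_zero: "(\<lambda>_. 0) \<in> L1d"
  by (simp add: L1d_def)

lemma kernel_section [measurable (raw)]: "x \<in> space M \<Longrightarrow> \<kappa> x \<in> borel_measurable M"
  using measurable_compose_Pair1[OF _ kernel_measurable, of x] by simp

lemma integrable_kernel_weight:
  assumes "x \<in> space M"
  shows "integrable M (\<lambda>y. \<kappa> x y * d y)" "(\<integral>y. \<kappa> x y * d y \<partial>M) \<le> K * d x"
proof -
  note [measurable] = kernel_section[OF assms]
  have nn: "AE y in M. 0 \<le> \<kappa> x y * d y"
    using kernel_nonneg[OF assms] weight_pos by (auto intro!: AE_I2 mult_nonneg_nonneg simp: less_imp_le)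
  show i: "integrable M (\<lambda>y. \<kappa> x y * d y)"
    by (rule integrableI_nonneg)
      (use nn kernel_weight[OF assms] in \<open>auto simp: top.not_eq_extremum intro: le_less_trans ennreal_less_top\<close>)
  have "ennreal (\<integral>y. \<kappa> x y * d y \<partial>M) \<le> ennreal (K * d x)"
    using kernel_weight[OF assms] by (subst nn_integral_eq_integral[OF i nn, symmetric])
  then show "(\<integral>y. \<kappa> x y * d y \<partial>M) \<le> K * d x"
    using K_pos weight_pos[OF assms] by (subst (asm) ennreal_le_iff) auto
qed

lemma integrable_kernel:
  assumes "x \<in> space M" "\<xi> \<in> S" shows "integrable M (\<lambda>y. \<kappa> x y * \<xi> y)"
proof -
  note [measurable] = kernel_section[OF assms(1)]
  obtain m where m: "0 < m" "\<And>x. x \<in> space M \<Longrightarrow> \<bar>\<xi> x\<bar> \<le> m * d x"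
    using assms(2) by (auto elim!: S_E)
  have "integrable M (\<lambda>y. m * (\<kappa> x y * d y))" using integrable_kernel_weight[OF assms(1)] by simp
  then show ?thesis
  proof (rule Bochner_Integration.integrable_bound)
    show "AE y in M. norm (\<kappa> x y * \<xi> y) \<le> norm (m * (\<kappa> x y * d y))"
    proof (rule AE_I2)
      fix y assume y: "y \<in> space M"
      then show "norm (\<kappa> x y * \<xi> y) \<le> norm (m * (\<kappa> x y * d y))"
        using m weight_pos[of y] mult_left_mono[of "\<bar>\<xi> y\<bar>" "m * d y" "\<bar>\<kappa> x y\<bar>"]
        by (simp add: abs_mult mult_ac)
    qed
  qed (use assms in measurable)
qed

lemma green_measurable [measurable (raw)]:
  assumes [measurable]: "f \<in> borel_measurable M"
  shows "green f \<in> borel_measurable M"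
  unfolding green_def by (rule borel_measurable_lebesgue_integral) measurable

lemma green_bound:
  assumes "x \<in> space M" "\<xi> \<in> borel_measurable M" "\<And>y. y \<in> space M \<Longrightarrow> \<bar>\<xi> y\<bar> \<le> m * d y"
  shows "\<bar>green \<xi> x\<bar> \<le> m * K * d x"
proof -
  have S: "\<xi> \<in> S" using assms by (auto intro: S_I)
  have "\<bar>green \<xi> x\<bar> \<le> (\<integral>y. \<bar>\<kappa> x y * \<xi> y\<bar> \<partial>M)"
    unfolding green_def by (rule integral_abs_bound)
  also have "\<dots> \<le> (\<integral>y. m * (\<kappa> x y * d y) \<partial>M)"
  proof (rule integral_mono)
    show "integrable M (\<lambda>y. \<bar>\<kappa> x y * \<xi> y\<bar>)" using integrable_kernel[OF assms(1) S] by simp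
    show "integrable M (\<lambda>y. m * (\<kappa> x y * d y))" using integrable_kernel_weight[OF assms(1)] by simp
    fix y assume "y \<in> space M"
    then show "\<bar>\<kappa> x y * \<xi> y\<bar> \<le> m * (\<kappa> x y * d y)"
      using assms(3)[of y] kernel_nonneg[OF assms(1), of y] mult_left_mono[of "\<bar>\<xi> y\<bar>" "m * d y" "\<kappa> x y"]
      by (simp add: abs_mult mult_ac)
  qed
  also have "\<dots> = m * (\<integral>y. \<kappa> x y * d y \<partial>M)" by simp
  also have "\<dots> \<le> m * (K * d x)"
  proof (rule mult_left_mono)
    show "(\<integral>y. \<kappa> x y * d y \<partial>M) \<le> K * d x" by (rule integrable_kernel_weight[OF assms(1)])
    \<comment> \<open>The sign of \<open>m\<close> is not assumed; it follows from the bound at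
      \<open>x\<close> itself because the weight is positive.\<close>
    have "0 \<le> m * d x" using assms(3)[OF assms(1)] by linarith
    then show "0 \<le> m" using weight_pos[OF assms(1)] by (simp add: zero_le_mult_iff)
  qed
  finally show ?thesis by (simp add: mult_ac)
qed

lemma green_in_S: assumes "\<xi> \<in> S" shows "green \<xi> \<in> S"
proof -
  obtain m where "\<And>x. x \<in> space M \<Longrightarrow> \<bar>\<xi> x\<bar> \<le> m * d x"
    using assms by (auto elim!: S_E)
  then show ?thesis using assms green_bound[of _ \<xi> m]
    by (intro S_I[where m="m * K"]) (auto intro: S_measurable green_measurable)
qed

lemma green_lincomb:
  assumes "x \<in> space M" "\<xi> \<in> S" "\<eta> \<in> S"
  shows "green (\<lambda>y. a * \<xi> y + b * \<eta> y) x = a * green \<xi> x + b * green \<eta> x"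
proof -
  have "green (\<lambda>y. a * \<xi> y + b * \<eta> y) x = (\<integral>y. a * (\<kappa> x y * \<xi> y) + b * (\<kappa> x y * \<eta> y) \<partial>M)"
    unfolding green_def by (simp add: algebra_simps)
  then show ?thesis
    using assms by (simp add: green_def integrable_kernel)
qed

lemma green_mono:
  assumes "x \<in> space M" "\<xi> \<in> S" "\<eta> \<in> S" "AE y in M. \<xi> y \<le> \<eta> y"
  shows "green \<xi> x \<le> green \<eta> x"
  unfolding green_def
proof (intro integral_mono_AE integrable_kernel assms(1-3))
  show "AE y in M. \<kappa> x y * \<xi> y \<le> \<kappa> x y * \<eta> y"
    using assms(4) AE_space by eventually_elim (auto intro!: mult_left_mono kernel_nonneg assms(1))
qed

lemma green_nonneg: "x \<in> space M \<Longrightarrow> (\<And>y. y \<in> space M \<Longrightarrow> 0 \<le> \<xi> y) \<Longrightarrow> 0 \<le> green \<xi> x"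
  unfolding green_def by (rule integral_nonneg_AE) (auto intro!: AE_I2 mult_nonneg_nonneg kernel_nonneg)

lemma green_cong_AE:
  assumes "x \<in> space M" "\<xi> \<in> borel_measurable M" "\<eta> \<in> borel_measurable M" "AE y in M. \<xi> y = \<eta> y"
  shows "green \<xi> x = green \<eta> x"
proof -
  note [measurable] = kernel_section[OF assms(1)] assms(2,3)
  have "AE y in M. \<kappa> x y * \<xi> y = \<kappa> x y * \<eta> y" using assms(4) by eventually_elim simp
  then show ?thesis unfolding green_def by (intro integral_cong_AE) measurable
qed

text \<open>Fubini; the measure \<open>N\<close> is either \<open>M\<close> itself or a Radon measure on the same space.\<close>

lemma green_duality:
  assumes "sigma_finite_measure N" "space N \<subseteq> space M" "case_prod \<kappa> \<in> borel_measurable (M \<Otimes>\<^sub>M N)"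
    and f: "f \<in> borel_measurable N" "integrable N (\<lambda>y. f y * d y)" and dN: "d \<in> borel_measurable N"
  shows "AE x in M. integrable N (\<lambda>y. \<kappa> x y * f y)"
    and "(\<lambda>x. \<integral>y. \<kappa> x y * f y \<partial>N) \<in> L1d"
    and "\<xi> \<in> S \<Longrightarrow> integrable N (\<lambda>y. f y * green \<xi> y)"
    and "\<xi> \<in> S \<Longrightarrow> (\<integral>x. (\<integral>y. \<kappa> x y * f y \<partial>N) * \<xi> x \<partial>M) = (\<integral>y. f y * green \<xi> y \<partial>N)"
proof -
  interpret N: sigma_finite_measure N by fact
  interpret pair_sigma_finite N M ..
  note [measurable] = assms(3) f(1) dN
  have swap [measurable]: "(\<lambda>(y, x). \<kappa> x y) \<in> borel_measurable (N \<Otimes>\<^sub>M M)"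
    using measurable_compose[OF measurable_pair_swap' assms(3)] by (simp add: split_beta')
  \<comment> \<open>Integrate in \<open>x\<close> first: by symmetry of the kernel the inner
    integral of the absolute value is
    \<open>\<bar>f y\<bar> * green (\<lambda>x. \<bar>\<xi> x\<bar>) y\<close>, at most
    \<open>m * K * \<bar>f y\<bar> * d y\<close>, which is integrable by hypothesis.\<close>
  have main: "integrable (N \<Otimes>\<^sub>M M) (\<lambda>(y, x). \<kappa> x y * f y * \<xi> x)"
    if xi: "\<xi> \<in> S" for \<xi>
  proof (rule Fubini_integrable)
    note [measurable] = S_measurable[OF xi]
    obtain m where m: "0 < m" "\<And>x. x \<in> space M \<Longrightarrow> \<bar>\<xi> x\<bar> \<le> m * d x"
      using xi by (auto elim!: S_E)
    show [measurable]: "(\<lambda>(y, x). \<kappa> x y * f y * \<xi> x) \<in> borel_measurable (N \<Otimes>\<^sub>M M)"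
      by measurable
    show "integrable N (\<lambda>y. \<integral>x. norm (case (y, x) of (y, x) \<Rightarrow> \<kappa> x y * f y * \<xi> x) \<partial>M)"
    proof (rule Bochner_Integration.integrable_bound)
      show "integrable N (\<lambda>y. m * K * (f y * d y))" using f by simp
      show "AE y in N. norm (\<integral>x. norm (case (y, x) of (y, x) \<Rightarrow> \<kappa> x y * f y * \<xi> x) \<partial>M)
              \<le> norm (m * K * (f y * d y))"
      proof (rule AE_I2)
        fix y assume "y \<in> space N"
        then have y: "y \<in> space M" using assms(2) by auto
        have "(\<integral>x. norm (case (y, x) of (y, x) \<Rightarrow> \<kappa> x y * f y * \<xi> x) \<partial>M)
            = (\<integral>x. \<bar>f y\<bar> * (\<kappa> y x * \<bar>\<xi> x\<bar>) \<partial>M)"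
          by (rule Bochner_Integration.integral_cong) (auto simp: abs_mult kernel_sym[OF y] kernel_nonneg y)
        also have "\<dots> = \<bar>f y\<bar> * green (\<lambda>x. \<bar>\<xi> x\<bar>) y"
          by (simp add: green_def)
        finally have eq: "(\<integral>x. norm (case (y, x) of (y, x) \<Rightarrow> \<kappa> x y * f y * \<xi> x) \<partial>M)
           = \<bar>f y\<bar> * green (\<lambda>x. \<bar>\<xi> x\<bar>) y" .
        have "\<bar>green (\<lambda>x. \<bar>\<xi> x\<bar>) y\<bar> \<le> m * K * d y"
          by (rule green_bound) (use y m in auto)
        then show "norm (\<integral>x. norm (case (y, x) of (y, x) \<Rightarrow> \<kappa> x y * f y * \<xi> x) \<partial>M)
              \<le> norm (m * K * (f y * d y))"
          unfolding eq using m K_pos weight_pos[OF y]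
            mult_left_mono[of "\<bar>green (\<lambda>x. \<bar>\<xi> x\<bar>) y\<bar>" "m * K * d y" "\<bar>f y\<bar>"]
          by (simp add: abs_mult mult_ac)
      qed
    qed measurable
    show "AE y in N. integrable M (\<lambda>x. case (y, x) of (y, x) \<Rightarrow> \<kappa> x y * f y * \<xi> x)"
    proof (rule AE_I2)
      fix y assume "y \<in> space N"
      then have y: "y \<in> space M" using assms(2) by auto
      have "integrable M (\<lambda>x. f y * (\<kappa> y x * \<xi> x))" using integrable_kernel[OF y xi] by simp
      then show "integrable M (\<lambda>x. case (y, x) of (y, x) \<Rightarrow> \<kappa> x y * f y * \<xi> x)"
        by (rule Bochner_Integration.integrable_cong[THEN iffD1, rotated -1])
          (auto simp: kernel_sym[OF y])
    qed
  qed
  \<comment> \<open>The test function \<open>\<xi> = d\<close> is strictly positive, so it can be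
    divided out again.\<close>
  have "AE x in M. integrable N (\<lambda>y. \<kappa> x y * f y * d x)"
    using AE_integrable_snd[OF main[OF weight_in_S]] by simp
  then show AE: "AE x in M. integrable N (\<lambda>y. \<kappa> x y * f y)"
    using AE_space
  proof eventually_elim
    case (elim x)
    then have "integrable N (\<lambda>y. \<kappa> x y * f y * d x / d x)" by (intro integrable_divide)
    then show ?case using weight_pos[OF elim(2)] by simp
  qed
  have "integrable M (\<lambda>x. \<integral>y. \<kappa> x y * f y * d x \<partial>N)"
    using integrable_snd[OF main[OF weight_in_S]] by simp
  then show "(\<lambda>x. \<integral>y. \<kappa> x y * f y \<partial>N) \<in> L1d"
    unfolding L1d_def by simp
  assume xi: "\<xi> \<in> S"
  have eq: "f y * green \<xi> y = (\<integral>x. \<kappa> x y * f y * \<xi> x \<partial>M)" if "y \<in> space N" for y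
  proof -
    have y: "y \<in> space M" using that assms(2) by auto
    have "f y * green \<xi> y = (\<integral>x. f y * (\<kappa> y x * \<xi> x) \<partial>M)" by (simp add: green_def)
    also have "\<dots> = (\<integral>x. \<kappa> x y * f y * \<xi> x \<partial>M)"
      by (rule Bochner_Integration.integral_cong) (auto simp: kernel_sym[OF y])
    finally show ?thesis .
  qed
  have "integrable N (\<lambda>y. \<integral>x. \<kappa> x y * f y * \<xi> x \<partial>M)"
    using integrable_fst[OF main[OF xi]] by simp
  then show "integrable N (\<lambda>y. f y * green \<xi> y)"
    by (rule Bochner_Integration.integrable_cong[THEN iffD1, rotated -1]) (auto simp: eq)
  have "(\<integral>y. f y * green \<xi> y \<partial>N) = (\<integral>y. \<integral>x. \<kappa> x y * f y * \<xi> x \<partial>M \<partial>N)"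
    by (rule Bochner_Integration.integral_cong) (auto simp: eq)
  also have "\<dots> = (\<integral>x. \<integral>y. \<kappa> x y * f y * \<xi> x \<partial>N \<partial>M)"
    using Fubini_integral[OF main[OF xi]] by simp
  finally show "(\<integral>x. (\<integral>y. \<kappa> x y * f y \<partial>N) * \<xi> x \<partial>M) = (\<integral>y. f y * green \<xi> y \<partial>N)"
    by simp
qed

lemma green_dual:
  assumes "f \<in> L1d" "\<xi> \<in> S"
  shows "(\<integral>x. green f x * \<xi> x \<partial>M) = (\<integral>x. f x * green \<xi> x \<partial>M)"
  using green_duality(4)[of M f \<xi>] assms sigma_finite_measure_axioms by (simp add: L1d_def green_def)

end

section \<open>Semilinear equations for a positive Green operator\<close>

text \<open>The third axiom is the trace of continuity that survives in this abstract setting. It is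
  there because potentials of test functions get integrated against measures for which a Lebesgue
  null set may matter.\<close>

locale green_operator = green_kernel +
  assumes energy_nonneg: "\<And>\<xi>. \<xi> \<in> S \<Longrightarrow> 0 \<le> (\<integral>x. \<xi> x * green \<xi> x \<partial>M)"
    and energy_neg_part: "\<And>\<xi>. \<xi> \<in> S \<Longrightarrow> (\<integral>x. \<xi> x * max 0 (- green \<xi> x) \<partial>M) \<le> 0"
    and green_nonneg_everywhere:
      "\<And>\<xi> x. \<xi> \<in> S \<Longrightarrow> AE y in M. 0 \<le> green \<xi> y \<Longrightarrow> x \<in> space M \<Longrightarrow> 0 \<le> green \<xi> x"
begin

section \<open>Energy estimates and the relaxed iteration\<close>

lemma S_times_S: "\<xi> \<in> S \<Longrightarrow> \<eta> \<in> S \<Longrightarrow> integrable M (\<lambda>x. \<xi> x * \<eta> x)"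
  by (intro L1d_times_S S_subset_L1d)

lemma energy_lincomb:
  assumes "\<xi> \<in> S" "\<eta> \<in> S"
  shows "(\<integral>x. (a * \<xi> x + b * \<eta> x) * green (\<lambda>x. a * \<xi> x + b * \<eta> x) x \<partial>M)
     = a\<^sup>2 * (\<integral>x. \<xi> x * green \<xi> x \<partial>M) + 2 * a * b * (\<integral>x. \<eta> x * green \<xi> x \<partial>M)
       + b\<^sup>2 * (\<integral>x. \<eta> x * green \<eta> x \<partial>M)"
proof -
  note int = S_times_S[OF assms(1) green_in_S[OF assms(1)]] S_times_S[OF assms(1) green_in_S[OF assms(2)]]
     S_times_S[OF assms(2) green_in_S[OF assms(1)]] S_times_S[OF assms(2) green_in_S[OF assms(2)]]
  have sym: "(\<integral>x. \<xi> x * green \<eta> x \<partial>M) = (\<integral>x. \<eta> x * green \<xi> x \<partial>M)"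
    using green_dual[OF S_subset_L1d[OF assms(1)] assms(2)] by (simp add: mult.commute)
  have "(\<integral>x. (a * \<xi> x + b * \<eta> x) * green (\<lambda>x. a * \<xi> x + b * \<eta> x) x \<partial>M)
    = (\<integral>x. (a * a) * (\<xi> x * green \<xi> x) + ((a * b) * (\<xi> x * green \<eta> x)
        + ((a * b) * (\<eta> x * green \<xi> x) + (b * b) * (\<eta> x * green \<eta> x))) \<partial>M)"
    by (rule Bochner_Integration.integral_cong) (auto simp: green_lincomb[OF _ assms] algebra_simps)
  also have "\<dots> = (a * a) * (\<integral>x. \<xi> x * green \<xi> x \<partial>M) + ((a * b) * (\<integral>x. \<xi> x * green \<eta> x \<partial>M)
        + ((a * b) * (\<integral>x. \<eta> x * green \<xi> x \<partial>M) + (b * b) * (\<integral>x. \<eta> x * green \<eta> x \<partial>M)))"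
    using int by simp
  finally show ?thesis by (simp add: sym power2_eq_square)
qed

text \<open>Schur's test with weight \<open>d\<close>.\<close>

lemma energy_le:
  assumes r: "r \<in> S"
  shows "(\<integral>x. r x * green r x \<partial>M) \<le> K * (\<integral>x. r x * r x \<partial>M)"
proof -
  define f where "f x = (r x)\<^sup>2 / d x" for x
  obtain m where m: "0 < m" "\<And>x. x \<in> space M \<Longrightarrow> \<bar>r x\<bar> \<le> m * d x"
    using r by (auto elim!: S_E)
  have f: "f \<in> S"
  proof (rule S_bound[OF r])
    show "f \<in> borel_measurable M" unfolding f_def using r by measurable
    fix x assume x: "x \<in> space M"
    have "\<bar>r x\<bar> * \<bar>r x\<bar> \<le> (m * d x) * \<bar>r x\<bar>" using m(2)[OF x] by (intro mult_right_mono) auto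
    then show "\<bar>f x\<bar> \<le> m * \<bar>r x\<bar>"
      using weight_pos[OF x] by (simp add: f_def power2_eq_square abs_mult divide_le_eq mult_ac)
  qed
  \<comment> \<open>This is 2 r(x) r(y) <= d(x) r(y)^2 / d(y) + d(y) r(x)^2 / d(x), integrated
    against the kernel. After integration in x the two terms agree by symmetry, and each becomes the
    integral of \<open>f * green d\<close>, where \<open>green d \<le> K * d\<close>
    applies.\<close>
  have pt: "r x * green r x \<le> (d x * green f x + f x * green d x) / 2" if x: "x \<in> space M" for x
  proof -
    have "r x * green r x = (\<integral>y. r x * (\<kappa> x y * r y) \<partial>M)" by (simp add: green_def)
    also have "\<dots> \<le> (\<integral>y. (d x / 2) * (\<kappa> x y * f y) + (f x / 2) * (\<kappa> x y * d y) \<partial>M)"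
    proof (rule integral_mono)
      fix y assume y: "y \<in> space M"
      have "0 \<le> (r y * d x - r x * d y)\<^sup>2" by simp
      then have "2 * (r x * r y) * (d x * d y) \<le> (r y * d x)\<^sup>2 + (r x * d y)\<^sup>2"
        by (simp add: power2_diff mult_ac)
      then have "2 * (r x * r y) \<le> ((r y * d x)\<^sup>2 + (r x * d y)\<^sup>2) / (d x * d y)"
        using weight_pos[OF x] weight_pos[OF y] by (simp add: le_divide_eq)
      also have "\<dots> = d x * f y + f x * d y"
        using weight_pos[OF x] weight_pos[OF y] by (simp add: f_def field_simps power2_eq_square)
      finally have "\<kappa> x y * (2 * (r x * r y)) \<le> \<kappa> x y * (d x * f y + f x * d y)"
        by (rule mult_left_mono) (rule kernel_nonneg[OF x y])
      then show "r x * (\<kappa> x y * r y) \<le> (d x / 2) * (\<kappa> x y * f y) + (f x / 2) * (\<kappa> x y * d y)"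
        by (simp add: algebra_simps)
    qed (use x r f weight_in_S in \<open>auto intro!: Bochner_Integration.integrable_add integrable_mult_right integrable_kernel\<close>)
    also have "\<dots> = (d x / 2) * green f x + (f x / 2) * green d x"
      using x f weight_in_S by (simp add: green_def integrable_kernel)
    finally show ?thesis by (simp add: add_divide_distrib)
  qed
  have sym: "(\<integral>x. d x * green f x \<partial>M) = (\<integral>x. f x * green d x \<partial>M)"
    using green_dual[OF S_subset_L1d[OF f] weight_in_S] by (simp add: mult.commute)
  have i: "integrable M (\<lambda>x. d x * green f x)" "integrable M (\<lambda>x. f x * green d x)"
    by (intro S_times_S green_in_S f weight_in_S)+
  have "(\<integral>x. r x * green r x \<partial>M) \<le> (\<integral>x. (d x * green f x + f x * green d x) / 2 \<partial>M)"
    using i by (intro integral_mono pt S_times_S green_in_S r) auto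
  also have "\<dots> = (\<integral>x. f x * green d x \<partial>M)" using i sym by simp
  also have "\<dots> \<le> (\<integral>x. K * (r x * r x) \<partial>M)"
  proof (rule integral_mono)
    fix x assume x: "x \<in> space M"
    have "f x * green d x \<le> f x * (K * d x)"
      using integrable_kernel_weight(2)[OF x] weight_pos[OF x]
      by (intro mult_left_mono) (auto simp: green_def f_def)
    also have "\<dots> = K * (r x * r x)" using weight_pos[OF x] by (simp add: f_def power2_eq_square)
    finally show "f x * green d x \<le> K * (r x * r x)" .
  qed (use i r in \<open>auto intro: S_times_S\<close>)
  finally show ?thesis by simp
qed

text \<open>The operator inequality G^2 <= K G for a nonnegative symmetric G of norm at most K. It
  comes from the nonnegative energy of \<open>q - green q / K\<close>: the term of third order in G
  is bounded by \<open>energy_le\<close>, and half of the cross term remains.\<close>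

lemma green_square_le:
  assumes q: "q \<in> S"
  shows "(\<integral>x. green q x * green q x \<partial>M) \<le> K * (\<integral>x. q x * green q x \<partial>M)"
proof -
  define R where "R = (\<integral>x. green q x * green q x \<partial>M)"
  have r: "green q \<in> S" using q by (rule green_in_S)
  have "0 \<le> (\<integral>x. (1 * q x + (- 1 / K) * green q x) * green (\<lambda>x. 1 * q x + (- 1 / K) * green q x) x \<partial>M)"
    by (rule energy_nonneg) (rule S_lincomb[OF q r])
  also have "\<dots> = (\<integral>x. q x * green q x \<partial>M) - 2 / K * R + (1 / K)\<^sup>2 * (\<integral>x. green q x * green (green q) x \<partial>M)"
    unfolding energy_lincomb[OF q r] by (simp add: R_def power2_eq_square)
  also have "\<dots> \<le> (\<integral>x. q x * green q x \<partial>M) - 2 / K * R + (1 / K)\<^sup>2 * (K * R)"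
    using energy_le[OF r] by (intro add_left_mono mult_left_mono) (auto simp: R_def)
  also have "\<dots> = (\<integral>x. q x * green q x \<partial>M) - R / K"
    using K_pos by (simp add: power2_eq_square field_simps)
  finally have "R / K \<le> (\<integral>x. q x * green q x \<partial>M)" by simp
  then show ?thesis using K_pos by (simp add: R_def divide_le_eq mult.commute)
qed

text \<open>The relaxed iteration \<open>q \<mapsto> (1 - \<theta>) q + \<theta> k(\<cdot>, green q)\<close> contracts the energy \<open>\<integral> q green q\<close>,
  because the cross term has a sign by monotonicity of \<open>k\<close>.\<close>

lemma relaxed_step_energy:
  assumes e: "e \<in> S" and p: "p \<in> S"
    and sign: "\<And>x. x \<in> space M \<Longrightarrow> p x * green e x \<le> 0"
    and lip: "\<And>x. x \<in> space M \<Longrightarrow> \<bar>p x\<bar> \<le> \<Lambda> * \<bar>green e x\<bar>"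
    and \<theta>: "\<theta> = 1 / (1 + (K * \<Lambda>)\<^sup>2)"
  shows "(\<integral>x. ((1 - \<theta>) * e x + \<theta> * p x) * green (\<lambda>x. (1 - \<theta>) * e x + \<theta> * p x) x \<partial>M)
    \<le> (1 - \<theta>) * (\<integral>x. e x * green e x \<partial>M)"
proof -
  define Q where "Q = (\<integral>x. e x * green e x \<partial>M)"
  have th: "0 < \<theta>" "\<theta> \<le> 1" unfolding \<theta> by (auto simp: add_pos_nonneg)
  have "(\<integral>x. p x * green p x \<partial>M) \<le> K * (\<integral>x. p x * p x \<partial>M)" by (rule energy_le[OF p])
  also have "(\<integral>x. p x * p x \<partial>M) \<le> (\<integral>x. \<Lambda>\<^sup>2 * (green e x * green e x) \<partial>M)"
  proof (rule integral_mono)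
    fix x assume "x \<in> space M"
    then have "\<bar>p x\<bar> * \<bar>p x\<bar> \<le> (\<Lambda> * \<bar>green e x\<bar>) * (\<Lambda> * \<bar>green e x\<bar>)"
      using lip[of x] by (intro mult_mono) auto
    then show "p x * p x \<le> \<Lambda>\<^sup>2 * (green e x * green e x)"
      by (simp add: power2_eq_square mult_ac)
  qed (auto intro!: S_times_S integrable_mult_right green_in_S e p)
  also have "\<dots> = \<Lambda>\<^sup>2 * (\<integral>x. green e x * green e x \<partial>M)" by simp
  also have "\<dots> \<le> \<Lambda>\<^sup>2 * (K * Q)"
    unfolding Q_def by (intro mult_left_mono green_square_le e) auto
  finally have pp: "(\<integral>x. p x * green p x \<partial>M) \<le> (K * \<Lambda>)\<^sup>2 * Q"
    using K_pos by (simp add: power2_eq_square mult_ac)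
  have cross: "(\<integral>x. p x * green e x \<partial>M) \<le> 0"
    using Bochner_Integration.integral_nonneg[of M "\<lambda>x. - (p x * green e x)"] sign by simp
  have "(\<integral>x. ((1 - \<theta>) * e x + \<theta> * p x) * green (\<lambda>x. (1 - \<theta>) * e x + \<theta> * p x) x \<partial>M)
     = (1 - \<theta>)\<^sup>2 * Q + 2 * (1 - \<theta>) * \<theta> * (\<integral>x. p x * green e x \<partial>M) + \<theta>\<^sup>2 * (\<integral>x. p x * green p x \<partial>M)"
    unfolding energy_lincomb[OF e p] Q_def ..
  also have "\<dots> \<le> (1 - \<theta>)\<^sup>2 * Q + 0 + \<theta>\<^sup>2 * ((K * \<Lambda>)\<^sup>2 * Q)"
    using th cross pp by (intro add_mono mult_left_mono mult_nonneg_nonpos) auto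
  \<comment> \<open>The choice of \<theta> makes the quadratic contribution \<theta>^2 (1 + (K
    \<Lambda>)^2) equal to \<theta>, so 1 - 2 \<theta> + \<theta> = 1 - \<theta> is left.\<close>
  also have "\<dots> = (1 - 2 * \<theta> + \<theta> * (\<theta> * (1 + (K * \<Lambda>)\<^sup>2))) * Q"
    by (simp add: algebra_simps power2_eq_square)
  also have "\<theta> * (1 + (K * \<Lambda>)\<^sup>2) = 1"
    unfolding \<theta> by (simp add: add_pos_nonneg less_imp_neq[symmetric])
  finally show ?thesis by (simp add: Q_def)
qed

text \<open>Half of the decay pays for the passage from squares to absolute values. Dividing the
  squares by r^j still leaves a summable series of integrals, so the sum of a_j^2 / r^j is finite
  almost everywhere; then |a_j| <= a_j^2 / r^j + r^j.\<close>

lemma AE_convergent_of_geometric_energy: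
  assumes e: "\<And>j. e j \<in> S" and r: "0 < r" "r < 1"
    and Q: "\<And>j. (\<integral>x. e j x * green (e j) x \<partial>M) \<le> C * (r * r) ^ j"
  shows "AE x in M. summable (\<lambda>j. green (e j) x)"
proof -
  have C: "0 \<le> C" using order_trans[OF energy_nonneg[OF e] Q[of 0]] by simp
  have le: "(\<integral>\<^sup>+x. ennreal (green (e j) x * green (e j) x / r ^ j) \<partial>M) \<le> ennreal (K * C * r ^ j)" for j
  proof -
    have "(\<integral>\<^sup>+x. ennreal (green (e j) x * green (e j) x / r ^ j) \<partial>M)
        = ennreal (\<integral>x. green (e j) x * green (e j) x / r ^ j \<partial>M)"
      using r by (intro nn_integral_eq_integral) (auto intro!: S_times_S green_in_S e)
    also have "\<dots> \<le> ennreal (K * C * r ^ j)"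
    proof (rule ennreal_leI)
      have "(\<integral>x. green (e j) x * green (e j) x / r ^ j \<partial>M) = (\<integral>x. green (e j) x * green (e j) x \<partial>M) / r ^ j"
        by simp
      also have "\<dots> \<le> (K * (C * (r * r) ^ j)) / r ^ j"
        using r K_pos by (intro divide_right_mono order_trans[OF green_square_le[OF e]] mult_left_mono Q) auto
      also have "\<dots> = K * C * r ^ j" using r by (simp add: power_mult_distrib)
      finally show "(\<integral>x. green (e j) x * green (e j) x / r ^ j \<partial>M) \<le> K * C * r ^ j" .
    qed
    finally show ?thesis .
  qed
  have [measurable]: "\<And>j::nat. green (e j) \<in> borel_measurable M" using e by (auto intro!: S_measurable green_in_S)
  have "(\<integral>\<^sup>+x. (\<Sum>j. ennreal (green (e j) x * green (e j) x / r ^ j)) \<partial>M)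
      = (\<Sum>j. \<integral>\<^sup>+x. ennreal (green (e j) x * green (e j) x / r ^ j) \<partial>M)"
    by (rule nn_integral_suminf) measurable
  also have "\<dots> \<le> (\<Sum>j. ennreal (K * C * r ^ j))"
    by (intro suminf_le le) auto
  also have "\<dots> = ennreal (\<Sum>j. K * C * r ^ j)"
    using r C K_pos by (intro suminf_ennreal2) (auto intro!: summable_mult summable_geometric)
  also have "\<dots> < \<infinity>" by simp
  finally have "AE x in M. (\<Sum>j. ennreal (green (e j) x * green (e j) x / r ^ j)) \<noteq> \<infinity>"
    by (intro nn_integral_PInf_AE) auto
  then show ?thesis
  proof eventually_elim
    case (elim x)
    have "summable (\<lambda>j. green (e j) x * green (e j) x / r ^ j)"
      using elim r by (intro summable_suminf_not_top) auto
    then have "summable (\<lambda>j. green (e j) x * green (e j) x / r ^ j + r ^ j)"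
      using r by (intro summable_add summable_geometric) auto
    then show "summable (\<lambda>j. green (e j) x)"
    proof (rule summable_comparison_test')
      fix j :: nat assume "0 \<le> j"
      have "2 * (\<bar>green (e j) x\<bar> * r ^ j) \<le> \<bar>green (e j) x\<bar> * \<bar>green (e j) x\<bar> + r ^ j * r ^ j"
        using sum_squares_bound[of "\<bar>green (e j) x\<bar>" "r ^ j"] by (simp add: power2_eq_square)
      moreover have "0 \<le> \<bar>green (e j) x\<bar> * r ^ j" using r by simp
      ultimately have "\<bar>green (e j) x\<bar> * r ^ j \<le> green (e j) x * green (e j) x + r ^ j * r ^ j" by simp
      then have "\<bar>green (e j) x\<bar> \<le> (green (e j) x * green (e j) x + r ^ j * r ^ j) / r ^ j"
        using r by (subst pos_le_divide_eq) auto
      then show "norm (green (e j) x) \<le> green (e j) x * green (e j) x / r ^ j + r ^ j"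
        using r by (simp add: add_divide_distrib)
    qed
  qed
qed

lemma green_dominated_limit:
  assumes "x \<in> space M" and [measurable]: "\<And>j. f j \<in> borel_measurable M" "h \<in> borel_measurable M"
    and "AE y in M. (\<lambda>j. f j y) \<longlonglongrightarrow> h y" and "\<And>j y. y \<in> space M \<Longrightarrow> \<bar>f j y\<bar> \<le> m * d y"
  shows "(\<lambda>j. green (f j) x) \<longlonglongrightarrow> green h x"
  unfolding green_def
proof (rule integral_dominated_convergence)
  note [measurable] = kernel_section[OF assms(1)]
  show "integrable M (\<lambda>y. m * (\<kappa> x y * d y))"
    using integrable_kernel_weight[OF assms(1)] by simp
  show "AE y in M. (\<lambda>j. \<kappa> x y * f j y) \<longlonglongrightarrow> \<kappa> x y * h y"
    using assms(4) by eventually_elim (rule tendsto_mult_left)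
  show "AE y in M. norm (\<kappa> x y * f j y) \<le> m * (\<kappa> x y * d y)" for j
  proof (rule AE_I2)
    fix y assume y: "y \<in> space M"
    show "norm (\<kappa> x y * f j y) \<le> m * (\<kappa> x y * d y)"
      using mult_left_mono[OF assms(5)[OF y, of j] kernel_nonneg[OF assms(1) y]] kernel_nonneg[OF assms(1) y]
      by (simp add: abs_mult mult_ac)
  qed
  show "(\<lambda>y. \<kappa> x y * h y) \<in> borel_measurable M" "\<And>j. (\<lambda>y. \<kappa> x y * f j y) \<in> borel_measurable M"
    by measurable
qed

text \<open>Only the potentials of the iterates are shown to converge, and only almost everywhere.
  The uniform bound on \<open>k\<close> then dominates: the sources
  \<open>k x (green (q j) x)\<close> converge, hence so do their potentials at every point, and the
  relaxed recursion in the limit says that the limit potential is the potential of the limit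
  source.\<close>

lemma fixed_point:
  assumes meas: "\<And>v. v \<in> borel_measurable M \<Longrightarrow> (\<lambda>x. k x (v x)) \<in> borel_measurable M"
    and bnd: "\<And>x t. x \<in> space M \<Longrightarrow> \<bar>k x t\<bar> \<le> m * d x"
    and anti: "\<And>x t t'. x \<in> space M \<Longrightarrow> t \<le> t' \<Longrightarrow> k x t' \<le> k x t"
    and lip: "\<And>x t t'. x \<in> space M \<Longrightarrow> \<bar>k x t - k x t'\<bar> \<le> \<Lambda> * \<bar>t - t'\<bar>" and "0 < \<Lambda>"
  shows "\<exists>q\<in>S. \<forall>x\<in>space M. q x = k x (green q x)"
proof -
  define \<theta> where "\<theta> = 1 / (1 + (K * \<Lambda>)\<^sup>2)"
  have L: "0 < (K * \<Lambda>)\<^sup>2" using K_pos \<open>0 < \<Lambda>\<close> by simp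
  have th: "0 < \<theta>" "\<theta> < 1" unfolding \<theta>_def using L by (auto simp: add_pos_pos)
  have m0: "0 \<le> m * d x" if "x \<in> space M" for x using bnd[OF that, of 0] by linarith
  define q where "q = rec_nat (\<lambda>_. 0) (\<lambda>_ p x. (1 - \<theta>) * p x + \<theta> * k x (green p x))"
  have q0: "q 0 = (\<lambda>_. 0)" and qS: "q (Suc j) = (\<lambda>x. (1 - \<theta>) * q j x + \<theta> * k x (green (q j) x))" for j
    by (auto simp: q_def)
  have [measurable]: "q j \<in> borel_measurable M" for j
  proof (induction j)
    case (Suc j)
    note [measurable] = Suc meas[OF green_measurable[OF Suc]]
    show ?case unfolding qS by measurable
  qed (simp add: q0)
  have qb: "\<bar>q j x\<bar> \<le> m * d x" if x: "x \<in> space M" for j x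
  proof (induction j)
    case (Suc j)
    have "\<bar>q (Suc j) x\<bar> \<le> (1 - \<theta>) * \<bar>q j x\<bar> + \<theta> * \<bar>k x (green (q j) x)\<bar>"
      unfolding qS using th by (intro order_trans[OF abs_triangle_ineq]) (simp add: abs_mult)
    also have "\<dots> \<le> (1 - \<theta>) * (m * d x) + \<theta> * (m * d x)"
      using th Suc bnd[OF x] by (intro add_mono mult_left_mono) auto
    finally show ?case by (simp add: algebra_simps)
  qed (simp add: q0 m0[OF x])
  have qin: "q j \<in> S" for j by (rule S_I[OF _ qb]) auto
  define kq where "kq j x = k x (green (q j) x)" for j x
  have [measurable]: "kq j \<in> borel_measurable M" for j unfolding kq_def by (intro meas green_measurable) auto
  have kin: "kq j \<in> S" for j by (rule S_I[where m=m]) (auto simp: kq_def bnd)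
  define e where "e j x = q (Suc j) x - q j x" for j x
  have ein: "e j \<in> S" for j
    using S_lincomb[OF qin[of "Suc j"] qin[of j], of 1 "-1"] by (simp add: e_def[abs_def])
  have ge: "green (e j) x = green (q (Suc j)) x - green (q j) x" if "x \<in> space M" for j x
    using green_lincomb[OF that qin[of "Suc j"] qin[of j], of 1 "-1"] by (simp add: e_def[abs_def])
  have eS: "e (Suc j) = (\<lambda>x. (1 - \<theta>) * e j x + \<theta> * (kq (Suc j) x - kq j x))" for j
    by (rule ext) (simp add: e_def qS kq_def algebra_simps)
  have step: "(\<integral>x. e (Suc j) x * green (e (Suc j)) x \<partial>M) \<le> (1 - \<theta>) * (\<integral>x. e j x * green (e j) x \<partial>M)" for j
    unfolding eS
  proof (rule relaxed_step_energy[OF ein])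
    show "(\<lambda>x. kq (Suc j) x - kq j x) \<in> S"
      using S_lincomb[OF kin[of "Suc j"] kin[of j], of 1 "-1"] by simp
    fix x assume x: "x \<in> space M"
    show "(kq (Suc j) x - kq j x) * green (e j) x \<le> 0"
      using anti[OF x, of "green (q j) x" "green (q (Suc j)) x"] anti[OF x, of "green (q (Suc j)) x" "green (q j) x"]
      unfolding ge[OF x] kq_def by (cases "green (q j) x \<le> green (q (Suc j)) x") (auto simp: mult_le_0_iff)
    show "\<bar>kq (Suc j) x - kq j x\<bar> \<le> \<Lambda> * \<bar>green (e j) x\<bar>"
      unfolding ge[OF x] kq_def by (rule lip[OF x])
  qed (rule \<theta>_def)
  define C where "C = (\<integral>x. e 0 x * green (e 0) x \<partial>M)"
  \<comment> \<open>The energy shrinks by the factor 1 - \<theta>, which has to be presented as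
    \<open>r * r\<close>.\<close>
  define r where "r = sqrt (1 - \<theta>)"
  have r: "0 < r" "r < 1" "r * r = 1 - \<theta>" using th by (auto simp: r_def)
  have "(\<integral>x. e j x * green (e j) x \<partial>M) \<le> C * (r * r) ^ j" for j
  proof (induction j)
    case (Suc j)
    have "(\<integral>x. e (Suc j) x * green (e (Suc j)) x \<partial>M) \<le> (1 - \<theta>) * (C * (r * r) ^ j)"
      using th by (intro order_trans[OF step] mult_left_mono Suc) auto
    then show ?case by (simp add: r(3) mult_ac)
  qed (simp add: C_def)
  then have sm: "AE x in M. summable (\<lambda>j. green (e j) x)"
    by (rule AE_convergent_of_geometric_energy[OF ein r(1,2)])
  define v where "v x = lim (\<lambda>j. green (q j) x)" for x
  have [measurable]: "v \<in> borel_measurable M" unfolding v_def by measurable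
  have lim: "AE x in M. (\<lambda>j. green (q j) x) \<longlonglongrightarrow> v x"
    using sm AE_space
  proof eventually_elim
    case (elim x)
    have "(\<lambda>n. \<Sum>j<n. green (e j) x) = (\<lambda>n. green (q n) x - green (q 0) x)"
      using sum_lessThan_telescope[of "\<lambda>j. green (q j) x"] by (simp add: ge[OF elim(2)])
    then have "convergent (\<lambda>n. green (q n) x - green (q 0) x)"
      using elim(1) by (simp add: summable_iff_convergent)
    then have "convergent (\<lambda>n. green (q n) x)"
      using convergent_add[OF _ convergent_const[of "green (q 0) x"]] by force
    then show ?case by (simp add: v_def convergent_LIMSEQ_iff)
  qed
  define p where "p x = k x (v x)" for x
  have [measurable]: "p \<in> borel_measurable M" unfolding p_def by (intro meas) auto
  have pin: "p \<in> S" by (rule S_I[where m=m]) (auto simp: p_def bnd)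
  have "AE x in M. (\<lambda>j. kq j x) \<longlonglongrightarrow> p x"
    using lim AE_space
  proof eventually_elim
    case (elim x)
    have "(\<lambda>j. \<Lambda> * \<bar>green (q j) x - v x\<bar>) \<longlonglongrightarrow> \<Lambda> * \<bar>v x - v x\<bar>"
      by (intro tendsto_intros elim)
    then have "(\<lambda>j. \<Lambda> * \<bar>green (q j) x - v x\<bar>) \<longlonglongrightarrow> 0" by simp
    then have "(\<lambda>j. kq j x - p x) \<longlonglongrightarrow> 0"
      by (rule Lim_null_comparison[rotated]) (auto simp: kq_def p_def intro!: always_eventually lip elim)
    then show ?case by (rule LIM_zero_cancel)
  qed
  then have gk: "(\<lambda>j. green (kq j) x) \<longlonglongrightarrow> green p x" if "x \<in> space M" for x
    using that by (intro green_dominated_limit[where m=m]) (auto simp: kq_def bnd)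
  have "AE x in M. v x = green p x"
    using lim AE_space
  proof eventually_elim
    case (elim x)
    have eq: "green (q (Suc j)) x = (1 - \<theta>) * green (q j) x + \<theta> * green (kq j) x" for j
      using green_lincomb[OF elim(2) qin[of j] kin[of j]] by (simp add: qS kq_def[abs_def])
    have "(\<lambda>j. green (q (Suc j)) x) \<longlonglongrightarrow> (1 - \<theta>) * v x + \<theta> * green p x"
      unfolding eq by (intro tendsto_intros elim gk)
    with LIMSEQ_Suc[OF elim(1)] have "v x = (1 - \<theta>) * v x + \<theta> * green p x"
      by (rule LIMSEQ_unique)
    then have "\<theta> * (v x - green p x) = 0" by argo
    then show ?case using th by simp
  qed
  then have eq: "AE x in M. k x (green p x) = p x" by eventually_elim (simp add: p_def)
  \<comment> \<open>So far the equation holds almost everywhere. Changing \<open>p\<close> on a null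
    set leaves its potential untouched at every point, so the redefined function solves the equation
    everywhere.\<close>
  define q' where "q' x = k x (green p x)" for x
  have [measurable]: "q' \<in> borel_measurable M" unfolding q'_def by (intro meas green_measurable) auto
  have "green q' x = green p x" if "x \<in> space M" for x
    using that by (rule green_cong_AE) (use eq in \<open>auto simp: q'_def\<close>)
  moreover have "q' \<in> S" by (rule S_I[where m=m]) (auto simp: q'_def bnd)
  ultimately show ?thesis by (intro bexI[of _ q']) (auto simp: q'_def)
qed

text \<open>The potential is first clamped to a bounded interval, which gives a bounded Lipschitz
  nonlinearity. Where \<open>green q\<close> is negative the clamp is 0 and
  \<open>q = \<xi> > 0\<close>, so \<open>energy_neg_part\<close> leaves no room for a negative
  part. Then \<open>q \<le> \<xi>\<close> bounds the potential from above, and the clamp turns out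
  to be inactive.\<close>

lemma linear_problem:
  assumes xi: "\<xi> \<in> S" and pos: "\<And>x. x \<in> space M \<Longrightarrow> 0 < \<xi> x"
    and a: "a \<in> borel_measurable M" "\<And>x. x \<in> space M \<Longrightarrow> 0 \<le> a x" "\<And>x. x \<in> space M \<Longrightarrow> a x \<le> n"
  shows "\<exists>q\<in>S. \<forall>x\<in>space M. 0 \<le> green q x \<and> green q x \<le> green \<xi> x \<and> q x = \<xi> x - a x * green q x"
proof -
  obtain m where m: "0 < m" "\<And>x. x \<in> space M \<Longrightarrow> \<bar>\<xi> x\<bar> \<le> m * d x"
    using xi by (auto elim!: S_E)
  note [measurable] = a(1) S_measurable[OF xi]
  \<comment> \<open>The upper level is the bound that \<open>green_bound\<close> gives for
    \<open>green \<xi>\<close>.\<close>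
  define cl where "cl x t = max 0 (min t (m * K * d x))" for x t
  have clb: "0 \<le> cl x t" "cl x t \<le> m * K * d x" if "x \<in> space M" for x t
    using m(1) K_pos weight_pos[OF that] by (auto simp: cl_def)
  have "\<exists>q\<in>S. \<forall>x\<in>space M. q x = \<xi> x - a x * cl x (green q x)"
  proof (rule fixed_point[where m="m + \<bar>n\<bar> * m * K" and \<Lambda>="\<bar>n\<bar> + 1"])
    fix x t t' assume x: "x \<in> space M"
    have "a x * cl x t \<le> \<bar>n\<bar> * (m * K * d x)"
      using clb[OF x] a(2,3)[OF x] by (intro mult_mono) auto
    moreover have "0 \<le> a x * cl x t" using clb[OF x] a(2)[OF x] by simp
    ultimately show "\<bar>\<xi> x - a x * cl x t\<bar> \<le> (m + \<bar>n\<bar> * m * K) * d x"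
      using m(2)[OF x] by (simp add: algebra_simps)
    have "\<bar>\<xi> x - a x * cl x t - (\<xi> x - a x * cl x t')\<bar> = a x * \<bar>cl x t' - cl x t\<bar>"
      using a(2)[OF x] by (simp add: abs_mult right_diff_distrib[symmetric])
    also have "\<dots> \<le> (\<bar>n\<bar> + 1) * \<bar>t - t'\<bar>"
      using a(2,3)[OF x] by (intro mult_mono) (auto simp: cl_def)
    finally show "\<bar>\<xi> x - a x * cl x t - (\<xi> x - a x * cl x t')\<bar> \<le> (\<bar>n\<bar> + 1) * \<bar>t - t'\<bar>" .
    assume "t \<le> t'"
    then show "\<xi> x - a x * cl x t' \<le> \<xi> x - a x * cl x t"
      using a(2)[OF x] by (auto simp: cl_def intro!: mult_left_mono)
  next
    fix v :: "'a \<Rightarrow> real" assume [measurable]: "v \<in> borel_measurable M"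
    show "(\<lambda>x. \<xi> x - a x * cl x (v x)) \<in> borel_measurable M" unfolding cl_def by measurable
  qed auto
  then obtain q where q: "q \<in> S" "\<And>x. x \<in> space M \<Longrightarrow> q x = \<xi> x - a x * cl x (green q x)" by auto
  have qn: "q x * max 0 (- green q x) = \<xi> x * max 0 (- green q x)" if x: "x \<in> space M" for x
    using q(2)[OF x] by (cases "green q x < 0") (auto simp: cl_def)
  have nn: "0 \<le> \<xi> x * max 0 (- green q x)" if "x \<in> space M" for x
    using pos[OF that] by simp
  have eq: "(\<integral>x. q x * max 0 (- green q x) \<partial>M) = (\<integral>x. \<xi> x * max 0 (- green q x) \<partial>M)"
    by (rule Bochner_Integration.integral_cong) (auto simp: qn)
  have mS: "(\<lambda>x. max 0 (- green q x)) \<in> S"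
    by (rule S_bound[OF green_in_S[OF q(1)], where c=1]) (use q(1) in \<open>auto intro!: borel_measurable_max borel_measurable_uminus S_measurable green_in_S\<close>)
  have "(\<integral>x. \<xi> x * max 0 (- green q x) \<partial>M) = 0"
    using energy_neg_part[OF q(1)] eq Bochner_Integration.integral_nonneg[of M "\<lambda>x. \<xi> x * max 0 (- green q x)"] nn
    by (auto intro: antisym)
  then have "AE x in M. \<xi> x * max 0 (- green q x) = 0"
    using integral_nonneg_eq_0_iff_AE[OF S_times_S[OF xi mS]] nn by auto
  then have "AE x in M. 0 \<le> green q x"
    using AE_space
  proof eventually_elim
    case (elim x)
    then show ?case using pos[OF elim(2)] by auto
  qed
  then have g0: "0 \<le> green q x" if "x \<in> space M" for x
    using green_nonneg_everywhere[OF q(1) _ that] by blast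
  have g1: "green q x \<le> green \<xi> x" if x: "x \<in> space M" for x
  proof (rule green_mono[OF x q(1) xi], rule AE_I2)
    fix y assume y: "y \<in> space M"
    show "q y \<le> \<xi> y" using q(2)[OF y] clb[OF y] a(2)[OF y] by simp
  qed
  have "cl x (green q x) = green q x" if x: "x \<in> space M" for x
    using g0[OF x] g1[OF x] green_bound[OF x _ m(2)] by (auto simp: cl_def)
  then show ?thesis using q g0 g1 by (intro bexI[of _ q]) auto
qed

text \<open>With \<open>a = f / w\<close>, truncated at height \<open>n\<close>, the solutions \<open>q\<close> of \<open>q + a green q = \<xi>\<close> are used as test
  functions: this replaces Kato's inequality and needs no regularity of the data.\<close>

lemma comparison_principle:
  assumes w: "w \<in> L1d" and f: "f \<in> L1d" and sign: "AE x in M. 0 \<le> w x \<longrightarrow> 0 \<le> f x"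
    and sub: "\<And>\<xi>. \<xi> \<in> S \<Longrightarrow> (\<And>x. x \<in> space M \<Longrightarrow> 0 \<le> green \<xi> x) \<Longrightarrow>
        (\<integral>x. w x * \<xi> x \<partial>M) + (\<integral>x. f x * green \<xi> x \<partial>M) \<le> 0"
  shows "AE x in M. w x \<le> 0"
proof -
  note [measurable] = L1d_measurable[OF w] L1d_measurable[OF f]
  \<comment> \<open>On the set where \<open>w = 0\<close> division yields \<open>a = 0\<close>,
    which is right since \<open>f \<ge> 0\<close> there. Where \<open>w < 0 \<le> f\<close> the
    maximum cuts the quotient off. In all other cases \<open>a * w = f\<close>.\<close>
  define a where "a x = max 0 (f x / w x)" for x
  have [measurable]: "a \<in> borel_measurable M" unfolding a_def by measurable
  have a0: "0 \<le> a x" for x by (simp add: a_def)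
  have aw: "AE x in M. a x * w x \<le> f x \<and> \<bar>a x * w x\<bar> \<le> \<bar>f x\<bar>"
    using sign
  proof eventually_elim
    case (elim x)
    consider "w x > 0" | "w x = 0" | "w x < 0" "f x < 0" | "w x < 0" "0 \<le> f x" by linarith
    then show ?case
    proof cases
      case 4
      then have "f x / w x \<le> 0" by (simp add: divide_nonneg_neg)
      then show ?thesis using 4 by (simp add: a_def max_def)
    next
      case 3
      then have "0 < f x / w x" by (simp add: divide_neg_neg)
      then show ?thesis using 3 by (simp add: a_def max_def)
    qed (use elim in \<open>auto simp: a_def max_def divide_less_0_iff\<close>)
  qed
  have main: "(\<integral>x. w x * \<xi> x \<partial>M) \<le> 0" if xi: "\<xi> \<in> S" and pos: "\<And>x. x \<in> space M \<Longrightarrow> 0 < \<xi> x" for \<xi>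
  proof -
    note [measurable] = S_measurable[OF xi]
    define an where "an n x = min (a x) (real n)" for n x
    have [measurable]: "an n \<in> borel_measurable M" for n unfolding an_def by measurable
    have gS: "green \<xi> \<in> S" by (rule green_in_S[OF xi])
    \<comment> \<open>The error of replacing \<open>a\<close> by its truncation \<open>an n\<close>,
      made independent of the solution \<open>q\<close> by means of
      \<open>0 \<le> green q \<le> green \<xi>\<close>. It vanishes pointwise for large n and is
      dominated by \<open>\<bar>f\<bar> * green \<xi>\<close>.\<close>
    define Z where "Z n x = (a x - an n x) * \<bar>w x\<bar> * green \<xi> x" for n x
    have le: "(\<integral>x. w x * \<xi> x \<partial>M) \<le> (\<integral>x. Z n x \<partial>M)" for n
    proof -
      obtain q where q: "q \<in> S" and qq: "\<And>x. x \<in> space M \<Longrightarrow> 0 \<le> green q x"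
          "\<And>x. x \<in> space M \<Longrightarrow> green q x \<le> green \<xi> x" "\<And>x. x \<in> space M \<Longrightarrow> q x = \<xi> x - an n x * green q x"
        using linear_problem[OF xi pos, of "an n" "real n"] by (auto simp: an_def a0)
      have gq: "green q \<in> S" by (rule green_in_S[OF q])
      note [measurable] = S_measurable[OF gq]
      have awL: "(\<lambda>x. a x * w x) \<in> L1d"
        by (rule L1d_bound[OF f]) (use aw in auto)
      have anwL: "(\<lambda>x. an n x * w x) \<in> L1d"
        by (rule L1d_bound[OF awL]) (use a0 in \<open>auto simp: an_def abs_mult intro!: AE_I2 mult_right_mono\<close>)
      note i1 = L1d_times_S[OF awL gq] and i2 = L1d_times_S[OF anwL gq]
      have "(\<integral>x. (a x * w x) * green q x \<partial>M) \<le> (\<integral>x. f x * green q x \<partial>M)"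
      proof (rule integral_mono_AE[OF i1 L1d_times_S[OF f gq]])
        show "AE x in M. a x * w x * green q x \<le> f x * green q x"
          using aw AE_space by eventually_elim (auto intro!: mult_right_mono qq)
      qed
      then have 1: "(\<integral>x. w x * q x \<partial>M) + (\<integral>x. (a x * w x) * green q x \<partial>M) \<le> 0"
        using sub[OF q qq(1)] by linarith
      have "(\<integral>x. w x * q x \<partial>M) = (\<integral>x. w x * \<xi> x - (an n x * w x) * green q x \<partial>M)"
        by (rule Bochner_Integration.integral_cong) (auto simp: qq(3) algebra_simps)
      also have "\<dots> = (\<integral>x. w x * \<xi> x \<partial>M) - (\<integral>x. (an n x * w x) * green q x \<partial>M)"
        by (rule Bochner_Integration.integral_diff[OF L1d_times_S[OF w xi] i2])
      finally have "(\<integral>x. w x * \<xi> x \<partial>M) \<le> (\<integral>x. (an n x * w x) * green q x \<partial>M) - (\<integral>x. (a x * w x) * green q x \<partial>M)"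
        using 1 by linarith
      also have "\<dots> = (\<integral>x. (an n x * w x) * green q x - (a x * w x) * green q x \<partial>M)"
        using i1 i2 by simp
      also have "\<dots> \<le> (\<integral>x. Z n x \<partial>M)"
      proof (rule integral_mono)
        have "(\<lambda>x. (a x - an n x) * \<bar>w x\<bar>) \<in> L1d"
          by (rule L1d_bound[OF awL]) (use a0 in \<open>auto simp: an_def abs_mult intro!: AE_I2 mult_right_mono\<close>)
        from L1d_times_S[OF this gS] show "integrable M (Z n)" by (simp add: Z_def[abs_def])
        fix x assume x: "x \<in> space M"
        have "(an n x * w x) * green q x - (a x * w x) * green q x = (a x - an n x) * ((- w x) * green q x)"
          by (simp add: algebra_simps)
        also have "\<dots> \<le> (a x - an n x) * (\<bar>w x\<bar> * green \<xi> x)"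
          using qq(1,2)[OF x] by (intro mult_left_mono mult_mono) (auto simp: an_def)
        finally show "(an n x * w x) * green q x - (a x * w x) * green q x \<le> Z n x"
          by (simp add: Z_def mult_ac)
      qed (use i1 i2 in auto)
      finally show ?thesis .
    qed
    have "(\<lambda>n. \<integral>x. Z n x \<partial>M) \<longlonglongrightarrow> (\<integral>x. 0 \<partial>M)"
    proof (rule integral_dominated_convergence)
      show "integrable M (\<lambda>x. \<bar>f x\<bar> * green \<xi> x)" by (rule L1d_times_S[OF L1d_abs[OF f] gS])
      show "AE x in M. (\<lambda>n. Z n x) \<longlonglongrightarrow> 0"
      proof (rule AE_I2)
        fix x
        obtain N where N: "a x \<le> real N" using real_arch_simple by blast
        have "\<forall>\<^sub>F n in sequentially. Z n x = 0"
          using eventually_ge_at_top[of N] by eventually_elim (use N in \<open>auto simp: Z_def an_def min_def\<close>)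
        then show "(\<lambda>n. Z n x) \<longlonglongrightarrow> 0" by (rule tendsto_eventually)
      qed
      show "AE x in M. norm (Z n x) \<le> \<bar>f x\<bar> * green \<xi> x" for n
        using aw AE_space
      proof eventually_elim
        case (elim x)
        have g: "0 \<le> green \<xi> x" using elim(2) pos by (intro green_nonneg) (auto intro: less_imp_le)
        have "(a x - an n x) * \<bar>w x\<bar> \<le> a x * \<bar>w x\<bar>" using a0 by (intro mult_right_mono) (auto simp: an_def)
        also have "\<dots> \<le> \<bar>f x\<bar>" using elim(1) a0[of x] by (simp add: abs_mult)
        finally have "(a x - an n x) * \<bar>w x\<bar> * green \<xi> x \<le> \<bar>f x\<bar> * green \<xi> x"
          using g by (rule mult_right_mono)
        moreover have "0 \<le> Z n x" using g by (auto simp: Z_def an_def)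
        ultimately show ?case by (simp add: Z_def)
      qed
      note [measurable] = S_measurable[OF gS]
      show "Z n \<in> borel_measurable M" for n unfolding Z_def by measurable
    qed auto
    then show ?thesis using LIMSEQ_le_const[of "\<lambda>n. \<integral>x. Z n x \<partial>M" 0 "\<integral>x. w x * \<xi> x \<partial>M"] le by auto
  qed
  define wp where "wp x = max 0 (w x)" for x
  have wpL: "integrable M (\<lambda>x. wp x * d x)" "integrable M (\<lambda>x. w x * d x)"
    using L1d_bound[OF w, of wp] w by (auto simp: wp_def[abs_def] L1d_def)
  have "(\<integral>x. wp x * d x \<partial>M) \<le> 0"
  proof (rule field_le_epsilon)
    fix \<epsilon> :: real assume e: "0 < \<epsilon>"
    \<comment> \<open>The natural test function, the weight restricted to the set where
      \<open>w > 0\<close>, is not strictly positive. Adding \<eta> times the weight repairs this at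
      a cost of at most \<epsilon>.\<close>
    define \<eta> where "\<eta> = \<epsilon> / (1 + \<bar>\<integral>x. w x * d x \<partial>M\<bar>)"
    have eta: "0 < \<eta>" using e by (simp add: \<eta>_def)
    define \<xi> where "\<xi> x = ((if 0 < w x then 1 else 0) + \<eta>) * d x" for x
    have xiS: "\<xi> \<in> S"
    proof (rule S_I[where m="1 + \<eta>"])
      show "\<xi> \<in> borel_measurable M" unfolding \<xi>_def by measurable
    qed (use eta in \<open>auto simp: \<xi>_def abs_mult weight_pos abs_of_pos intro!: mult_right_mono\<close>)
    have "(\<integral>x. wp x * d x + \<eta> * (w x * d x) \<partial>M) = (\<integral>x. w x * \<xi> x \<partial>M)"
      by (rule Bochner_Integration.integral_cong) (auto simp: \<xi>_def wp_def algebra_simps)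
    also have "\<dots> \<le> 0" by (rule main[OF xiS]) (use eta in \<open>auto simp: \<xi>_def weight_pos intro!: mult_pos_pos\<close>)
    finally have "(\<integral>x. wp x * d x \<partial>M) + \<eta> * (\<integral>x. w x * d x \<partial>M) \<le> 0" using wpL by simp
    then have "(\<integral>x. wp x * d x \<partial>M) \<le> \<eta> * \<bar>\<integral>x. w x * d x \<partial>M\<bar>"
      using abs_ge_minus_self[of "\<eta> * (\<integral>x. w x * d x \<partial>M)"] eta by (simp add: abs_mult)
    also have "\<dots> \<le> \<eta> * (1 + \<bar>\<integral>x. w x * d x \<partial>M\<bar>)" using eta by (intro mult_left_mono) auto
    also have "\<dots> = \<epsilon>" by (simp add: \<eta>_def)
    finally show "(\<integral>x. wp x * d x \<partial>M) \<le> 0 + \<epsilon>" by simp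
  qed
  moreover have nn: "AE x in M. 0 \<le> wp x * d x" by (auto simp: wp_def weight_pos less_imp_le intro!: AE_I2)
  ultimately have "(\<integral>x. wp x * d x \<partial>M) = 0" using integral_nonneg_AE[OF nn] by linarith
  then have "AE x in M. wp x * d x = 0"
    using integral_nonneg_eq_0_iff_AE[OF wpL(1) nn] by simp
  then show ?thesis using AE_space
  proof eventually_elim
    case (elim x)
    then show ?case using weight_pos[OF elim(2)] by (auto simp: wp_def max_def split: if_splits)
  qed
qed

end

section \<open>Lipschitz minorants of a nonnegative function by infimal convolution with n
  |t|\<close>

definition lip_env :: "(real \<Rightarrow> real) \<Rightarrow> real \<Rightarrow> real \<Rightarrow> real" where
  "lip_env h n t = (INF r. h r + n * \<bar>t - r\<bar>)"

lemma lip_env_bdd: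
  fixes h :: "real \<Rightarrow> real"
  assumes "\<And>r. 0 \<le> h r" "0 \<le> n" shows "bdd_below (range (\<lambda>r. h r + n * \<bar>t - r\<bar>))"
proof (rule bdd_belowI[where m=0], clarify)
  show "0 \<le> h r + n * \<bar>t - r\<bar>" for r
    using assms(1)[of r] mult_nonneg_nonneg[OF assms(2) abs_ge_zero[of "t - r"]] by linarith
qed

lemma lip_env_le:
  assumes "\<And>r. 0 \<le> h r" "0 \<le> n" shows "lip_env h n t \<le> h r + n * \<bar>t - r\<bar>"
  unfolding lip_env_def by (rule cINF_lower[OF lip_env_bdd[OF assms]]) auto

lemma lip_env_greatest: "(\<And>r. c \<le> h r + n * \<bar>t - r\<bar>) \<Longrightarrow> c \<le> lip_env h n t"
  unfolding lip_env_def by (rule cINF_greatest) auto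

lemma lip_env_le_self: "(\<And>r. 0 \<le> h r) \<Longrightarrow> 0 \<le> n \<Longrightarrow> lip_env h n t \<le> h t"
  using lip_env_le[where h=h and n=n and t=t and r=t] by simp

lemma lip_env_nonneg: "(\<And>r. 0 \<le> h r) \<Longrightarrow> 0 \<le> n \<Longrightarrow> 0 \<le> lip_env h n t"
  by (rule lip_env_greatest) (intro add_nonneg_nonneg mult_nonneg_nonneg; simp)

lemma lip_env_lipschitz:
  assumes "\<And>r. 0 \<le> h r" "0 \<le> n" shows "\<bar>lip_env h n t - lip_env h n t'\<bar> \<le> n * \<bar>t - t'\<bar>"
proof -
  have *: "lip_env h n t - n * \<bar>t - t'\<bar> \<le> lip_env h n t'" for t t'
  proof (rule lip_env_greatest)
    fix r
    have "lip_env h n t \<le> h r + n * \<bar>t - r\<bar>" by (rule lip_env_le[OF assms])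
    also have "\<dots> \<le> h r + n * (\<bar>t - t'\<bar> + \<bar>t' - r\<bar>)"
      using assms(2) by (intro add_left_mono mult_left_mono) auto
    finally show "lip_env h n t - n * \<bar>t - t'\<bar> \<le> h r + n * \<bar>t' - r\<bar>"
      by (simp add: algebra_simps)
  qed
  show ?thesis using *[of t t'] *[of t' t] by (simp add: abs_minus_commute abs_le_iff)
qed

text \<open>Compare the competitor \<open>r\<close> for \<open>t'\<close> with its translate by
  \<open>t - t'\<close>: it has the same distance to \<open>t\<close>, and \<open>h\<close> is not
  larger there.\<close>

lemma lip_env_mono:
  assumes "mono h" "\<And>r. 0 \<le> h r" "0 \<le> n" "t \<le> t'" shows "lip_env h n t \<le> lip_env h n t'"
proof (rule lip_env_greatest)
  fix r
  have "lip_env h n t \<le> h (r - (t' - t)) + n * \<bar>t - (r - (t' - t))\<bar>" by (rule lip_env_le[OF assms(2,3)])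
  also have "\<dots> \<le> h r + n * \<bar>t' - r\<bar>"
    using monoD[OF assms(1), of "r - (t' - t)" r] assms(4) by (simp add: algebra_simps)
  finally show "lip_env h n t \<le> h r + n * \<bar>t' - r\<bar>" .
qed

lemma lip_env_mono_slope:
  assumes "\<And>r. 0 \<le> h r" "0 \<le> n" "n \<le> n'" shows "lip_env h n t \<le> lip_env h n' t"
proof (rule lip_env_greatest)
  fix r
  have "n * \<bar>t - r\<bar> \<le> n' * \<bar>t - r\<bar>" using assms by (intro mult_right_mono) auto
  then show "lip_env h n t \<le> h r + n' * \<bar>t - r\<bar>"
    using lip_env_le[where h=h and n=n and t=t and r=r] assms(1,2) by force
qed

text \<open>Competitors far from \<open>t\<close> pay at least n \<rho>, which exceeds
  \<open>h t\<close> for large n; near \<open>t\<close> continuity keeps \<open>h r\<close> close to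
  \<open>h t\<close>.\<close>

lemma lip_env_tendsto:
  assumes "\<And>r. 0 \<le> h r" "isCont h t" shows "(\<lambda>n. lip_env h (real n) t) \<longlonglongrightarrow> h t"
proof (rule LIMSEQ_I)
  fix e :: real assume e: "0 < e"
  then obtain \<rho> where \<rho>: "0 < \<rho>" "\<And>r. \<bar>r - t\<bar> < \<rho> \<Longrightarrow> \<bar>h r - h t\<bar> < e / 2"
    using assms(2) unfolding continuous_at_eps_delta dist_real_def by (metis half_gt_zero)
  obtain N :: nat where N: "h t / \<rho> \<le> real N" using real_arch_simple by blast
  have "norm (lip_env h (real n) t - h t) < e" if n: "N \<le> n" for n
  proof -
    have "h t - e / 2 \<le> lip_env h (real n) t"
    proof (rule lip_env_greatest)
      fix r
      show "h t - e / 2 \<le> h r + real n * \<bar>t - r\<bar>"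
      proof (cases "\<bar>r - t\<bar> < \<rho>")
        case True
        have "0 \<le> real n * \<bar>t - r\<bar>" by simp
        then show ?thesis using \<rho>(2)[OF True] by linarith
      next
        case False
        have "h t \<le> real N * \<rho>" using N \<rho>(1) by (simp add: divide_le_eq)
        also have "\<dots> \<le> real n * \<bar>t - r\<bar>" using False n \<rho>(1) by (intro mult_mono) auto
        finally show ?thesis using assms(1)[of r] e by linarith
      qed
    qed
    moreover have "lip_env h (real n) t \<le> h t" by (rule lip_env_le_self) (auto simp: assms)
    ultimately show ?thesis using e by simp
  qed
  then show "\<exists>N. \<forall>n\<ge>N. norm (lip_env h (real n) t - h t) < e" by blast
qed

lemma continuous_lip_env:
  assumes "\<And>r. 0 \<le> h r" "0 \<le> n" shows "continuous_on UNIV (lip_env h n)"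
proof (rule lipschitz_on_continuous_on[where L=n])
  show "n-lipschitz_on UNIV (lip_env h n)"
    by (rule lipschitz_onI) (use assms in \<open>auto simp: dist_real_def intro: lip_env_lipschitz\<close>)
qed

section \<open>Abstract weak solutions: comparison, existence, bounds\<close>

context green_operator
begin

text \<open>The right-hand side enters through its potential \<open>F\<close>: a measure datum is
  replaced by G[\<mu>], since by duality the integral of G[\<xi>] against \<mu> equals that of
  \<open>F * \<xi>\<close>. The nonlinearity may depend on \<open>x\<close> because the truncations
  used below are capped by multiples of \<open>d x\<close>.\<close>

definition sol :: "('a \<Rightarrow> real \<Rightarrow> real) \<Rightarrow> ('a \<Rightarrow> real) \<Rightarrow> ('a \<Rightarrow> real) \<Rightarrow> bool" where
  "sol \<beta> F u \<longleftrightarrow> u \<in> L1d \<and> (\<lambda>x. \<beta> x (u x)) \<in> L1d \<and>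
     (\<forall>\<xi>\<in>S. (\<integral>x. u x * \<xi> x \<partial>M) + (\<integral>x. \<beta> x (u x) * green \<xi> x \<partial>M) = (\<integral>x. F x * \<xi> x \<partial>M))"

text \<open>The last clause expresses, without mentioning a measure, that \<open>U\<close> is
  generated by a nonnegative source.\<close>

definition potential :: "('a \<Rightarrow> real) \<Rightarrow> bool" where
  "potential U \<longleftrightarrow> U \<in> L1d \<and> (\<forall>x\<in>space M. 0 \<le> U x) \<and>
     (\<forall>\<xi>\<in>S. (\<forall>x\<in>space M. 0 \<le> green \<xi> x) \<longrightarrow> 0 \<le> (\<integral>x. U x * \<xi> x \<partial>M))"

lemma potential_zero: "potential (\<lambda>_. 0)"
  by (simp add: potential_def L1d_zero)

lemma sol_le:
  assumes 1: "sol \<beta>\<^sub>1 F\<^sub>1 u\<^sub>1" and 2: "sol \<beta>\<^sub>2 F\<^sub>2 u\<^sub>2"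
    and b: "AE x in M. u\<^sub>2 x \<le> u\<^sub>1 x \<longrightarrow> \<beta>\<^sub>2 x (u\<^sub>2 x) \<le> \<beta>\<^sub>1 x (u\<^sub>1 x)"
    and F: "\<And>\<xi>. \<xi> \<in> S \<Longrightarrow> (\<And>x. x \<in> space M \<Longrightarrow> 0 \<le> green \<xi> x) \<Longrightarrow> (\<integral>x. F\<^sub>1 x * \<xi> x \<partial>M) \<le> (\<integral>x. F\<^sub>2 x * \<xi> x \<partial>M)"
  shows "AE x in M. u\<^sub>1 x \<le> u\<^sub>2 x"
proof -
  have L: "u\<^sub>1 \<in> L1d" "u\<^sub>2 \<in> L1d" "(\<lambda>x. \<beta>\<^sub>1 x (u\<^sub>1 x)) \<in> L1d" "(\<lambda>x. \<beta>\<^sub>2 x (u\<^sub>2 x)) \<in> L1d"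
    using 1 2 by (auto simp: sol_def)
  have "AE x in M. u\<^sub>1 x - u\<^sub>2 x \<le> 0"
  proof (rule comparison_principle[where f="\<lambda>x. \<beta>\<^sub>1 x (u\<^sub>1 x) - \<beta>\<^sub>2 x (u\<^sub>2 x)"])
    fix \<xi> assume xi: "\<xi> \<in> S" "\<And>x. x \<in> space M \<Longrightarrow> 0 \<le> green \<xi> x"
    note gS = green_in_S[OF xi(1)]
    have "(\<integral>x. (u\<^sub>1 x - u\<^sub>2 x) * \<xi> x \<partial>M) = (\<integral>x. u\<^sub>1 x * \<xi> x \<partial>M) - (\<integral>x. u\<^sub>2 x * \<xi> x \<partial>M)"
      using L1d_times_S[OF L(1) xi(1)] L1d_times_S[OF L(2) xi(1)] by (simp add: left_diff_distrib)
    moreover have "(\<integral>x. (\<beta>\<^sub>1 x (u\<^sub>1 x) - \<beta>\<^sub>2 x (u\<^sub>2 x)) * green \<xi> x \<partial>M)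
        = (\<integral>x. \<beta>\<^sub>1 x (u\<^sub>1 x) * green \<xi> x \<partial>M) - (\<integral>x. \<beta>\<^sub>2 x (u\<^sub>2 x) * green \<xi> x \<partial>M)"
      using L1d_times_S[OF L(3) gS] L1d_times_S[OF L(4) gS] by (simp add: left_diff_distrib)
    moreover have "(\<integral>x. F\<^sub>1 x * \<xi> x \<partial>M) \<le> (\<integral>x. F\<^sub>2 x * \<xi> x \<partial>M)" by (rule F[OF xi])
    moreover have "(\<integral>x. u\<^sub>1 x * \<xi> x \<partial>M) + (\<integral>x. \<beta>\<^sub>1 x (u\<^sub>1 x) * green \<xi> x \<partial>M) = (\<integral>x. F\<^sub>1 x * \<xi> x \<partial>M)"
      "(\<integral>x. u\<^sub>2 x * \<xi> x \<partial>M) + (\<integral>x. \<beta>\<^sub>2 x (u\<^sub>2 x) * green \<xi> x \<partial>M) = (\<integral>x. F\<^sub>2 x * \<xi> x \<partial>M)"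
      using 1 2 xi(1) by (auto simp: sol_def)
    ultimately show "(\<integral>x. (u\<^sub>1 x - u\<^sub>2 x) * \<xi> x \<partial>M) + (\<integral>x. (\<beta>\<^sub>1 x (u\<^sub>1 x) - \<beta>\<^sub>2 x (u\<^sub>2 x)) * green \<xi> x \<partial>M) \<le> 0"
      by linarith
  qed (use b L in \<open>auto intro: L1d_diff\<close>)
  then show ?thesis by simp
qed

lemma sol_linear: "F \<in> L1d \<Longrightarrow> sol (\<lambda>_ _. 0) F F"
  by (simp add: sol_def L1d_zero)

text \<open>This symmetry turns a decreasing family of nonlinearities into an increasing one, so
  \<open>sol_increasing_limit\<close> serves both.\<close>

lemma sol_reflect:
  assumes "sol \<beta> F u" shows "sol (\<lambda>x t. - \<beta> x (- t)) (\<lambda>x. - F x) (\<lambda>x. - u x)"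
  using assms L1d_minus by (auto simp: sol_def)

lemma potential_pairing_diff:
  assumes "potential U" "potential W" "\<xi> \<in> S"
  shows "(\<integral>x. (U x - W x) * \<xi> x \<partial>M) = (\<integral>x. U x * \<xi> x \<partial>M) - (\<integral>x. W x * \<xi> x \<partial>M)"
  using L1d_times_S[OF _ assms(3), of U] L1d_times_S[OF _ assms(3), of W] assms(1,2)
  by (simp add: potential_def left_diff_distrib)

text \<open>\<open>U\<close> and \<open>- W\<close> solve problems with zero nonlinearity. Where
  \<open>u\<close> exceeds \<open>U \<ge> 0\<close> the term \<open>\<beta> x (u x)\<close> is
  nonnegative, and symmetrically below \<open>- W\<close>; this is all that \<open>sol_le\<close>
  asks for.\<close>

lemma sol_bounds:
  assumes U: "potential U" and W: "potential W" and s: "sol \<beta> (\<lambda>x. U x - W x) u"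
    and b: "\<And>x t. x \<in> space M \<Longrightarrow> 0 \<le> t \<Longrightarrow> 0 \<le> \<beta> x t" "\<And>x t. x \<in> space M \<Longrightarrow> t \<le> 0 \<Longrightarrow> \<beta> x t \<le> 0"
  shows "AE x in M. - W x \<le> u x \<and> u x \<le> U x"
proof -
  have UL: "U \<in> L1d" "W \<in> L1d" "\<And>x. x \<in> space M \<Longrightarrow> 0 \<le> U x" "\<And>x. x \<in> space M \<Longrightarrow> 0 \<le> W x"
    using U W by (auto simp: potential_def)
  have "AE x in M. u x \<le> U x"
  proof (rule sol_le[OF s sol_linear[OF UL(1)]])
    show "AE x in M. U x \<le> u x \<longrightarrow> 0 \<le> \<beta> x (u x)"
      using UL(3) by (auto intro!: AE_I2 b(1) intro: order_trans)
  qed (use W in \<open>auto simp: potential_pairing_diff[OF U W] potential_def\<close>)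
  moreover have "AE x in M. - W x \<le> u x"
  proof (rule sol_le[OF sol_linear[OF L1d_minus[OF UL(2)]] s])
    show "AE x in M. u x \<le> - W x \<longrightarrow> \<beta> x (u x) \<le> 0"
    proof (intro AE_I2 impI)
      fix x assume "x \<in> space M" "u x \<le> - W x"
      then show "\<beta> x (u x) \<le> 0" using UL(4)[of x] by (intro b(2)) auto
    qed
  qed (use U in \<open>auto simp: potential_pairing_diff[OF U W] potential_def\<close>)
  ultimately show ?thesis by eventually_elim simp
qed

text \<open>Substitute \<open>u = F - green q\<close>: the equation becomes
  \<open>q = \<beta> x (F x - green q x)\<close>, whose right-hand side is nonincreasing in the
  potential, as \<open>fixed_point\<close> requires.\<close>

lemma sol_exists_lipschitz:
  assumes F: "F \<in> L1d"
    and meas: "\<And>v. v \<in> borel_measurable M \<Longrightarrow> (\<lambda>x. \<beta> x (v x)) \<in> borel_measurable M"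
    and bnd: "\<And>x t. x \<in> space M \<Longrightarrow> \<bar>\<beta> x t\<bar> \<le> m * d x"
    and mono: "\<And>x t t'. x \<in> space M \<Longrightarrow> t \<le> t' \<Longrightarrow> \<beta> x t \<le> \<beta> x t'"
    and lip: "\<And>x t t'. x \<in> space M \<Longrightarrow> \<bar>\<beta> x t - \<beta> x t'\<bar> \<le> \<Lambda> * \<bar>t - t'\<bar>" and L: "0 < \<Lambda>"
  shows "\<exists>u. sol \<beta> F u"
proof -
  note [measurable] = L1d_measurable[OF F]
  have "\<exists>q\<in>S. \<forall>x\<in>space M. q x = \<beta> x (F x - green q x)"
  proof (rule fixed_point[where m=m and \<Lambda>=\<Lambda>])
    fix x t t' assume x: "x \<in> space M"
    show "\<bar>\<beta> x (F x - t) - \<beta> x (F x - t')\<bar> \<le> \<Lambda> * \<bar>t - t'\<bar>"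
      using lip[OF x, of "F x - t" "F x - t'"] by (simp add: abs_minus_commute)
  qed (use bnd mono L in \<open>auto intro!: meas\<close>)
  then obtain q where q: "q \<in> S" "\<And>x. x \<in> space M \<Longrightarrow> q x = \<beta> x (F x - green q x)" by auto
  note [measurable] = S_measurable[OF q(1)] S_measurable[OF green_in_S[OF q(1)]]
  have gL: "green q \<in> L1d" by (intro S_subset_L1d green_in_S q)
  have "sol \<beta> F (\<lambda>x. F x - green q x)"
    unfolding sol_def
  proof (intro conjI ballI)
    show "(\<lambda>x. F x - green q x) \<in> L1d" by (rule L1d_diff[OF F gL])
    show "(\<lambda>x. \<beta> x (F x - green q x)) \<in> L1d"
      by (rule L1d_bound[OF S_subset_L1d[OF q(1)]]) (use q(2) in \<open>auto intro!: meas\<close>)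
    fix \<xi> assume xi: "\<xi> \<in> S"
    have "(\<integral>x. \<beta> x (F x - green q x) * green \<xi> x \<partial>M) = (\<integral>x. q x * green \<xi> x \<partial>M)"
      by (rule Bochner_Integration.integral_cong) (auto simp: q(2)[symmetric])
    also have "\<dots> = (\<integral>x. green q x * \<xi> x \<partial>M)"
      by (rule green_dual[OF S_subset_L1d[OF q(1)] xi, symmetric])
    finally show "(\<integral>x. (F x - green q x) * \<xi> x \<partial>M) + (\<integral>x. \<beta> x (F x - green q x) * green \<xi> x \<partial>M)
       = (\<integral>x. F x * \<xi> x \<partial>M)"
      using L1d_times_S[OF F xi] L1d_times_S[OF gL xi] by (simp add: left_diff_distrib)
  qed
  then show ?thesis by blast
qed

lemma dominated_pairing_limit:
  assumes "Y \<in> L1d" "\<xi> \<in> S" and [measurable]: "u \<in> borel_measurable M" "\<And>n. v n \<in> borel_measurable M"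
    and "AE x in M. (\<lambda>n. v n x) \<longlonglongrightarrow> u x" "\<And>n. AE x in M. \<bar>v n x\<bar> \<le> Y x"
  shows "(\<lambda>n. \<integral>x. v n x * \<xi> x \<partial>M) \<longlonglongrightarrow> (\<integral>x. u x * \<xi> x \<partial>M)"
proof (rule integral_dominated_convergence)
  note [measurable] = S_measurable[OF assms(2)]
  have "(\<lambda>x. \<bar>\<xi> x\<bar>) \<in> S" by (rule S_bound[OF assms(2), where c=1]) auto
  then show "integrable M (\<lambda>x. Y x * \<bar>\<xi> x\<bar>)" by (rule L1d_times_S[OF assms(1)])
  show "AE x in M. (\<lambda>n. v n x * \<xi> x) \<longlonglongrightarrow> u x * \<xi> x"
    using assms(5) by eventually_elim (rule tendsto_mult_right)
  show "AE x in M. norm (v n x * \<xi> x) \<le> Y x * \<bar>\<xi> x\<bar>" for n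
    using assms(6)[of n] by eventually_elim (simp add: abs_mult mult_right_mono)
  show "(\<lambda>x. u x * \<xi> x) \<in> borel_measurable M" "\<And>n. (\<lambda>x. v n x * \<xi> x) \<in> borel_measurable M"
    by measurable
qed

lemma AE_bounded_in_L1d:
  assumes "Y \<in> L1d" "u \<in> borel_measurable M" "AE x in M. (\<lambda>n. v n x) \<longlonglongrightarrow> u x"
    and "\<And>n::nat. AE x in M. \<bar>v n x\<bar> \<le> Y x"
  shows "u \<in> L1d"
proof (rule L1d_bound[OF assms(1,2)])
  have "AE x in M. \<forall>n. \<bar>v n x\<bar> \<le> Y x" using assms(4) by (simp add: AE_all_countable)
  then show "AE x in M. \<bar>u x\<bar> \<le> \<bar>Y x\<bar>"
    using assms(3)
  proof eventually_elim
    case (elim x)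
    have "\<bar>u x\<bar> \<le> Y x"
      by (rule LIMSEQ_le_const2[OF tendsto_rabs[OF elim(2)]]) (use elim(1) in auto)
    then show ?case by linarith
  qed
qed

text \<open>Larger absorption gives smaller solutions, so \<open>u n\<close> decreases and is
  bounded below by \<open>- W\<close>. The nonlinear terms converge without any uniformity:
  \<open>\<beta> n x (u n x)\<close> lies between \<open>\<beta> n x (v x)\<close> and
  \<open>\<beta>' x (u n x)\<close>, and both tend to \<open>\<beta>' x (v x)\<close>.\<close>

lemma sol_increasing_limit:
  assumes U: "potential U" and W: "potential W" and Z: "Z \<in> L1d"
    and ex: "\<And>n. \<exists>u. sol (\<beta> n) (\<lambda>x. U x - W x) u"
    and mono: "\<And>n x t t'. x \<in> space M \<Longrightarrow> t \<le> t' \<Longrightarrow> \<beta> n x t \<le> \<beta> n x t'"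
    and zero: "\<And>n x. x \<in> space M \<Longrightarrow> \<beta> n x 0 = 0"
    and inc: "\<And>n x t. x \<in> space M \<Longrightarrow> \<beta> n x t \<le> \<beta> (Suc n) x t"
    and lim: "\<And>x t. x \<in> space M \<Longrightarrow> (\<lambda>n. \<beta> n x t) \<longlonglongrightarrow> \<beta>' x t"
    and cont: "\<And>x t. x \<in> space M \<Longrightarrow> isCont (\<beta>' x) t"
    and meas: "\<And>v. v \<in> borel_measurable M \<Longrightarrow> (\<lambda>x. \<beta>' x (v x)) \<in> borel_measurable M"
    and dom: "\<And>n x t. x \<in> space M \<Longrightarrow> - W x \<le> t \<Longrightarrow> t \<le> U x \<Longrightarrow> \<bar>\<beta> n x t\<bar> \<le> Z x"
  shows "\<exists>u. sol \<beta>' (\<lambda>x. U x - W x) u"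
proof -
  have UL: "U \<in> L1d" "W \<in> L1d" "\<And>x. x \<in> space M \<Longrightarrow> 0 \<le> U x" "\<And>x. x \<in> space M \<Longrightarrow> 0 \<le> W x"
    using U W by (auto simp: potential_def)
  obtain u where u: "\<And>n. sol (\<beta> n) (\<lambda>x. U x - W x) (u n)" using ex by metis
  have uL: "\<And>n. u n \<in> L1d" "\<And>n. (\<lambda>x. \<beta> n x (u n x)) \<in> L1d" using u by (auto simp: sol_def)
  have [measurable]: "\<And>n. u n \<in> borel_measurable M" using uL L1d_measurable by blast
  have bn: "0 \<le> \<beta> n x t" if "x \<in> space M" "0 \<le> t" for n x t
    using mono[OF that, of n] zero[OF that(1), of n] by simp
  have bn': "\<beta> n x t \<le> 0" if "x \<in> space M" "t \<le> 0" for n x t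
    using mono[OF that, of n] zero[OF that(1), of n] by simp
  have "AE x in M. - W x \<le> u n x \<and> u n x \<le> U x" for n
    by (rule sol_bounds[OF U W u[of n]]) (auto intro: bn bn')
  then have bnd: "AE x in M. \<forall>n. - W x \<le> u n x \<and> u n x \<le> U x" by (simp add: AE_all_countable)
  have "AE x in M. u (Suc n) x \<le> u n x" for n
  proof (rule sol_le[OF u u])
    show "AE x in M. u n x \<le> u (Suc n) x \<longrightarrow> \<beta> n x (u n x) \<le> \<beta> (Suc n) x (u (Suc n) x)"
      by (intro AE_I2 impI) (rule order_trans[OF mono inc])
  qed auto
  then have dec: "AE x in M. \<forall>n. u (Suc n) x \<le> u n x" by (simp add: AE_all_countable)
  define v where "v x = lim (\<lambda>n. u n x)" for x
  have vm: "v \<in> borel_measurable M" unfolding v_def by measurable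
  note meas' [measurable] = meas[OF vm]
  have cv: "AE x in M. (\<lambda>n. u n x) \<longlonglongrightarrow> v x \<and> (\<forall>n. v x \<le> u n x)"
    using bnd dec
  proof eventually_elim
    case (elim x)
    then have d: "decseq (\<lambda>n. u n x)" by (simp add: decseq_Suc_iff)
    obtain l where "(\<lambda>n. u n x) \<longlonglongrightarrow> l" "\<forall>n. l \<le> u n x"
      using decseq_convergent[OF d, of "- W x"] elim(1) by blast
    then show ?case by (auto simp: v_def limI)
  qed
  have cb: "AE x in M. (\<lambda>n. \<beta> n x (u n x)) \<longlonglongrightarrow> \<beta>' x (v x)"
    using cv AE_space
  proof eventually_elim
    case (elim x)
    have le: "\<beta> n x t \<le> \<beta>' x t" for n t
    proof -
      have "incseq (\<lambda>n. \<beta> n x t)" using inc[OF elim(2)] by (simp add: incseq_Suc_iff)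
      then show ?thesis by (rule incseq_le[OF _ lim[OF elim(2)]])
    qed
    have "(\<lambda>n. \<beta>' x (u n x)) \<longlonglongrightarrow> \<beta>' x (v x)"
      using elim by (intro isCont_tendsto_compose[OF cont]) auto
    show ?case
    proof (rule tendsto_sandwich[OF _ _ lim[OF elim(2)] \<open>(\<lambda>n. \<beta>' x (u n x)) \<longlonglongrightarrow> \<beta>' x (v x)\<close>])
      show "\<forall>\<^sub>F n in sequentially. \<beta> n x (v x) \<le> \<beta> n x (u n x)"
        using elim by (auto intro!: always_eventually mono)
      show "\<forall>\<^sub>F n in sequentially. \<beta> n x (u n x) \<le> \<beta>' x (u n x)"
        using le by (auto intro!: always_eventually)
    qed
  qed
  have dom_u: "AE x in M. \<bar>u n x\<bar> \<le> U x + W x" for n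
    using bnd AE_space
  proof eventually_elim
    case (elim x)
    have "- W x \<le> u n x" "u n x \<le> U x" using elim(1) by auto
    then show ?case using UL(3,4)[OF elim(2)] by linarith
  qed
  have dom_b: "AE x in M. \<bar>\<beta> n x (u n x)\<bar> \<le> Z x" for n
    using bnd AE_space by eventually_elim (auto intro: dom)
  have cv': "AE x in M. (\<lambda>n. u n x) \<longlonglongrightarrow> v x" using cv by eventually_elim simp
  have "sol \<beta>' (\<lambda>x. U x - W x) v"
    unfolding sol_def
  proof (intro conjI ballI)
    show "v \<in> L1d" by (rule AE_bounded_in_L1d[OF L1d_add[OF UL(1,2)] vm cv' dom_u])
    show "(\<lambda>x. \<beta>' x (v x)) \<in> L1d" by (rule AE_bounded_in_L1d[OF Z meas' cb dom_b])
    fix \<xi> assume xi: "\<xi> \<in> S"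
    have "(\<lambda>n. (\<integral>x. u n x * \<xi> x \<partial>M) + (\<integral>x. \<beta> n x (u n x) * green \<xi> x \<partial>M))
       \<longlonglongrightarrow> (\<integral>x. v x * \<xi> x \<partial>M) + (\<integral>x. \<beta>' x (v x) * green \<xi> x \<partial>M)"
      by (intro tendsto_add dominated_pairing_limit[OF L1d_add[OF UL(1,2)] xi vm _ cv' dom_u]
         dominated_pairing_limit[OF Z green_in_S[OF xi] meas' _ cb dom_b] L1d_measurable uL)
    moreover have "(\<integral>x. u n x * \<xi> x \<partial>M) + (\<integral>x. \<beta> n x (u n x) * green \<xi> x \<partial>M)
        = (\<integral>x. (U x - W x) * \<xi> x \<partial>M)" for n
      using u[of n] xi by (simp add: sol_def)
    ultimately show "(\<integral>x. v x * \<xi> x \<partial>M) + (\<integral>x. \<beta>' x (v x) * green \<xi> x \<partial>M) = (\<integral>x. (U x - W x) * \<xi> x \<partial>M)"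
      by (simp add: LIMSEQ_const_iff)
  qed
  then show ?thesis by blast
qed

text \<open>The two truncation parameters are sent to infinity one after the other: raising the
  first increases the nonlinearity, raising the second decreases it, so a joint limit would not be
  monotone.\<close>

lemma sol_exists:
  assumes U: "potential U" and W: "potential W"
    and g: "mono g" "continuous_on UNIV g" "g 0 = 0"
    and gU: "(\<lambda>x. g (U x)) \<in> L1d" and gW: "(\<lambda>x. g (- W x)) \<in> L1d"
  shows "\<exists>u. sol (\<lambda>_. g) (\<lambda>x. U x - W x) u"
proof -
  have UL: "U \<in> L1d" "W \<in> L1d" "\<And>x. x \<in> space M \<Longrightarrow> 0 \<le> U x" "\<And>x. x \<in> space M \<Longrightarrow> 0 \<le> W x"
    using U W by (auto simp: potential_def)
  have gc: "isCont g t" for t using g(2) by (simp add: continuous_on_eq_continuous_at)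
  have [measurable]: "g \<in> borel_measurable borel" using g(2) by (rule borel_measurable_continuous_onI)
  define gp where "gp t = max 0 (g t)" for t
  define gm where "gm t = max 0 (- g (- t))" for t
  have gp: "mono gp" "\<And>t. 0 \<le> gp t" "\<And>t. isCont gp t" and gm: "mono gm" "\<And>t. 0 \<le> gm t" "\<And>t. isCont gm t"
    unfolding gp_def gm_def
    by (auto intro!: monoI max.mono monoD[OF g(1)] continuous_intros gc isCont_o2[where f="\<lambda>x. - x" and g=g])
  have gpos: "0 \<le> g t" if "0 \<le> t" for t using monoD[OF g(1) that] g(3) by simp
  have gneg: "g t \<le> 0" if "t \<le> 0" for t using monoD[OF g(1) that] g(3) by simp
  have z: "gp t = 0" "gm t = 0" if "t \<le> 0" for t
    using gneg[of t] gpos[of "- t"] that by (auto simp: gp_def gm_def)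
  have g_split: "g t = gp t - gm (- t)" for t
    using gpos[of t] gneg[of t] by (cases "0 \<le> t") (auto simp: gp_def gm_def)
  \<comment> \<open>The envelope provides the Lipschitz constant n, the cap
    \<open>real n * d x\<close> the bound by a multiple of the weight that
    \<open>sol_exists_lipschitz\<close> demands. At a fixed point the cap disappears for large n
    because \<open>d x > 0\<close>.\<close>
  define P where "P n x t = min (lip_env gp (real n) t) (real n * d x)" for n x t
  define Q where "Q n x t = min (lip_env gm (real n) t) (real n * d x)" for n x t
  have [measurable]: "lip_env gp (real n) \<in> borel_measurable borel" "lip_env gm (real n) \<in> borel_measurable borel" for n
    by (auto intro!: borel_measurable_continuous_onI continuous_lip_env gp gm)
  have general: "0 \<le> min (lip_env h (real n) t) (real n * d x)"
      "min (lip_env h (real n) t) (real n * d x) \<le> h t"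
      "t \<le> t' \<Longrightarrow> min (lip_env h (real n) t) (real n * d x) \<le> min (lip_env h (real n) t') (real n * d x)"
      "\<bar>min (lip_env h (real n) t) (real n * d x) - min (lip_env h (real n) t') (real n * d x)\<bar> \<le> real n * \<bar>t - t'\<bar>"
      "min (lip_env h (real n) t) (real n * d x) \<le> min (lip_env h (real (Suc n)) t) (real (Suc n) * d x)"
      "(\<lambda>n. min (lip_env h (real n) t) (real n * d x)) \<longlonglongrightarrow> h t"
    if x: "x \<in> space M" and h: "mono h" "\<And>t. 0 \<le> h t" "\<And>t. isCont h t" for h n x t t'
  proof -
    have dx: "0 < d x" by (rule weight_pos[OF x])
    show "0 \<le> min (lip_env h (real n) t) (real n * d x)"
      using dx by (auto intro!: lip_env_nonneg h)
    show "min (lip_env h (real n) t) (real n * d x) \<le> h t"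
      by (rule min.coboundedI1) (auto intro!: lip_env_le_self h)
    show "min (lip_env h (real n) t) (real n * d x) \<le> min (lip_env h (real n) t') (real n * d x)" if "t \<le> t'"
      using lip_env_mono[OF h(1,2) _ that, of "real n"] by auto
    show "\<bar>min (lip_env h (real n) t) (real n * d x) - min (lip_env h (real n) t') (real n * d x)\<bar> \<le> real n * \<bar>t - t'\<bar>"
      by (rule order_trans[OF _ lip_env_lipschitz[of h "real n" t t', OF h(2)]]) auto
    show "min (lip_env h (real n) t) (real n * d x) \<le> min (lip_env h (real (Suc n)) t) (real (Suc n) * d x)"
      using dx by (intro min.mono lip_env_mono_slope h mult_right_mono) auto
    have "\<forall>\<^sub>F n in sequentially. h t \<le> real n * d x"
    proof -
      obtain N where N: "h t / d x \<le> real N" using real_arch_simple by blast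
      show ?thesis using eventually_ge_at_top[of N]
      proof eventually_elim
        case (elim n)
        then have "h t / d x \<le> real n" using N by simp
        then show ?case using dx by (simp add: divide_le_eq)
      qed
    qed
    then have "\<forall>\<^sub>F n in sequentially. lip_env h (real n) t = min (lip_env h (real n) t) (real n * d x)"
      by eventually_elim (simp add: min_absorb1 order_trans[OF lip_env_le_self[OF h(2)]])
    with lip_env_tendsto[OF h(2,3)] show "(\<lambda>n. min (lip_env h (real n) t) (real n * d x)) \<longlonglongrightarrow> h t"
      by (rule Lim_transform_eventually)
  qed
  note GP = general[OF _ gp, folded P_def] and GM = general[OF _ gm, folded Q_def]
  \<comment> \<open>Common majorant: for t between \<open>- W x\<close> and \<open>U x\<close> the
    positive part of \<open>g\<close> is at most \<open>g (U x)\<close> and the negative part at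
    most \<open>- g (- W x)\<close>, for all truncations at once.\<close>
  define Z where "Z x = g (U x) - g (- W x)" for x
  have Z: "Z \<in> L1d" unfolding Z_def by (rule L1d_diff[OF gU gW])
  have bounds_pm: "gp t \<le> g (U x)" "gm (- t) \<le> - g (- W x)" if "x \<in> space M" "- W x \<le> t" "t \<le> U x" for x t
    using monoD[OF g(1) that(2)] monoD[OF g(1) that(3)] gpos[OF UL(3)[OF that(1)]] gneg[of "- W x"] UL(4)[OF that(1)]
    by (auto simp: gp_def gm_def)
  have Zb: "\<bar>a - b\<bar> \<le> Z x" if "x \<in> space M" "- W x \<le> t" "t \<le> U x" "0 \<le> a" "a \<le> gp t" "0 \<le> b" "b \<le> gm (- t)" for a b x t
    using bounds_pm[OF that(1-3)] that(4-) by (simp add: Z_def abs_le_iff)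
  have P0: "P n x 0 = 0" "Q n x 0 = 0" if "x \<in> space M" for n x
    using GP(1,2)[OF that, of n 0] GM(1,2)[OF that, of n 0] z[of 0] by auto
  have ex1: "\<exists>u. sol (\<lambda>x t. P n x t - Q m x (- t)) (\<lambda>x. U x - W x) u" for n m
  proof (rule sol_exists_lipschitz[where m="real n + real m" and \<Lambda>="real n + real m + 1"])
    show "(\<lambda>x. U x - W x) \<in> L1d" by (rule L1d_diff[OF UL(1,2)])
    show "(\<lambda>x. P n x (v x) - Q m x (- v x)) \<in> borel_measurable M" if [measurable]: "v \<in> borel_measurable M" for v
      unfolding P_def Q_def by measurable
    fix x t t' assume x: "x \<in> space M"
    have "P n x t \<le> real n * d x" "Q m x (- t) \<le> real m * d x" by (auto simp: P_def Q_def)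
    moreover have "0 \<le> real n * d x" "0 \<le> real m * d x" using weight_pos[OF x] by auto
    ultimately show "\<bar>P n x t - Q m x (- t)\<bar> \<le> (real n + real m) * d x"
      using GP(1)[OF x, of n t] GM(1)[OF x, of m "- t"] by (simp add: distrib_right abs_le_iff)
    have "\<bar>P n x t - P n x t'\<bar> \<le> real n * \<bar>t - t'\<bar>" "\<bar>Q m x (- t) - Q m x (- t')\<bar> \<le> real m * \<bar>t - t'\<bar>"
      using GP(4)[OF x, of n t t'] GM(4)[OF x, of m "- t" "- t'"] by (auto simp: abs_minus_commute)
    then show "\<bar>P n x t - Q m x (- t) - (P n x t' - Q m x (- t'))\<bar> \<le> (real n + real m + 1) * \<bar>t - t'\<bar>"
      by (simp add: distrib_right)
    assume "t \<le> t'"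
    then show "P n x t - Q m x (- t) \<le> P n x t' - Q m x (- t')"
      using GP(3)[OF x, of t t' n] GM(3)[OF x, of "- t'" "- t" m] by auto
  qed auto
  have ex2: "\<exists>u. sol (\<lambda>x t. gp t - Q m x (- t)) (\<lambda>x. U x - W x) u" for m
  proof (rule sol_increasing_limit[OF U W Z ex1[of _ m]])
    fix x assume x: "x \<in> space M"
    show "P n x t - Q m x (- t) \<le> P n x t' - Q m x (- t')" if "t \<le> t'" for n t t'
      using that GP(3)[OF x, of t t' n] GM(3)[OF x, of "- t'" "- t" m] by auto
    show "P n x t - Q m x (- t) \<le> P (Suc n) x t - Q m x (- t)" for n t
      using GP(5)[OF x, of n t] by auto
    show "(\<lambda>n. P n x t - Q m x (- t)) \<longlonglongrightarrow> gp t - Q m x (- t)" for t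
      using GP(6)[OF x] by (intro tendsto_intros) auto
    have "isCont (lip_env gm (real m)) t" for t
      using continuous_lip_env[of gm "real m"] gm by (simp add: continuous_on_eq_continuous_at)
    then show "isCont (\<lambda>t. gp t - Q m x (- t)) t" for t
      unfolding Q_def by (intro continuous_intros gp isCont_o2[where f="\<lambda>x. - x"]) auto
    show "\<bar>P n x t - Q m x (- t)\<bar> \<le> Z x" if "- W x \<le> t" "t \<le> U x" for n t
      by (rule Zb[OF x that]) (auto intro: GP(1,2) GM(1,2) x)
  next
    show "(\<lambda>x. gp (v x) - Q m x (- v x)) \<in> borel_measurable M" if [measurable]: "v \<in> borel_measurable M" for v
      unfolding gp_def Q_def by measurable
  qed (simp add: P0)
  \<comment> \<open>The second limit is taken in the reflected problem, where raising the truncation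
    \<open>Q\<close> increases the nonlinearity; \<open>U\<close> and \<open>W\<close> exchange
    their roles.\<close>
  have "\<exists>u. sol (\<lambda>x t. - g (- t)) (\<lambda>x. W x - U x) u"
  proof (rule sol_increasing_limit[OF W U Z, where \<beta>="\<lambda>m x t. Q m x t - gp (- t)"])
    fix m
    obtain u where "sol (\<lambda>x t. gp t - Q m x (- t)) (\<lambda>x. U x - W x) u" using ex2 by blast
    from sol_reflect[OF this] show "\<exists>u. sol (\<lambda>x t. Q m x t - gp (- t)) (\<lambda>x. W x - U x) u" by auto
  next
    fix x assume x: "x \<in> space M"
    show "Q n x t - gp (- t) \<le> Q n x t' - gp (- t')" if "t \<le> t'" for n t t'
      using that GM(3)[OF x, of t t' n] monoD[OF gp(1), of "- t'" "- t"] by auto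
    show "Q n x t - gp (- t) \<le> Q (Suc n) x t - gp (- t)" for n t
      using GM(5)[OF x, of n t] by auto
    have "(\<lambda>n. Q n x t - gp (- t)) \<longlonglongrightarrow> gm t - gp (- t)" for t
      using GM(6)[OF x] by (intro tendsto_intros) auto
    then show "(\<lambda>n. Q n x t - gp (- t)) \<longlonglongrightarrow> - g (- t)" for t
      by (simp add: g_split)
    show "isCont (\<lambda>t. - g (- t)) t" for t
      by (intro continuous_intros isCont_o2[where f="\<lambda>x. - x" and g=g] gc)
    show "\<bar>Q n x t - gp (- t)\<bar> \<le> Z x" if "- U x \<le> t" "t \<le> W x" for n t
      using that GM(1,2)[OF x, of n t] gp(2) Zb[OF x, of "- t" "gp (- t)" "Q n x t"] by (simp add: abs_minus_commute)
    show "Q n x 0 - gp (- 0) = 0" for n using P0[OF x] z[of 0] by simp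
  next
    show "(\<lambda>x. - g (- v x)) \<in> borel_measurable M" if [measurable]: "v \<in> borel_measurable M" for v
      by measurable
  qed
  then obtain u where "sol (\<lambda>x t. - g (- t)) (\<lambda>x. W x - U x) u" by blast
  from sol_reflect[OF this] show ?thesis by auto
qed

text \<open>Enclose \<open>u\<close> between the solution \<open>w \<le> 0\<close> with datum
  \<open>- W\<close> and the solution \<open>v \<ge> 0\<close> with datum \<open>U\<close>, so that
  \<open>\<bar>g (u x)\<bar> \<le> g (v x) - g (w x)\<close>. The integrals of
  \<open>g (v x)\<close> and \<open>g (w x)\<close> against \<open>green \<xi>\<close> are read off
  from the equations, and the terms in \<open>v\<close> and \<open>w\<close> have a sign that lets
  them be dropped.\<close>

lemma absorption_bound:
  assumes U: "potential U" and W: "potential W"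
    and g: "mono g" "continuous_on UNIV g" "g 0 = 0"
    and gU: "(\<lambda>x. g (U x)) \<in> L1d" and gW: "(\<lambda>x. g (- W x)) \<in> L1d"
    and s: "sol (\<lambda>_. g) (\<lambda>x. U x - W x) u"
    and xi: "\<xi> \<in> S" "\<And>x. x \<in> space M \<Longrightarrow> 0 \<le> \<xi> x"
  shows "(\<integral>x. \<bar>g (u x)\<bar> * green \<xi> x \<partial>M) \<le> (\<integral>x. U x * \<xi> x \<partial>M) + (\<integral>x. W x * \<xi> x \<partial>M)"
proof -
  have gpos: "0 \<le> g t" if "0 \<le> t" for t using monoD[OF g(1) that] g(3) by simp
  have gneg: "g t \<le> 0" if "t \<le> 0" for t using monoD[OF g(1) that] g(3) by simp
  note gS = green_in_S[OF xi(1)]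
  have g0: "(\<lambda>x::'a. g 0) \<in> L1d" "(\<lambda>x::'a. g (- 0)) \<in> L1d" using L1d_zero g(3) by auto
  obtain v where v: "sol (\<lambda>_. g) (\<lambda>x. U x - 0) v"
    using sol_exists[OF U potential_zero g gU g0(2)] by blast
  obtain w where w: "sol (\<lambda>_. g) (\<lambda>x. 0 - W x) w"
    using sol_exists[OF potential_zero W g g0(1) gW] by blast
  have v0: "AE x in M. - 0 \<le> v x \<and> v x \<le> U x"
    by (rule sol_bounds[OF U potential_zero v]) (auto intro: gpos gneg)
  have w0: "AE x in M. - W x \<le> w x \<and> w x \<le> 0"
    by (rule sol_bounds[OF potential_zero W w]) (auto intro: gpos gneg)
  have uv: "AE x in M. u x \<le> v x"
  proof (rule sol_le[OF s v])
    show "AE x in M. v x \<le> u x \<longrightarrow> g (v x) \<le> g (u x)" using monoD[OF g(1)] by auto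
  qed (use W in \<open>auto simp: potential_pairing_diff[OF U W] potential_def\<close>)
  have wu: "AE x in M. w x \<le> u x"
  proof (rule sol_le[OF w s])
    show "AE x in M. u x \<le> w x \<longrightarrow> g (u x) \<le> g (w x)" using monoD[OF g(1)] by auto
  qed (use U in \<open>auto simp: potential_pairing_diff[OF U W] potential_def\<close>)
  have L: "(\<lambda>x. g (u x)) \<in> L1d" "(\<lambda>x. g (v x)) \<in> L1d" "(\<lambda>x. g (w x)) \<in> L1d" "v \<in> L1d" "w \<in> L1d"
    using s v w by (auto simp: sol_def)
  have gx: "0 \<le> green \<xi> x" if "x \<in> space M" for x by (rule green_nonneg[OF that xi(2)])
  note iv = L1d_times_S[OF L(2) gS] and iw = L1d_times_S[OF L(3) gS]
  have "(\<integral>x. \<bar>g (u x)\<bar> * green \<xi> x \<partial>M) \<le> (\<integral>x. g (v x) * green \<xi> x - g (w x) * green \<xi> x \<partial>M)"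
  proof (rule integral_mono_AE)
    show "AE x in M. \<bar>g (u x)\<bar> * green \<xi> x \<le> g (v x) * green \<xi> x - g (w x) * green \<xi> x"
      using uv wu v0 w0 AE_space
    proof eventually_elim
      case (elim x)
      have "\<bar>g (u x)\<bar> \<le> g (v x) - g (w x)"
        using monoD[OF g(1) elim(1)] monoD[OF g(1) elim(2)] gpos[of "v x"] gneg[of "w x"] elim(3,4) by auto
      from mult_right_mono[OF this gx[OF elim(5)]] show ?case by (simp add: left_diff_distrib)
    qed
  qed (use iv iw L1d_times_S[OF L1d_abs[OF L(1)] gS] in auto)
  also have "\<dots> = (\<integral>x. g (v x) * green \<xi> x \<partial>M) - (\<integral>x. g (w x) * green \<xi> x \<partial>M)"
    using iv iw by simp
  also have "(\<integral>x. g (v x) * green \<xi> x \<partial>M) = (\<integral>x. U x * \<xi> x \<partial>M) - (\<integral>x. v x * \<xi> x \<partial>M)"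
    using v xi(1) by (auto simp: sol_def)
  also have "(\<integral>x. g (w x) * green \<xi> x \<partial>M) = - (\<integral>x. W x * \<xi> x \<partial>M) - (\<integral>x. w x * \<xi> x \<partial>M)"
    using w xi(1) by (auto simp: sol_def)
  finally have "(\<integral>x. \<bar>g (u x)\<bar> * green \<xi> x \<partial>M)
    \<le> ((\<integral>x. U x * \<xi> x \<partial>M) - (\<integral>x. v x * \<xi> x \<partial>M)) - (- (\<integral>x. W x * \<xi> x \<partial>M) - (\<integral>x. w x * \<xi> x \<partial>M))" .
  moreover have "0 \<le> (\<integral>x. v x * \<xi> x \<partial>M)"
  proof (rule integral_nonneg_AE)
    show "AE x in M. 0 \<le> v x * \<xi> x" using v0 AE_space by eventually_elim (simp add: xi(2))
  qed
  moreover have "0 \<le> (\<integral>x. - (w x * \<xi> x) \<partial>M)"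
  proof (rule integral_nonneg_AE)
    show "AE x in M. 0 \<le> - (w x * \<xi> x)" using w0 AE_space
      by eventually_elim (simp add: xi(2) mult_nonpos_nonneg)
  qed
  ultimately show ?thesis by simp
qed

end

section \<open>Weak positivity of the variational Green operator\<close>

lemma frechet_derivative_eqI: "(f has_derivative f') (at x) \<Longrightarrow> frechet_derivative f (at x) = f'"
  by (rule frechet_derivative_at[symmetric])

lemma Ck_continuous: "Ck k f \<Longrightarrow> continuous_on UNIV f"
  by (cases k) (auto intro: differentiable_imp_continuous_on simp: differentiable_on_def
    intro: differentiable_at_withinI)

lemma Ck_SucD: "Ck (Suc k) f \<Longrightarrow> Ck k f"
proof (induction k arbitrary: f)
  case 0
  then show ?case using Ck_continuous[OF 0] by simp
qed auto

lemma Ck_const: "Ck k (\<lambda>_. c)"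
  by (induction k arbitrary: c) (auto simp: frechet_derivative_eqI[OF has_derivative_const])

lemma Ck_add: "Ck k f \<Longrightarrow> Ck k h \<Longrightarrow> Ck k (\<lambda>x. f x + h x)"
proof (induction k arbitrary: f h)
  case 0
  then show ?case by (auto intro: continuous_on_add)
next
  case (Suc k)
  then have "(f has_derivative frechet_derivative f (at x)) (at x)" "(h has_derivative frechet_derivative h (at x)) (at x)" for x
    by (auto simp: frechet_derivative_works)
  then have "((\<lambda>x. f x + h x) has_derivative (\<lambda>b. frechet_derivative f (at x) b + frechet_derivative h (at x) b)) (at x)" for x
    by (rule has_derivative_add)
  note D = this frechet_derivative_eqI[OF this]
  show ?case using Suc by (auto simp: D(2) intro: differentiableI[OF D(1)])
qed

lemma Ck_mult: "Ck k f \<Longrightarrow> Ck k h \<Longrightarrow> Ck k (\<lambda>x. f x * h x)"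
proof (induction k arbitrary: f h)
  case 0
  then show ?case by (auto intro: continuous_on_mult)
next
  case (Suc k)
  then have "(f has_derivative frechet_derivative f (at x)) (at x)" "(h has_derivative frechet_derivative h (at x)) (at x)" for x
    by (auto simp: frechet_derivative_works)
  then have "((\<lambda>x. f x * h x) has_derivative (\<lambda>b. f x * frechet_derivative h (at x) b + frechet_derivative f (at x) b * h x)) (at x)" for x
    by (rule has_derivative_mult)
  note D = this frechet_derivative_eqI[OF this]
  have "Ck k (\<lambda>x. f x * frechet_derivative h (at x) b + frechet_derivative f (at x) b * h x)" if "b \<in> Basis" for b
    using Suc that Ck_SucD[OF Suc.prems(1)] Ck_SucD[OF Suc.prems(2)] by (intro Ck_add Suc.IH) auto
  then show ?case by (auto simp: D(2) intro: differentiableI[OF D(1)])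
qed

text \<open>Each differentiation lowers the exponent by one, so the induction runs over all
  exponents simultaneously. Since \<open>e > 0\<close> the base never vanishes.\<close>

lemma Ck_powr_compose:
  assumes "0 < e" shows "Ck k \<phi> \<Longrightarrow> Ck k (\<lambda>x. ((\<phi> x)\<^sup>2 + e) powr r)"
proof (induction k arbitrary: r)
  case 0
  have "(\<phi> x)\<^sup>2 + e \<noteq> 0" for x using assms zero_le_power2[of "\<phi> x"] by linarith
  with 0 show ?case by (auto intro!: continuous_intros)
next
  case (Suc k)
  have pos: "0 < (\<phi> x)\<^sup>2 + e" for x using assms by (simp add: add_nonneg_pos)
  have d: "(\<phi> has_derivative frechet_derivative \<phi> (at x)) (at x)" for x
    using Suc.prems by (auto simp: frechet_derivative_works)
  have D: "((\<lambda>x. ((\<phi> x)\<^sup>2 + e) powr r) has_derivative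
      (\<lambda>b. (2 * r) * (\<phi> x * (frechet_derivative \<phi> (at x) b * ((\<phi> x)\<^sup>2 + e) powr (r - 1))))) (at x)" for x
  proof -
    have "((\<lambda>t. (t\<^sup>2 + e) powr r) has_real_derivative (r * ((\<phi> x)\<^sup>2 + e) powr (r - 1) * (2 * \<phi> x))) (at (\<phi> x))"
      using pos by (auto intro!: derivative_eq_intros)
    from has_derivative_compose[OF d this[unfolded has_field_derivative_def]] show ?thesis
      by (rule back_subst[of "\<lambda>f. (_ has_derivative f) (at x)"]) (auto simp: mult_ac)
  qed
  have "Ck k (\<lambda>x. (2 * r) * (\<phi> x * (frechet_derivative \<phi> (at x) b * ((\<phi> x)\<^sup>2 + e) powr (r - 1))))" if "b \<in> Basis" for b
    using Suc.prems that Suc.IH[OF Ck_SucD[OF Suc.prems]]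
    by (intro Ck_mult Ck_const Ck_SucD[OF Suc.prems]) auto
  then show ?case by (auto simp: frechet_derivative_eqI[OF D] intro: differentiableI[OF D])
qed

text \<open>A smooth nonincreasing approximation of twice the negative part of t. Subtracting
  \<open>e\<close> makes it vanish at 0, so composing it with a test function does not enlarge the
  support.\<close>

definition neg_approx :: "real \<Rightarrow> real \<Rightarrow> real" where
  "neg_approx e t = sqrt (t\<^sup>2 + e\<^sup>2) - e - t"

lemma neg_approx_0 [simp]: "0 \<le> e \<Longrightarrow> neg_approx e 0 = 0"
  by (simp add: neg_approx_def)

lemma sqrt_sum_lipschitz: "\<bar>sqrt (a\<^sup>2 + e\<^sup>2) - sqrt (b\<^sup>2 + e\<^sup>2)\<bar> \<le> \<bar>a - b\<bar>"
  using norm_triangle_ineq3[of "Complex a e" "Complex b e"] by (simp add: cmod_def)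

lemma neg_approx_antimono: "a \<le> b \<Longrightarrow> neg_approx e b \<le> neg_approx e a"
  using sqrt_sum_lipschitz[of a e b] by (simp add: neg_approx_def abs_le_iff)

lemma neg_approx_lipschitz: "\<bar>neg_approx e a - neg_approx e b\<bar> \<le> 2 * \<bar>a - b\<bar>"
proof -
  have "neg_approx e a - neg_approx e b = (sqrt (a\<^sup>2 + e\<^sup>2) - sqrt (b\<^sup>2 + e\<^sup>2)) - (a - b)"
    by (simp add: neg_approx_def)
  then show ?thesis
    using sqrt_sum_lipschitz[of a e b] abs_triangle_ineq4[of "sqrt (a\<^sup>2 + e\<^sup>2) - sqrt (b\<^sup>2 + e\<^sup>2)" "a - b"]
    by (simp del: abs_triangle_ineq4)
qed

lemma neg_approx_bound: "0 \<le> e \<Longrightarrow> \<bar>neg_approx e a\<bar> \<le> 2 * \<bar>a\<bar>"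
  using neg_approx_lipschitz[of e a 0] by simp

lemma neg_approx_sign: "(a - b) * (neg_approx e a - neg_approx e b) \<le> 0"
  using neg_approx_antimono[of a b e] neg_approx_antimono[of b a e]
  by (cases "a \<le> b") (auto simp: mult_le_0_iff)

lemma continuous_neg_approx: "continuous_on UNIV (neg_approx e)"
  unfolding neg_approx_def by (intro continuous_intros)

lemma neg_approx_tendsto: "(\<lambda>n. neg_approx (1 / real (Suc n)) t) \<longlonglongrightarrow> 2 * max 0 (- t)"
proof -
  have "(\<lambda>n. sqrt (t\<^sup>2 + (1 / real (Suc n))\<^sup>2) - 1 / real (Suc n) - t) \<longlonglongrightarrow> sqrt (t\<^sup>2 + 0\<^sup>2) - 0 - t"
    using LIMSEQ_Suc[OF lim_1_over_n] by (intro tendsto_intros) auto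
  moreover have "sqrt (t\<^sup>2 + 0\<^sup>2) - 0 - t = 2 * max 0 (- t)" by (simp add: max_def)
  ultimately show ?thesis by (simp only: neg_approx_def)
qed

lemma neg_approx_test_fun:
  assumes "0 < e" "\<phi> \<in> test_fun \<Omega>" shows "(\<lambda>x. neg_approx e (\<phi> x)) \<in> test_fun \<Omega>"
proof -
  have eq: "(\<lambda>x. neg_approx e (\<phi> x)) = (\<lambda>x. ((\<phi> x)\<^sup>2 + e\<^sup>2) powr (1/2) + (- e + (- 1) * \<phi> x))"
    by (rule ext) (simp add: neg_approx_def powr_half_sqrt)
  have "Ck k (\<lambda>x. neg_approx e (\<phi> x))" for k
    unfolding eq using assms by (intro Ck_add Ck_mult Ck_const Ck_powr_compose) (auto simp: test_fun_def)
  moreover have sub: "closure {x. neg_approx e (\<phi> x) \<noteq> 0} \<subseteq> closure {x. \<phi> x \<noteq> 0}"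
    using assms by (intro closure_mono) auto
  moreover have "compact (closure {x. neg_approx e (\<phi> x) \<noteq> 0})"
    using assms by (auto simp: test_fun_def compact_closure elim!: bounded_subset)
  ultimately show ?thesis using assms(2) by (auto simp: test_fun_def)
qed

section \<open>Set integrals, restricted Lebesgue measure and projections\<close>

lemma set_integrable_iff_restrict:
  "A \<in> sets M \<Longrightarrow> set_integrable M A f \<longleftrightarrow> integrable (restrict_space M A) (f :: _ \<Rightarrow> real)"
  unfolding set_integrable_def by (subst integrable_restrict_space) (auto simp: sets.Int_space_eq2)

lemma set_integral_eq_restrict:
  "A \<in> sets M \<Longrightarrow> set_lebesgue_integral M A f = integral\<^sup>L (restrict_space M A) (f :: _ \<Rightarrow> real)"
  unfolding set_lebesgue_integral_def by (subst integral_restrict_space) (auto simp: sets.Int_space_eq2)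

lemma set_borel_measurable_iff_restrict:
  "A \<in> sets M \<Longrightarrow> set_borel_measurable M A f \<longleftrightarrow> (f :: _ \<Rightarrow> real) \<in> borel_measurable (restrict_space M A)"
  unfolding set_borel_measurable_def by (subst borel_measurable_restrict_space_iff) (auto simp: sets.Int_space_eq2)

lemmas restrict_iffs = set_integrable_iff_restrict set_integral_eq_restrict set_borel_measurable_iff_restrict

lemma null_sets_lborel_Times:
  assumes "N \<in> null_sets (lborel :: 'a::euclidean_space measure)"
  shows "N \<times> UNIV \<in> null_sets (lborel :: ('a \<times> 'a) measure)" "UNIV \<times> N \<in> null_sets (lborel :: ('a \<times> 'a) measure)"
proof -
  have [measurable]: "N \<in> sets borel" and N: "emeasure lborel N = 0" using assms by auto
  show "N \<times> UNIV \<in> null_sets (lborel :: ('a \<times> 'a) measure)" "UNIV \<times> N \<in> null_sets (lborel :: ('a \<times> 'a) measure)"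
    unfolding lborel_prod[symmetric]
    by (auto simp: null_sets_def lborel.emeasure_pair_measure_Times N)
qed

text \<open>Lebesgue sets are Borel sets up to null sets, so beyond Borel measurability it must be
  known that the preimage of a null set, a strip over it in the product, is again null.\<close>

lemma measurable_fst_lebesgue: "fst \<in> (lebesgue :: ('a \<times> 'a::euclidean_space) measure) \<rightarrow>\<^sub>M lebesgue"
  and measurable_snd_lebesgue: "snd \<in> (lebesgue :: ('a \<times> 'a::euclidean_space) measure) \<rightarrow>\<^sub>M lebesgue"
proof -
  have f: "fst \<in> (lebesgue :: ('a \<times> 'a) measure) \<rightarrow>\<^sub>M lborel" "snd \<in> (lebesgue :: ('a \<times> 'a) measure) \<rightarrow>\<^sub>M lborel"
    by (auto intro!: measurable_completion simp: borel_prod[symmetric])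
  have v: "fst -` N \<inter> space lebesgue = N \<times> (UNIV :: 'a set)" "snd -` N \<inter> space lebesgue = (UNIV :: 'a set) \<times> N" for N :: "'a set"
    by auto
  show "fst \<in> (lebesgue :: ('a \<times> 'a) measure) \<rightarrow>\<^sub>M lebesgue"
  proof (rule completion.measurable_completion2[OF f(1)], rule subsetI)
    fix N :: "'a set" assume N: "N \<in> null_sets lborel"
    have "emeasure lebesgue (N \<times> (UNIV :: 'a set)) = 0"
      using null_sets_lborel_Times(1)[OF N] by (auto dest: null_sets_completionI)
    then show "N \<in> null_sets (distr lebesgue lborel (fst :: 'a \<times> 'a \<Rightarrow> 'a))"
      using N f(1) v(1)[of N] by (auto simp: null_sets_def emeasure_distr)
  qed
  show "snd \<in> (lebesgue :: ('a \<times> 'a) measure) \<rightarrow>\<^sub>M lebesgue"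
  proof (rule completion.measurable_completion2[OF f(2)], rule subsetI)
    fix N :: "'a set" assume N: "N \<in> null_sets lborel"
    have "emeasure lebesgue ((UNIV :: 'a set) \<times> N) = 0"
      using null_sets_lborel_Times(2)[OF N] by (auto dest: null_sets_completionI)
    then show "N \<in> null_sets (distr lebesgue lborel (snd :: 'a \<times> 'a \<Rightarrow> 'a))"
      using N f(2) v(2)[of N] by (auto simp: null_sets_def emeasure_distr)
  qed
qed

lemma measurable_lebesgue_on_Times:
  fixes u :: "'a::euclidean_space \<Rightarrow> real"
  assumes "u \<in> borel_measurable (lebesgue_on \<Omega>)"
  shows "(\<lambda>p. u (fst p)) \<in> borel_measurable (lebesgue_on (\<Omega> \<times> \<Omega>))"
    and "(\<lambda>p. u (snd p)) \<in> borel_measurable (lebesgue_on (\<Omega> \<times> \<Omega>))"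
proof -
  have "fst \<in> lebesgue_on (\<Omega> \<times> \<Omega>) \<rightarrow>\<^sub>M lebesgue_on \<Omega>"
    by (intro measurable_restrict_space2 measurable_restrict_space1 measurable_fst_lebesgue)
      (auto simp: space_restrict_space)
  from measurable_compose[OF this assms] show "(\<lambda>p. u (fst p)) \<in> borel_measurable (lebesgue_on (\<Omega> \<times> \<Omega>))" .
  have "snd \<in> lebesgue_on (\<Omega> \<times> \<Omega>) \<rightarrow>\<^sub>M lebesgue_on \<Omega>"
    by (intro measurable_restrict_space2 measurable_restrict_space1 measurable_snd_lebesgue)
      (auto simp: space_restrict_space)
  from measurable_compose[OF this assms] show "(\<lambda>p. u (snd p)) \<in> borel_measurable (lebesgue_on (\<Omega> \<times> \<Omega>))" .
qed

lemma mult_le_young: "0 < n \<Longrightarrow> a * b \<le> n / 2 * a\<^sup>2 + 1 / (2 * n) * b\<^sup>2" for a b n :: real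
proof -
  assume n: "0 < n"
  have "0 \<le> (n * a - b)\<^sup>2" by simp
  then have "2 * n * (a * b) \<le> n\<^sup>2 * a\<^sup>2 + b\<^sup>2" by (simp add: power2_diff power_mult_distrib mult_ac)
  then have "a * b \<le> (n\<^sup>2 * a\<^sup>2 + b\<^sup>2) / (2 * n)" using n by (simp add: le_divide_eq mult_ac)
  also have "\<dots> = n / 2 * a\<^sup>2 + 1 / (2 * n) * b\<^sup>2" using n by (simp add: field_simps power2_eq_square)
  finally show ?thesis .
qed

lemma square_sum_le: "(a + b)\<^sup>2 \<le> 2 * a\<^sup>2 + 2 * b\<^sup>2" for a b :: real
  using sum_squares_bound[of a b] by (simp add: power2_sum)

lemma square_diff_le: "(a - b)\<^sup>2 \<le> 2 * a\<^sup>2 + 2 * b\<^sup>2" for a b :: real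
  using square_sum_le[of a "- b"] by simp

section \<open>The variational equation for a fixed datum\<close>

locale variational_problem =
  fixes \<Omega> :: "'a::euclidean_space set" and J :: "'a \<Rightarrow> 'a \<Rightarrow> real" and B q \<zeta> :: "'a \<Rightarrow> real"
  assumes opn: "open \<Omega>" and L1: "cond_L1 \<Omega> J B" and q: "q \<in> L2 \<Omega>" and var: "variational_sol \<Omega> J B q \<zeta>"
begin

abbreviation "M1 \<equiv> lebesgue_on \<Omega>"
abbreviation "M2 \<equiv> lebesgue_on (\<Omega> \<times> \<Omega>)"

definition en :: "('a \<Rightarrow> real) \<Rightarrow> 'a \<times> 'a \<Rightarrow> real" where
  "en u p = J (fst p) (snd p) * (u (fst p) - u (snd p))\<^sup>2"

lemma sets_Omega [measurable, simp]: "\<Omega> \<in> sets lebesgue" "\<Omega> \<times> \<Omega> \<in> sets lebesgue"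
  using opn by (auto intro!: sets_completionI_sets borel_open open_Times)

lemma J_meas [measurable]: "(\<lambda>p. J (fst p) (snd p)) \<in> borel_measurable M2"
  and B_meas [measurable]: "B \<in> borel_measurable M1"
  using L1 by (auto simp: cond_L1_def restrict_iffs split_beta')

lemma J_nonneg: "p \<in> \<Omega> \<times> \<Omega> \<Longrightarrow> fst p \<noteq> snd p \<Longrightarrow> 0 \<le> J (fst p) (snd p)"
  and B_nonneg: "x \<in> \<Omega> \<Longrightarrow> 0 \<le> B x"
  using L1 by (auto simp: cond_L1_def)

lemma L2_iff: "u \<in> L2 \<Omega> \<longleftrightarrow> u \<in> borel_measurable M1 \<and> integrable M1 (\<lambda>x. (u x)\<^sup>2)"
  by (simp add: L2_def restrict_iffs)

lemma dom_iff: "u \<in> dom_E \<Omega> J B \<longleftrightarrow>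
    u \<in> borel_measurable M1 \<and> integrable M1 (\<lambda>x. (u x)\<^sup>2) \<and> integrable M2 (en u) \<and> integrable M1 (\<lambda>x. B x * (u x)\<^sup>2)"
  by (simp add: dom_E_def restrict_iffs L2_iff en_def[abs_def] split_beta')

lemma form_eq: "form_E \<Omega> J B u v = 1/2 * (\<integral>p. J (fst p) (snd p) * (u (fst p) - u (snd p)) * (v (fst p) - v (snd p)) \<partial>M2)
     + (\<integral>x. B x * u x * v x \<partial>M1)"
  by (simp add: form_E_def restrict_iffs split_beta')

lemma form_diag: "form_E \<Omega> J B u u = 1/2 * (\<integral>p. en u p \<partial>M2) + (\<integral>x. B x * (u x)\<^sup>2 \<partial>M1)"
  by (simp add: form_eq en_def power2_eq_square mult.assoc)

text \<open>On the diagonal the sign of \<open>J\<close> is unknown, but there the difference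
  quotient's numerator vanishes.\<close>

lemma en_nonneg: "p \<in> \<Omega> \<times> \<Omega> \<Longrightarrow> 0 \<le> en u p"
  using J_nonneg[of p] by (cases "fst p = snd p") (auto simp: en_def)

lemma form_parts_nonneg: "0 \<le> (\<integral>p. en u p \<partial>M2)" "0 \<le> (\<integral>x. B x * (u x)\<^sup>2 \<partial>M1)"
  by (auto intro!: Bochner_Integration.integral_nonneg en_nonneg mult_nonneg_nonneg B_nonneg simp: space_restrict_space)

lemma en_measurable [measurable (raw)]:
  assumes "u \<in> borel_measurable M1" shows "en u \<in> borel_measurable M2"
proof -
  note [measurable] = measurable_lebesgue_on_Times[OF assms]
  show ?thesis unfolding en_def by measurable
qed

lemma zeta_dom: "\<zeta> \<in> dom_E \<Omega> J B"
  using var by (auto simp: variational_sol_def space_H_def)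

lemma test_in_H: "v \<in> test_fun \<Omega> \<Longrightarrow> v \<in> dom_E \<Omega> J B \<Longrightarrow> v \<in> space_H \<Omega> J B"
  unfolding space_H_def by (auto intro!: bexI[of _ v] simp: form_eq restrict_iffs)

lemma var_eq: "v \<in> space_H \<Omega> J B \<Longrightarrow> form_E \<Omega> J B \<zeta> v = (\<integral>x. q x * v x \<partial>M1)"
  using var by (simp add: variational_sol_def restrict_iffs)

lemma L2_prod: "u \<in> L2 \<Omega> \<Longrightarrow> v \<in> L2 \<Omega> \<Longrightarrow> integrable M1 (\<lambda>x. u x * v x)"
proof -
  assume uv: "u \<in> L2 \<Omega>" "v \<in> L2 \<Omega>"
  then have [measurable]: "u \<in> borel_measurable M1" "v \<in> borel_measurable M1" by (auto simp: L2_iff)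
  have "integrable M1 (\<lambda>x. (u x)\<^sup>2 + (v x)\<^sup>2)" using uv by (auto simp: L2_iff)
  then show ?thesis
  proof (rule Bochner_Integration.integrable_bound)
    have "\<bar>a * b\<bar> \<le> a\<^sup>2 + b\<^sup>2" for a b :: real
    proof -
      have "0 \<le> \<bar>a\<bar> * \<bar>b\<bar>" by simp
      then show ?thesis using sum_squares_bound[of "\<bar>a\<bar>" "\<bar>b\<bar>"] unfolding abs_mult power2_abs by linarith
    qed
    then show "AE x in M1. norm (u x * v x) \<le> norm ((u x)\<^sup>2 + (v x)\<^sup>2)" by auto
  qed measurable
qed

text \<open>Test the variational equation with its own solution.\<close>

lemma energy_nonneg: "0 \<le> (\<integral>x. q x * \<zeta> x \<partial>M1)"
  using var_eq[of \<zeta>] form_parts_nonneg[of \<zeta>] var by (auto simp: variational_sol_def form_diag)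

lemma neg_approx_dom:
  assumes "0 < e" "\<phi> \<in> dom_E \<Omega> J B" shows "(\<lambda>x. neg_approx e (\<phi> x)) \<in> dom_E \<Omega> J B"
proof -
  have [measurable]: "\<phi> \<in> borel_measurable M1" and i: "integrable M1 (\<lambda>x. (\<phi> x)\<^sup>2)" "integrable M2 (en \<phi>)"
      "integrable M1 (\<lambda>x. B x * (\<phi> x)\<^sup>2)"
    using assms(2) by (auto simp: dom_iff)
  have m[measurable]: "(\<lambda>x. neg_approx e (\<phi> x)) \<in> borel_measurable M1"
    using measurable_compose[OF _ borel_measurable_continuous_onI[OF continuous_neg_approx]] by measurable
  have b1: "(neg_approx e t)\<^sup>2 \<le> 4 * t\<^sup>2" for t
    using power_mono[OF neg_approx_bound[of e t], of 2] assms(1) by (simp add: power_mult_distrib)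
  have b2: "(neg_approx e a - neg_approx e b)\<^sup>2 \<le> 4 * (a - b)\<^sup>2" for a b
    using power_mono[OF neg_approx_lipschitz[of e a b], of 2] by (simp add: power_mult_distrib)
  have "integrable M1 (\<lambda>x. (neg_approx e (\<phi> x))\<^sup>2)"
    by (rule Bochner_Integration.integrable_bound[OF integrable_mult_right[OF i(1), of 4]]) (use b1 in auto)
  moreover have "integrable M2 (en (\<lambda>x. neg_approx e (\<phi> x)))"
  proof (rule Bochner_Integration.integrable_bound[OF integrable_mult_right[OF i(2), of 4]])
    show "AE p in M2. norm (en (\<lambda>x. neg_approx e (\<phi> x)) p) \<le> norm (4 * en \<phi> p)"
    proof (rule AE_I2)
      fix p assume "p \<in> space M2"
      then have p: "p \<in> \<Omega> \<times> \<Omega>" by (simp add: space_restrict_space)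
      have "en (\<lambda>x. neg_approx e (\<phi> x)) p \<le> 4 * en \<phi> p"
        using mult_left_mono[OF b2 J_nonneg[OF p]] by (cases "fst p = snd p") (auto simp: en_def mult_ac)
      then show "norm (en (\<lambda>x. neg_approx e (\<phi> x)) p) \<le> norm (4 * en \<phi> p)"
        using en_nonneg[OF p] by simp
    qed
    show "en (\<lambda>x. neg_approx e (\<phi> x)) \<in> borel_measurable M2" by (rule en_measurable[OF m])
  qed
  moreover have "integrable M1 (\<lambda>x. B x * (neg_approx e (\<phi> x))\<^sup>2)"
  proof (rule Bochner_Integration.integrable_bound[OF integrable_mult_right[OF i(3), of 4]])
    show "AE x in M1. norm (B x * (neg_approx e (\<phi> x))\<^sup>2) \<le> norm (4 * (B x * (\<phi> x)\<^sup>2))"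
    proof (rule AE_I2)
      fix x assume "x \<in> space M1"
      then have "0 \<le> B x" by (simp add: space_restrict_space B_nonneg)
      then show "norm (B x * (neg_approx e (\<phi> x))\<^sup>2) \<le> norm (4 * (B x * (\<phi> x)\<^sup>2))"
        using mult_left_mono[OF b1[of "\<phi> x"]] by (simp add: mult_ac)
    qed
  qed measurable
  ultimately show ?thesis by (auto simp: dom_iff)
qed

lemma diff_dom:
  assumes "u \<in> dom_E \<Omega> J B" "v \<in> dom_E \<Omega> J B" shows "(\<lambda>x. u x - v x) \<in> dom_E \<Omega> J B"
proof -
  have [measurable]: "u \<in> borel_measurable M1" "v \<in> borel_measurable M1"
    and i: "integrable M1 (\<lambda>x. (u x)\<^sup>2)" "integrable M2 (en u)" "integrable M1 (\<lambda>x. B x * (u x)\<^sup>2)"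
      "integrable M1 (\<lambda>x. (v x)\<^sup>2)" "integrable M2 (en v)" "integrable M1 (\<lambda>x. B x * (v x)\<^sup>2)"
    using assms by (auto simp: dom_iff)
  have m: "(\<lambda>x. u x - v x) \<in> borel_measurable M1" by measurable
  have "integrable M1 (\<lambda>x. (u x - v x)\<^sup>2)"
    by (rule Bochner_Integration.integrable_bound[where f="\<lambda>x. 2 * (u x)\<^sup>2 + 2 * (v x)\<^sup>2"])
      (use i square_diff_le in auto)
  moreover have "integrable M2 (en (\<lambda>x. u x - v x))"
  proof (rule Bochner_Integration.integrable_bound[where f="\<lambda>p. 2 * en u p + 2 * en v p"])
    show "AE p in M2. norm (en (\<lambda>x. u x - v x) p) \<le> norm (2 * en u p + 2 * en v p)"
    proof (rule AE_I2)
      fix p assume "p \<in> space M2"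
      then have p: "p \<in> \<Omega> \<times> \<Omega>" by (simp add: space_restrict_space)
      have "en (\<lambda>x. u x - v x) p \<le> 2 * en u p + 2 * en v p"
        using mult_left_mono[OF square_diff_le[of "u (fst p) - u (snd p)" "v (fst p) - v (snd p)"] J_nonneg[OF p]]
        by (cases "fst p = snd p") (auto simp: en_def algebra_simps)
      then show "norm (en (\<lambda>x. u x - v x) p) \<le> norm (2 * en u p + 2 * en v p)"
        using en_nonneg[OF p, of "\<lambda>x. u x - v x"] en_nonneg[OF p, of u] en_nonneg[OF p, of v] by simp
    qed
  qed (use i en_measurable[OF m] in auto)
  moreover have "integrable M1 (\<lambda>x. B x * (u x - v x)\<^sup>2)"
  proof (rule Bochner_Integration.integrable_bound[where f="\<lambda>x. 2 * (B x * (u x)\<^sup>2) + 2 * (B x * (v x)\<^sup>2)"])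
    show "AE x in M1. norm (B x * (u x - v x)\<^sup>2) \<le> norm (2 * (B x * (u x)\<^sup>2) + 2 * (B x * (v x)\<^sup>2))"
    proof (rule AE_I2)
      fix x assume "x \<in> space M1"
      then have "0 \<le> B x" by (simp add: space_restrict_space B_nonneg)
      then show "norm (B x * (u x - v x)\<^sup>2) \<le> norm (2 * (B x * (u x)\<^sup>2) + 2 * (B x * (v x)\<^sup>2))"
        using mult_left_mono[OF square_diff_le[of "u x" "v x"]] by (simp add: algebra_simps)
    qed
    show "integrable M1 (\<lambda>x. 2 * (B x * (u x)\<^sup>2) + 2 * (B x * (v x)\<^sup>2))" using i by simp
    show "(\<lambda>x. B x * (u x - v x)\<^sup>2) \<in> borel_measurable M1" by measurable
  qed
  ultimately show ?thesis using m by (auto simp: dom_iff)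
qed

text \<open>For a test function \<open>\<phi>\<close> close to \<open>\<zeta>\<close> and \<open>v\<close> a nonincreasing function of \<open>\<phi>\<close>, the form
  \<open>\<E>(\<phi>, v)\<close> is nonpositive and \<open>\<E>(\<zeta> - \<phi>, v)\<close> is small.\<close>

lemma form_neg_approx_le:
  assumes e: "0 < e" and n: "0 < n" and phi: "\<phi> \<in> dom_E \<Omega> J B"
    and small: "form_E \<Omega> J B (\<lambda>x. \<zeta> x - \<phi> x) (\<lambda>x. \<zeta> x - \<phi> x) \<le> \<rho>"
  shows "form_E \<Omega> J B \<zeta> (\<lambda>x. neg_approx e (\<phi> x)) \<le> (n / 2 + 4 / n) * \<rho> + 4 / n * form_E \<Omega> J B \<zeta> \<zeta>"
proof -
  define v where "v x = neg_approx e (\<phi> x)" for x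
  define d where "d x = \<zeta> x - \<phi> x" for x
  have dd: "d \<in> dom_E \<Omega> J B" unfolding d_def[abs_def] by (rule diff_dom[OF zeta_dom phi])
  have i: "integrable M2 (en \<zeta>)" "integrable M1 (\<lambda>x. B x * (\<zeta> x)\<^sup>2)" "integrable M2 (en d)" "integrable M1 (\<lambda>x. B x * (d x)\<^sup>2)"
    using zeta_dom dd by (auto simp: dom_iff)
  define A where "A = n / 2 + 4 / n"
  have A: "0 \<le> A" using n by (simp add: A_def)
  \<comment> \<open>Here a, b, c, w stand for the increments of \<zeta>, \<phi>, \<zeta> - \<phi>
    and v. Write a w = c w + b w: the second product has a sign, and Young's inequality with
    parameter n treats the first, where w is controlled by b and hence by a and c. A large n makes
    the coefficient of a^2 small; the growing coefficient of c^2 is later beaten by the closeness of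
    \<phi>.\<close>
  have key: "a * w \<le> A * c\<^sup>2 + 4 / n * a\<^sup>2"
    if "b * w \<le> 0" "\<bar>w\<bar> \<le> 2 * \<bar>b\<bar>" "c = a - b" for a b c w :: real
  proof -
    have "a * w = c * w + b * w" unfolding that(3) by (simp add: algebra_simps)
    also have "\<dots> \<le> n / 2 * c\<^sup>2 + 1 / (2 * n) * w\<^sup>2" using that(1) mult_le_young[OF n, of c w] by linarith
    also have "\<dots> \<le> n / 2 * c\<^sup>2 + 1 / (2 * n) * (4 * (2 * a\<^sup>2 + 2 * c\<^sup>2))"
    proof -
      have "w\<^sup>2 \<le> (2 * b)\<^sup>2" using that(2) abs_le_square_iff[of w "2 * b"] by (simp add: abs_mult)
      also have "\<dots> \<le> 4 * (2 * a\<^sup>2 + 2 * c\<^sup>2)" using square_diff_le[of a c] that(3) by (simp add: power_mult_distrib)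
      finally show ?thesis using n by (intro add_left_mono mult_left_mono) auto
    qed
    also have "\<dots> = A * c\<^sup>2 + 4 / n * a\<^sup>2" using n by (simp add: A_def field_simps)
    finally show ?thesis .
  qed
  have 1: "(\<integral>p. J (fst p) (snd p) * (\<zeta> (fst p) - \<zeta> (snd p)) * (v (fst p) - v (snd p)) \<partial>M2)
      \<le> (\<integral>p. A * en d p + 4 / n * en \<zeta> p \<partial>M2)"
  \<comment> \<open>Only the majorant has to be integrable for this rule, at the price that it must
    be nonnegative.\<close>
  proof (rule integral_mono')
    fix p assume "p \<in> space M2"
    then have p: "p \<in> \<Omega> \<times> \<Omega>" by (simp add: space_restrict_space)
    show "0 \<le> A * en d p + 4 / n * en \<zeta> p" using en_nonneg[OF p] A n by simp
    have "(\<zeta> (fst p) - \<zeta> (snd p)) * (v (fst p) - v (snd p))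
      \<le> A * (d (fst p) - d (snd p))\<^sup>2 + 4 / n * (\<zeta> (fst p) - \<zeta> (snd p))\<^sup>2"
      by (rule key[where b="\<phi> (fst p) - \<phi> (snd p)"])
        (auto simp: v_def d_def neg_approx_sign neg_approx_lipschitz)
    from mult_left_mono[OF this J_nonneg[OF p]]
    show "J (fst p) (snd p) * (\<zeta> (fst p) - \<zeta> (snd p)) * (v (fst p) - v (snd p)) \<le> A * en d p + 4 / n * en \<zeta> p"
      by (cases "fst p = snd p") (auto simp: en_def algebra_simps)
  qed (use i in auto)
  have 2: "(\<integral>x. B x * \<zeta> x * v x \<partial>M1) \<le> (\<integral>x. A * (B x * (d x)\<^sup>2) + 4 / n * (B x * (\<zeta> x)\<^sup>2) \<partial>M1)"
  proof (rule integral_mono')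
    fix x assume "x \<in> space M1"
    then have x: "0 \<le> B x" by (simp add: space_restrict_space B_nonneg)
    then show "0 \<le> A * (B x * (d x)\<^sup>2) + 4 / n * (B x * (\<zeta> x)\<^sup>2)" using A n by simp
    have "\<zeta> x * v x \<le> A * (d x)\<^sup>2 + 4 / n * (\<zeta> x)\<^sup>2"
      by (rule key[where b="\<phi> x"])
        (use neg_approx_sign[of "\<phi> x" 0 e] neg_approx_bound[of e "\<phi> x"] e in \<open>auto simp: v_def d_def\<close>)
    from mult_left_mono[OF this x]
    show "B x * \<zeta> x * v x \<le> A * (B x * (d x)\<^sup>2) + 4 / n * (B x * (\<zeta> x)\<^sup>2)"
      by (simp add: algebra_simps)
  qed (use i in auto)
  have eq: "(\<integral>p. A * en d p + 4 / n * en \<zeta> p \<partial>M2) = A * (\<integral>p. en d p \<partial>M2) + 4 / n * (\<integral>p. en \<zeta> p \<partial>M2)"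
    "(\<integral>x. A * (B x * (d x)\<^sup>2) + 4 / n * (B x * (\<zeta> x)\<^sup>2) \<partial>M1)
      = A * (\<integral>x. B x * (d x)\<^sup>2 \<partial>M1) + 4 / n * (\<integral>x. B x * (\<zeta> x)\<^sup>2 \<partial>M1)"
    using i by (simp_all del: times_divide_eq_left)
  have "form_E \<Omega> J B \<zeta> v \<le> 1 / 2 * (A * (\<integral>p. en d p \<partial>M2) + 4 / n * (\<integral>p. en \<zeta> p \<partial>M2))
      + (A * (\<integral>x. B x * (d x)\<^sup>2 \<partial>M1) + 4 / n * (\<integral>x. B x * (\<zeta> x)\<^sup>2 \<partial>M1))"
    unfolding form_eq[of \<zeta> v]
    by (intro add_mono mult_left_mono order_trans[OF 1 eq_refl[OF eq(1)]] order_trans[OF 2 eq_refl[OF eq(2)]]) simp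
  also have "\<dots> = A * form_E \<Omega> J B d d + 4 / n * form_E \<Omega> J B \<zeta> \<zeta>"
    unfolding form_diag distrib_left by (simp only: mult_ac)
  finally have "form_E \<Omega> J B \<zeta> v \<le> A * form_E \<Omega> J B d d + 4 / n * form_E \<Omega> J B \<zeta> \<zeta>" .
  also have "A * form_E \<Omega> J B d d + 4 / n * form_E \<Omega> J B \<zeta> \<zeta> \<le> A * \<rho> + 4 / n * form_E \<Omega> J B \<zeta> \<zeta>"
    using small A unfolding d_def[symmetric] by (intro add_right_mono mult_left_mono) auto
  finally show ?thesis by (simp add: A_def v_def[abs_def])
qed

text \<open>The function tested with is \<open>neg_approx e\<close> of a test function \<phi> near
  \<zeta>, because such compositions are test functions again and thus admissible. The bound for the
  form and the error of exchanging \<phi> for \<zeta> in the pairing with \<open>q\<close> are both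
  of order 1/n when \<phi> is within 1/n of \<zeta>.\<close>

lemma neg_approx_pairing:
  assumes e: "0 < e" shows "(\<integral>x. q x * neg_approx e (\<zeta> x) \<partial>M1) \<le> 0"
proof (rule field_le_epsilon)
  fix \<epsilon> :: real assume eps: "0 < \<epsilon>"
  \<comment> \<open>The constant collects 5 from (n/2 + 4/n) / n^2 <= 5/n, 4 times the energy of
    \<zeta> from \<open>form_neg_approx_le\<close>, and 1 plus the integral of q^2 from Young's
    inequality in the pairing.\<close>
  define C where "C = 6 + 4 * form_E \<Omega> J B \<zeta> \<zeta> + (\<integral>x. (q x)\<^sup>2 \<partial>M1)"
  have C: "0 < C" using form_parts_nonneg[of \<zeta>] Bochner_Integration.integral_nonneg[of M1 "\<lambda>x. (q x)\<^sup>2"]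
    by (simp add: C_def form_diag add_pos_nonneg)
  define n where "n = max 1 (C / \<epsilon>)"
  have n: "1 \<le> n" by (simp add: n_def)
  have n': "C / n \<le> \<epsilon>"
  proof -
    have "C / \<epsilon> \<le> n" by (simp add: n_def)
    then show ?thesis using eps n by (simp add: divide_le_eq mult.commute)
  qed
  obtain \<phi> where phi: "\<phi> \<in> test_fun \<Omega>" "\<phi> \<in> dom_E \<Omega> J B"
    and close: "(\<integral>x. (\<zeta> x - \<phi> x)\<^sup>2 \<partial>M1) + form_E \<Omega> J B (\<lambda>x. \<zeta> x - \<phi> x) (\<lambda>x. \<zeta> x - \<phi> x) < (1 / n)\<^sup>2"
  proof -
    have "\<zeta> \<in> space_H \<Omega> J B" using var by (simp add: variational_sol_def)
    moreover have "0 < 1 / n" using n by simp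
    ultimately show thesis using that unfolding space_H_def restrict_iffs(2)[OF sets_Omega(1)] by blast
  qed
  define v where "v x = neg_approx e (\<phi> x)" for x
  have vH: "v \<in> space_H \<Omega> J B"
    unfolding v_def[abs_def] by (intro test_in_H neg_approx_test_fun neg_approx_dom phi e)
  have dm: "(\<lambda>x. \<zeta> x - \<phi> x) \<in> dom_E \<Omega> J B" by (rule diff_dom[OF zeta_dom phi(2)])
  have L2v: "v \<in> L2 \<Omega>" using vH by (auto simp: space_H_def dom_E_def)
  have L2z: "(\<lambda>x. neg_approx e (\<zeta> x)) \<in> L2 \<Omega>" using neg_approx_dom[OF e zeta_dom] by (simp add: dom_E_def)
  have d0: "0 \<le> (\<integral>x. (\<zeta> x - \<phi> x)\<^sup>2 \<partial>M1)" by simp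
  have small: "form_E \<Omega> J B (\<lambda>x. \<zeta> x - \<phi> x) (\<lambda>x. \<zeta> x - \<phi> x) \<le> (1 / n)\<^sup>2"
    using close d0 by linarith
  have f0: "0 \<le> form_E \<Omega> J B (\<lambda>x. \<zeta> x - \<phi> x) (\<lambda>x. \<zeta> x - \<phi> x)"
    using form_parts_nonneg[of "\<lambda>x. \<zeta> x - \<phi> x"] unfolding form_diag by simp
  have "(\<integral>x. q x * v x \<partial>M1) = form_E \<Omega> J B \<zeta> v" using var_eq[OF vH] by simp
  also have "\<dots> \<le> (n / 2 + 4 / n) * (1 / n)\<^sup>2 + 4 / n * form_E \<Omega> J B \<zeta> \<zeta>"
    unfolding v_def[abs_def] by (rule form_neg_approx_le[OF e _ phi(2) small]) (use n in auto)
  also have "(n / 2 + 4 / n) * (1 / n)\<^sup>2 \<le> 5 / n"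
  proof -
    have "(n / 2 + 4 / n) * (1 / n)\<^sup>2 = (1 / 2 + 4 / n\<^sup>2) / n" using n by (simp add: field_simps power2_eq_square)
    also have "\<dots> \<le> 5 / n"
    proof (rule divide_right_mono)
      have "1 \<le> n\<^sup>2" using n by simp
      then have "4 / n\<^sup>2 \<le> 4" using n by (simp add: divide_le_eq)
      then show "1 / 2 + 4 / n\<^sup>2 \<le> 5" by simp
    qed (use n in simp)
    finally show ?thesis .
  qed
  finally have 1: "(\<integral>x. q x * v x \<partial>M1) \<le> 5 / n + 4 / n * form_E \<Omega> J B \<zeta> \<zeta>" by simp
  have "(\<integral>x. q x * neg_approx e (\<zeta> x) - q x * v x \<partial>M1) \<le> (\<integral>x. 1 / n * (q x)\<^sup>2 + n * (\<zeta> x - \<phi> x)\<^sup>2 \<partial>M1)"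
  proof (rule integral_mono)
    fix x
    have "q x * neg_approx e (\<zeta> x) - q x * v x \<le> \<bar>q x\<bar> * \<bar>neg_approx e (\<zeta> x) - v x\<bar>"
      by (simp add: right_diff_distrib[symmetric] abs_mult[symmetric])
    also have "\<dots> \<le> \<bar>q x\<bar> * (2 * \<bar>\<zeta> x - \<phi> x\<bar>)"
      unfolding v_def by (intro mult_left_mono neg_approx_lipschitz) auto
    also have "\<dots> = 2 * (\<bar>\<zeta> x - \<phi> x\<bar> * \<bar>q x\<bar>)" by simp
    also have "\<dots> \<le> 2 * (n / 2 * \<bar>\<zeta> x - \<phi> x\<bar>\<^sup>2 + 1 / (2 * n) * \<bar>q x\<bar>\<^sup>2)"
      using n by (intro mult_left_mono mult_le_young) auto
    also have "\<dots> = 1 / n * (q x)\<^sup>2 + n * (\<zeta> x - \<phi> x)\<^sup>2" using n by (simp add: field_simps)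
    finally show "q x * neg_approx e (\<zeta> x) - q x * v x \<le> 1 / n * (q x)\<^sup>2 + n * (\<zeta> x - \<phi> x)\<^sup>2" .
  qed (use dm q L2_prod[OF q L2v] L2_prod[OF q L2z] in \<open>auto simp: dom_iff L2_iff\<close>)
  also have "\<dots> = 1 / n * (\<integral>x. (q x)\<^sup>2 \<partial>M1) + n * (\<integral>x. (\<zeta> x - \<phi> x)\<^sup>2 \<partial>M1)"
    using dm q by (subst Bochner_Integration.integral_add) (auto simp: dom_iff L2_iff)
  also have "\<dots> \<le> 1 / n * (\<integral>x. (q x)\<^sup>2 \<partial>M1) + n * (1 / n)\<^sup>2"
    using close f0 n by (intro add_left_mono mult_left_mono) auto
  also have "n * (1 / n)\<^sup>2 = 1 / n" using n by (simp add: power2_eq_square)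
  finally have 2: "(\<integral>x. q x * neg_approx e (\<zeta> x) - q x * v x \<partial>M1) \<le> 1 / n * (\<integral>x. (q x)\<^sup>2 \<partial>M1) + 1 / n" .
  have "(\<integral>x. q x * neg_approx e (\<zeta> x) - q x * v x \<partial>M1) = (\<integral>x. q x * neg_approx e (\<zeta> x) \<partial>M1) - (\<integral>x. q x * v x \<partial>M1)"
    by (rule Bochner_Integration.integral_diff[OF L2_prod[OF q L2z] L2_prod[OF q L2v]])
  with 1 2 have "(\<integral>x. q x * neg_approx e (\<zeta> x) \<partial>M1) \<le> C / n"
    by (simp add: C_def add_divide_distrib)
  then show "(\<integral>x. q x * neg_approx e (\<zeta> x) \<partial>M1) \<le> 0 + \<epsilon>" using n' by simp
qed

text \<open>Let the smoothing parameter tend to 0; \<open>2 * \<bar>q x * \<zeta> x\<bar>\<close>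
  dominates.\<close>

lemma negative_part_pairing: "(\<integral>x. q x * max 0 (- \<zeta> x) \<partial>M1) \<le> 0"
proof -
  have z: "\<zeta> \<in> L2 \<Omega>" using zeta_dom by (simp add: dom_E_def)
  have [measurable]: "q \<in> borel_measurable M1" "\<zeta> \<in> borel_measurable M1" using q z by (auto simp: L2_iff)
  have "(\<lambda>n. \<integral>x. q x * neg_approx (1 / real (Suc n)) (\<zeta> x) \<partial>M1) \<longlonglongrightarrow> (\<integral>x. q x * (2 * max 0 (- \<zeta> x)) \<partial>M1)"
  proof (rule integral_dominated_convergence)
    show "integrable M1 (\<lambda>x. 2 * \<bar>q x * \<zeta> x\<bar>)" using L2_prod[OF q z] by simp
    show "AE x in M1. (\<lambda>n. q x * neg_approx (1 / real (Suc n)) (\<zeta> x)) \<longlonglongrightarrow> q x * (2 * max 0 (- \<zeta> x))"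
      by (intro AE_I2 tendsto_mult_left neg_approx_tendsto)
    show "AE x in M1. norm (q x * neg_approx (1 / real (Suc n)) (\<zeta> x)) \<le> 2 * \<bar>q x * \<zeta> x\<bar>" for n
    proof (rule AE_I2)
      fix x
      show "norm (q x * neg_approx (1 / real (Suc n)) (\<zeta> x)) \<le> 2 * \<bar>q x * \<zeta> x\<bar>"
        using mult_left_mono[OF neg_approx_bound[of "1 / real (Suc n)" "\<zeta> x"], of "\<bar>q x\<bar>"] by (simp add: abs_mult mult_ac)
    qed
    show "(\<lambda>x. q x * (2 * max 0 (- \<zeta> x))) \<in> borel_measurable M1" by measurable
    show "(\<lambda>x. q x * neg_approx (1 / real (Suc n)) (\<zeta> x)) \<in> borel_measurable M1" for n
      unfolding neg_approx_def by measurable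
  qed
  then have "(\<integral>x. q x * (2 * max 0 (- \<zeta> x)) \<partial>M1) \<le> 0"
    by (rule LIMSEQ_le_const2) (auto intro!: neg_approx_pairing)
  then show ?thesis by (simp add: mult.left_commute[of _ 2] mult_le_0_iff)
qed

end

section \<open>Estimates for the Green kernel\<close>

lemma suminf_half_powr:
  assumes "0 < b" shows "(\<Sum>j. ennreal (((1/2) ^ j) powr b)) < \<infinity>"
proof -
  have eq: "((1/2) ^ j) powr b = ((1/2) powr b) ^ j" for j :: nat
    by (simp add: powr_realpow[symmetric] powr_powr mult.commute)
  have "(1/2 :: real) powr b < 1" using assms by (simp add: powr01_less_one)
  then have "summable (\<lambda>j. ((1/2 :: real) ^ j) powr b)" unfolding eq by (intro summable_geometric) auto
  then have "(\<Sum>j. ennreal (((1/2) ^ j) powr b)) = ennreal (\<Sum>j. ((1/2) ^ j) powr b)"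
    by (intro suminf_ennreal2) auto
  then show ?thesis by simp
qed

lemma dyadic_scale:
  assumes "0 < t" "t < (1::real)" obtains j :: nat where "(1/2) ^ Suc j \<le> t" "t < (1/2) ^ j"
proof -
  obtain n where n: "(1/2 :: real) ^ n < t" using real_arch_pow_inv[OF assms(1), of "1/2"] by auto
  define k where "k = (LEAST n. (1/2 :: real) ^ n \<le> t)"
  have k: "(1/2 :: real) ^ k \<le> t" unfolding k_def by (rule LeastI[of _ n]) (use n in simp)
  have "k \<noteq> 0" using k assms(2) by (cases "k = 0") auto
  then obtain j where j: "k = Suc j" using not0_implies_Suc by blast
  have "\<not> (1/2 :: real) ^ j \<le> t" unfolding k_def[symmetric] using not_less_Least[of j "\<lambda>n. (1/2 :: real) ^ n \<le> t"] j
    by (simp add: k_def)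
  then show thesis using that k j by auto
qed

text \<open>Cut the ball into dyadic shells. On the shell of outer radius r_j the integrand is at
  most (r_j / 2)^(b - N), and the volume is at most a constant times r_j^N, so the contributions
  form a geometric series in 2^(-j b). For simplicity each shell is enlarged to the whole ball of
  radius r_j.\<close>

lemma singular_integral:
  fixes b :: real assumes b: "0 < b" "b < DIM('a::euclidean_space)"
  shows "\<exists>I>0. \<forall>(y::'a) \<rho>. 0 < \<rho> \<longrightarrow>
     (\<integral>\<^sup>+x. ennreal (dist x y powr (b - DIM('a))) * indicator (ball y \<rho>) x \<partial>lebesgue) \<le> ennreal (I * \<rho> powr b)"
proof -
  define N where "N = real DIM('a)"
  define \<omega> where "\<omega> = measure lebesgue (ball (0::'a) 1)"
  define T where "T = (\<Sum>j. ennreal (((1/2) ^ j) powr b))"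
  have T: "T < \<infinity>" unfolding T_def by (rule suminf_half_powr[OF b(1)])
  \<comment> \<open>The summand 1 only makes the constant positive.\<close>
  define I where "I = \<omega> * 2 powr (N - b) * enn2real T + 1"
  have w0: "0 \<le> \<omega>" by (simp add: \<omega>_def)
  have vol: "emeasure lebesgue (ball (y::'a) r) = ennreal (r powr N * \<omega>)" if "0 < r" for y r
  proof -
    have "emeasure lebesgue (ball (0::'a) 1) = ennreal \<omega>"
      unfolding \<omega>_def using emeasure_lborel_ball_finite[of "0::'a" 1] by (subst emeasure_eq_ennreal_measure) auto
    then show ?thesis using emeasure_lebesgue_ball_conv_unit_ball[of r y] that w0
      by (simp add: N_def powr_realpow ennreal_mult)
  qed
  have "(\<integral>\<^sup>+x. ennreal (dist x y powr (b - N)) * indicator (ball y \<rho>) x \<partial>lebesgue) \<le> ennreal (I * \<rho> powr b)"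
    if rho: "0 < \<rho>" for y :: 'a and \<rho>
  proof -
    define r where "r j = (1/2) ^ j * \<rho>" for j :: nat
    have r: "0 < r j" for j using rho by (simp add: r_def)
    have "(\<integral>\<^sup>+x. ennreal (dist x y powr (b - N)) * indicator (ball y \<rho>) x \<partial>lebesgue)
      \<le> (\<integral>\<^sup>+x. (\<Sum>j. ennreal (r (Suc j) powr (b - N)) * indicator (ball y (r j)) x) \<partial>lebesgue)"
    proof (rule nn_integral_mono)
      fix x :: 'a
      show "ennreal (dist x y powr (b - N)) * indicator (ball y \<rho>) x
        \<le> (\<Sum>j. ennreal (r (Suc j) powr (b - N)) * indicator (ball y (r j)) x)"
      \<comment> \<open>At \<open>x = y\<close> the left-hand side is 0, because
        \<open>0 powr r = 0\<close> for every exponent.\<close>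
      proof (cases "x \<in> ball y \<rho> \<and> x \<noteq> y")
        case True
        then have "0 < dist x y / \<rho>" "dist x y / \<rho> < 1" using rho by (auto simp: dist_commute)
        then obtain j where j: "(1/2) ^ Suc j \<le> dist x y / \<rho>" "dist x y / \<rho> < (1/2) ^ j"
          by (rule dyadic_scale)
        have j': "r (Suc j) \<le> dist x y" "dist x y < r j"
          using j rho by (simp_all add: r_def le_divide_eq divide_less_eq)
        have "ennreal (dist x y powr (b - N)) * indicator (ball y \<rho>) x
            \<le> ennreal (r (Suc j) powr (b - N)) * indicator (ball y (r j)) x"
          using True j' r[of "Suc j"] b by (auto simp: dist_commute N_def intro!: ennreal_leI powr_mono2')
        also have "\<dots> \<le> (\<Sum>j. ennreal (r (Suc j) powr (b - N)) * indicator (ball y (r j)) x)"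
          (is "_ \<le> suminf ?F")
        proof -
          have "?F j = sum ?F {j}"
            using sum.insert[of "{}" j ?F] by (simp only: finite.emptyI empty_iff not_False_eq_True simp_thms sum.empty add_0_right)
          also have "\<dots> \<le> suminf ?F" by (rule sum_le_suminf[OF summableI]) simp_all
          finally show ?thesis .
        qed
        finally show ?thesis .
      qed (auto simp: indicator_def)
    qed
    also have "\<dots> = (\<Sum>j. \<integral>\<^sup>+x. ennreal (r (Suc j) powr (b - N)) * indicator (ball y (r j)) x \<partial>lebesgue)"
    proof (rule nn_integral_suminf)
      have "ball y (r j) \<in> sets lebesgue" for j by simp
      then show "(\<lambda>x. ennreal (r (Suc j) powr (b - N)) * indicator (ball y (r j)) x) \<in> borel_measurable lebesgue" for j
        by (intro borel_measurable_times_ennreal borel_measurable_const borel_measurable_indicator)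
    qed
    also have "\<dots> = (\<Sum>j. ennreal (\<omega> * 2 powr (N - b) * \<rho> powr b) * ennreal (((1/2) ^ j) powr b))"
    proof (rule suminf_cong)
      fix j
      have "(\<integral>\<^sup>+x. ennreal (r (Suc j) powr (b - N)) * indicator (ball y (r j)) x \<partial>lebesgue)
          = ennreal (r (Suc j) powr (b - N)) * ennreal (r j powr N * \<omega>)"
        using vol[OF r] by (subst nn_integral_cmult_indicator) auto
      also have "\<dots> = ennreal (r (Suc j) powr (b - N) * (r j powr N * \<omega>))"
        using w0 by (simp add: ennreal_mult)
      also have "r (Suc j) powr (b - N) * (r j powr N * \<omega>) = \<omega> * 2 powr (N - b) * \<rho> powr b * ((1/2) ^ j) powr b"
      proof -
        have "r (Suc j) powr (b - N) = (1/2) powr (b - N) * r j powr (b - N)"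
          using powr_mult[of "1/2" "r j" "b - N"] r[of j] by (simp add: r_def)
        also have "(1/2 :: real) powr (b - N) = 2 powr (N - b)"
          using powr_minus_divide[of 2 "N - b"] by (simp add: powr_divide powr_minus_divide[symmetric])
        finally have "r (Suc j) powr (b - N) * (r j powr N * \<omega>) = 2 powr (N - b) * (r j powr (b - N) * r j powr N) * \<omega>" by simp
        also have "r j powr (b - N) * r j powr N = r j powr b" by (simp add: powr_add[symmetric])
        also have "r j powr b = \<rho> powr b * ((1/2) ^ j) powr b" using rho by (simp add: r_def powr_mult)
        finally show ?thesis by (simp add: mult_ac)
      qed
      finally show "(\<integral>\<^sup>+x. ennreal (r (Suc j) powr (b - N)) * indicator (ball y (r j)) x \<partial>lebesgue)
         = ennreal (\<omega> * 2 powr (N - b) * \<rho> powr b) * ennreal (((1/2) ^ j) powr b)"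
        using w0 by (simp add: ennreal_mult)
    qed
    also have "\<dots> = ennreal (\<omega> * 2 powr (N - b) * \<rho> powr b) * T"
      unfolding T_def by (rule ennreal_suminf_cmult)
    also have "\<dots> = ennreal (\<omega> * 2 powr (N - b) * \<rho> powr b * enn2real T)"
      using T w0 by (simp add: ennreal_mult ennreal_enn2real)
    also have "\<dots> \<le> ennreal (I * \<rho> powr b)"
      by (intro ennreal_leI) (simp add: I_def algebra_simps)
    finally show ?thesis .
  qed
  moreover have "0 < I" using w0 by (simp add: I_def add_nonneg_pos)
  ultimately show ?thesis unfolding N_def by blast
qed

text \<open>The radius \<open>R\<close> of an enclosing ball and the constant \<open>I\<close> of
  \<open>singular_integral\<close> are parameters, so that the constants built from them are visibly
  the same for all kernels \<open>G\<close> with the same comparison constant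
  \<open>c\<close>.\<close>

locale green_domain =
  fixes \<Omega> :: "'a::euclidean_space set" and s \<gamma> c R I :: real and G :: "'a \<Rightarrow> 'a \<Rightarrow> real"
  assumes opn: "open \<Omega>" and ne: "\<Omega> \<noteq> {}" and bnd: "\<Omega> \<subseteq> ball 0 R"
    and s: "0 < s" and \<gamma>: "0 < \<gamma>" and dim: "2 * s < real DIM('a)" and c: "0 < c" and I: "0 < I"
    and sing: "\<And>(y::'a) \<rho>. 0 < \<rho> \<Longrightarrow>
       (\<integral>\<^sup>+x. ennreal (dist x y powr (2 * s - real DIM('a))) * indicator (ball y \<rho>) x \<partial>lebesgue) \<le> ennreal (I * \<rho> powr (2 * s))"
    and G_meas: "(\<lambda>(x, y). G x y) \<in> borel_measurable (restrict_space borel {(x, y). x \<in> \<Omega> \<and> y \<in> \<Omega> \<and> x \<noteq> y})"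
    and G_props: "\<And>x y. x \<in> \<Omega> \<Longrightarrow> y \<in> \<Omega> \<Longrightarrow> x \<noteq> y \<Longrightarrow> 0 < G x y \<and> G x y = G y x \<and>
        inverse c * kernel_bound \<Omega> s \<gamma> x y \<le> G x y \<and> G x y \<le> c * kernel_bound \<Omega> s \<gamma> x y"
    and G_cont: "continuous_on {(x, y). x \<in> \<Omega> \<and> y \<in> \<Omega> \<and> x \<noteq> y} (\<lambda>(x, y). G x y)"
begin

abbreviation "\<delta> \<equiv> bdist \<Omega>"
abbreviation "M \<equiv> lebesgue_on \<Omega>"

definition w :: "'a \<Rightarrow> real" where "w x = \<delta> x powr \<gamma>"

text \<open>The arbitrary diagonal values of \<open>G\<close> could spoil positivity and joint
  measurability; with 0 there, both hold on the whole square.\<close>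

definition \<kappa> :: "'a \<Rightarrow> 'a \<Rightarrow> real" where "\<kappa> x y = (if x = y then 0 else G x y)"

text \<open>Here \<open>2 powr \<gamma>\<close> stems from \<open>kernel_bound_weight\<close>, and
  the last two factors bound the singular integral over a ball of radius \<open>2 * R\<close>, which
  contains \<Omega> when centred in \<Omega>.\<close>

definition Kc :: real where "Kc = c * 2 powr \<gamma> * I * (2 * R) powr (2 * s)"

lemma R_pos: "0 < R"
  using ne bnd by (auto simp: subset_eq dest: order_le_less_trans[OF norm_ge_zero])

lemma Omega_sets [measurable, simp]: "\<Omega> \<in> sets lebesgue" "\<Omega> \<in> sets borel"
  using opn by auto

lemma space_M [simp]: "space M = \<Omega>"
  by (simp add: space_restrict_space)

lemma dist_lt: "x \<in> \<Omega> \<Longrightarrow> y \<in> \<Omega> \<Longrightarrow> dist x y < 2 * R"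
  using bnd dist_triangle2[of x y 0] subsetD[OF bnd, of x] subsetD[OF bnd, of y]
  by (simp add: dist_commute)

lemma delta_le: assumes "x \<in> \<Omega>" shows "\<delta> x \<le> 2 * R"
proof -
  obtain z :: 'a where z: "norm z = R" using vector_choose_size[of R] R_pos by auto
  then have "z \<notin> \<Omega>" using bnd by auto
  then have "\<delta> x \<le> dist x z" unfolding bdist_def by (intro infdist_le) auto
  also have "\<dots> \<le> norm x + norm z" using dist_triangle2[of x z 0] by (simp add: dist_norm)
  also have "\<dots> \<le> 2 * R" using z bnd assms by (auto simp: subset_eq less_imp_le)
  finally show ?thesis .
qed

lemma compl_ne: "- \<Omega> \<noteq> {}"
proof -
  obtain z :: 'a where "norm z = R" using vector_choose_size[of R] R_pos by auto
  then have "z \<notin> \<Omega>" using bnd by auto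
  then show ?thesis by auto
qed

lemma delta_pos: assumes "x \<in> \<Omega>" shows "0 < \<delta> x"
proof -
  have "closed (- \<Omega>)" using opn by auto
  then have "infdist x (- \<Omega>) \<noteq> 0" using in_closed_iff_infdist_zero[of "- \<Omega>" x] compl_ne assms by auto
  then show ?thesis using infdist_nonneg[of x "- \<Omega>"] by (simp add: bdist_def)
qed

lemma delta_triangle: "\<delta> x \<le> \<delta> y + dist x y"
  unfolding bdist_def by (rule infdist_triangle)

lemma w_pos: "x \<in> \<Omega> \<Longrightarrow> 0 < w x"
  using delta_pos by (fastforce simp: w_def)

lemma w_le: "x \<in> \<Omega> \<Longrightarrow> w x \<le> (2 * R) powr \<gamma>"
  unfolding w_def using delta_le delta_pos \<gamma> by (intro powr_mono2) (auto intro: less_imp_le)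

lemma w_borel [measurable]: "w \<in> borel_measurable borel"
proof -
  have "continuous_on UNIV \<delta>" unfolding bdist_def[abs_def] by (intro continuous_intros)
  then have [measurable]: "\<delta> \<in> borel_measurable borel" by (rule borel_measurable_continuous_onI)
  show ?thesis unfolding w_def by measurable
qed

lemma w_M [measurable]: "w \<in> borel_measurable M"
  by (intro measurable_restrict_space1 measurable_completion) simp

section \<open>Pointwise consequences of the two-sided kernel estimate\<close>

lemma min_powr_le_1: "(min a 1) powr \<gamma> \<le> 1" if "0 \<le> a"
  using that \<gamma> powr_le1[of \<gamma> "min a 1"] by simp

lemma kernel_bound_le_sing:
  assumes "x \<in> \<Omega>" "y \<in> \<Omega>" shows "kernel_bound \<Omega> s \<gamma> x y \<le> dist x y powr (2 * s - real DIM('a))"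
proof -
  have "kernel_bound \<Omega> s \<gamma> x y \<le> 1 / dist x y powr (real DIM('a) - 2 * s) * 1 * 1"
    unfolding kernel_bound_def using delta_pos[OF assms(1)] delta_pos[OF assms(2)]
    by (intro mult_mono min_powr_le_1) auto
  then show ?thesis by (simp add: powr_minus_divide[symmetric])
qed

text \<open>The boundary factor at x converts the weight at y into the weight at x: with r = |x - y|
  one has \<delta>(y) <= \<delta>(x) + r, hence min(\<delta>(x)/r, 1) \<delta>(y) <= 2
  \<delta>(x).\<close>

lemma kernel_bound_weight:
  assumes "x \<in> \<Omega>" "y \<in> \<Omega>" "x \<noteq> y"
  shows "kernel_bound \<Omega> s \<gamma> x y * w y \<le> 2 powr \<gamma> * w x * dist x y powr (2 * s - real DIM('a))"
proof -
  define r where "r = dist x y"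
  have r: "0 < r" using assms(3) by (simp add: r_def)
  have dx: "0 < \<delta> x" "0 < \<delta> y" using assms delta_pos by auto
  have "min (\<delta> x / r) 1 * \<delta> y \<le> min (\<delta> x / r) 1 * (\<delta> x + r)"
    using dx r delta_triangle[of y x] by (intro mult_left_mono) (auto simp: r_def dist_commute)
  also have "\<dots> = min (\<delta> x / r) 1 * \<delta> x + min (\<delta> x / r) 1 * r" by (simp add: distrib_left)
  also have "\<dots> \<le> 1 * \<delta> x + \<delta> x / r * r" using dx r by (intro add_mono mult_right_mono) auto
  finally have "min (\<delta> x / r) 1 * \<delta> y \<le> 2 * \<delta> x" using r by simp
  then have "(min (\<delta> x / r) 1 * \<delta> y) powr \<gamma> \<le> (2 * \<delta> x) powr \<gamma>"
    using dx r \<gamma> by (intro powr_mono2) auto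
  then have 1: "(min (\<delta> x / r) 1) powr \<gamma> * w y \<le> 2 powr \<gamma> * w x"
    using dx r by (simp add: w_def powr_mult)
  have "kernel_bound \<Omega> s \<gamma> x y * w y = r powr (2 * s - real DIM('a)) * ((min (\<delta> x / r) 1) powr \<gamma> * w y) * (min (\<delta> y / r) 1) powr \<gamma>"
    unfolding kernel_bound_def by (simp add: r_def powr_minus_divide[symmetric] mult_ac)
  also have "\<dots> \<le> r powr (2 * s - real DIM('a)) * (2 powr \<gamma> * w x) * 1"
    using dx r w_pos[OF assms(1)] w_pos[OF assms(2)] by (intro mult_mono 1 min_powr_le_1) auto
  finally show ?thesis by (simp add: r_def mult_ac)
qed

text \<open>For use away from the singularity: the factor at y yields the full weight of y at the
  price of another |x - y|^(-\<gamma>). The resulting exponent N + \<gamma> - 2s is the denominator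
  in \<open>p_star\<close>.\<close>

lemma kernel_bound_far:
  assumes "x \<in> \<Omega>" "y \<in> \<Omega>" "x \<noteq> y"
  shows "kernel_bound \<Omega> s \<gamma> x y \<le> w y * dist x y powr (2 * s - real DIM('a) - \<gamma>)"
proof -
  define r where "r = dist x y"
  have r: "0 < r" using assms(3) by (simp add: r_def)
  have dx: "0 < \<delta> x" "0 < \<delta> y" using assms delta_pos by auto
  have "(min (\<delta> y / r) 1) powr \<gamma> \<le> (\<delta> y / r) powr \<gamma>" using dx r \<gamma> by (intro powr_mono2) auto
  also have "\<dots> = w y * r powr (- \<gamma>)" using dx r by (simp add: w_def powr_divide powr_minus_divide)
  finally have 1: "(min (\<delta> y / r) 1) powr \<gamma> \<le> w y * r powr (- \<gamma>)" .
  have "kernel_bound \<Omega> s \<gamma> x y = r powr (2 * s - real DIM('a)) * (min (\<delta> x / r) 1) powr \<gamma> * (min (\<delta> y / r) 1) powr \<gamma>"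
    unfolding kernel_bound_def by (simp add: r_def powr_minus_divide[symmetric])
  also have "\<dots> \<le> r powr (2 * s - real DIM('a)) * 1 * (w y * r powr (- \<gamma>))"
    using 1 dx r by (intro mult_mono min_powr_le_1) auto
  also have "\<dots> = w y * r powr (2 * s - real DIM('a) - \<gamma>)" by (simp add: powr_add[symmetric])
  finally show ?thesis by (simp add: r_def)
qed

text \<open>All distances in \<Omega>, to the boundary and between points, are at most 2R, so each
  minimum is at least \<delta>/(2R).\<close>

lemma kernel_bound_lower:
  assumes "x \<in> \<Omega>" "y \<in> \<Omega>" "x \<noteq> y"
  shows "(2 * R) powr (2 * s - real DIM('a) - 2 * \<gamma>) * w x * w y \<le> kernel_bound \<Omega> s \<gamma> x y"
proof -
  define r where "r = dist x y"
  have r: "0 < r" "r \<le> 2 * R" using assms dist_lt[OF assms(1,2)] by (auto simp: r_def)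
  have m: "w z * (2 * R) powr (- \<gamma>) \<le> (min (\<delta> z / r) 1) powr \<gamma>" if z: "z \<in> \<Omega>" for z
  proof -
    have "w z * (2 * R) powr (- \<gamma>) = (\<delta> z / (2 * R)) powr \<gamma>"
      using delta_pos[OF z] R_pos by (simp add: w_def powr_divide powr_minus_divide)
    also have "\<dots> \<le> (min (\<delta> z / r) 1) powr \<gamma>"
      using delta_pos[OF z] delta_le[OF z] R_pos r \<gamma>
      by (intro powr_mono2) (auto intro: divide_left_mono)
    finally show ?thesis .
  qed
  have "(2 * R) powr (2 * s - real DIM('a) - 2 * \<gamma>) * w x * w y
      = (2 * R) powr (2 * s - real DIM('a)) * (w x * (2 * R) powr (- \<gamma>)) * (w y * (2 * R) powr (- \<gamma>))"
  proof -
    have "(2 * R) powr (2 * s - real DIM('a) - 2 * \<gamma>) = (2 * R) powr (2 * s - real DIM('a)) * (2 * R) powr (- \<gamma>) * (2 * R) powr (- \<gamma>)"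
      by (simp add: powr_add[symmetric])
    then show ?thesis by (simp add: mult_ac)
  qed
  also have "\<dots> \<le> r powr (2 * s - real DIM('a)) * (min (\<delta> x / r) 1) powr \<gamma> * (min (\<delta> y / r) 1) powr \<gamma>"
    using r dim w_pos[OF assms(1)] w_pos[OF assms(2)]
    by (intro mult_mono m assms powr_mono2') (auto intro: less_imp_le)
  also have "\<dots> = kernel_bound \<Omega> s \<gamma> x y"
    unfolding kernel_bound_def by (simp add: r_def powr_minus_divide[symmetric])
  finally show ?thesis .
qed

lemma kappa_nonneg: "x \<in> \<Omega> \<Longrightarrow> y \<in> \<Omega> \<Longrightarrow> 0 \<le> \<kappa> x y"
  using G_props by (auto simp: \<kappa>_def less_imp_le)

lemma kappa_sym: "x \<in> \<Omega> \<Longrightarrow> y \<in> \<Omega> \<Longrightarrow> \<kappa> x y = \<kappa> y x"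
  using G_props[of x y] by (auto simp: \<kappa>_def)

lemma kappa_le_sing: "x \<in> \<Omega> \<Longrightarrow> y \<in> \<Omega> \<Longrightarrow> \<kappa> x y \<le> c * dist x y powr (2 * s - real DIM('a))"
  using G_props[of x y] mult_left_mono[OF kernel_bound_le_sing[of x y], of c] c order_trans
  by (cases "x = y") (fastforce simp: \<kappa>_def)+

lemma kappa_weight:
  assumes "x \<in> \<Omega>" "y \<in> \<Omega>" shows "\<kappa> x y * w y \<le> c * 2 powr \<gamma> * w x * dist x y powr (2 * s - real DIM('a))"
proof (cases "x = y")
  case False
  have "\<kappa> x y * w y \<le> c * (kernel_bound \<Omega> s \<gamma> x y * w y)"
    using G_props[OF assms False] w_pos[OF assms(2)] False by (simp add: \<kappa>_def mult.assoc[symmetric] mult_right_mono)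
  also have "\<dots> \<le> c * (2 powr \<gamma> * w x * dist x y powr (2 * s - real DIM('a)))"
    using c by (intro mult_left_mono kernel_bound_weight assms False) auto
  finally show ?thesis by (simp add: mult_ac)
qed (simp add: \<kappa>_def)

lemma kappa_far:
  assumes "x \<in> \<Omega>" "y \<in> \<Omega>" shows "\<kappa> x y \<le> c * w y * dist x y powr (2 * s - real DIM('a) - \<gamma>)"
proof (cases "x = y")
  case False
  have "\<kappa> x y \<le> c * kernel_bound \<Omega> s \<gamma> x y" using G_props[OF assms False] False by (simp add: \<kappa>_def)
  also have "\<dots> \<le> c * (w y * dist x y powr (2 * s - real DIM('a) - \<gamma>))"
    using c by (intro mult_left_mono kernel_bound_far assms False) auto
  finally show ?thesis by (simp add: mult_ac)
qed (simp add: \<kappa>_def)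

lemma offdiag_open: "open {(x, y). x \<in> \<Omega> \<and> y \<in> \<Omega> \<and> x \<noteq> y}"
proof -
  have "{(x, y). x \<in> \<Omega> \<and> y \<in> \<Omega> \<and> x \<noteq> y} = (\<Omega> \<times> \<Omega>) \<inter> {p. fst p \<noteq> snd p}" by auto
  moreover have "open {p :: 'a \<times> 'a. fst p \<noteq> snd p}"
    by (intro open_Collect_neq continuous_intros)
  ultimately show ?thesis using opn by (simp add: open_Int open_Times)
qed

text \<open>General enough for the product of Lebesgue measure with itself as well as with a Radon
  measure on \<Omega>.\<close>

lemma kappa_measurable:
  assumes id1: "(\<lambda>x. x) \<in> M1 \<rightarrow>\<^sub>M borel" and id2: "(\<lambda>x. x) \<in> M2 \<rightarrow>\<^sub>M borel"
    and sp: "space M1 \<subseteq> \<Omega>" "space M2 \<subseteq> \<Omega>"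
  shows "case_prod \<kappa> \<in> borel_measurable (M1 \<Otimes>\<^sub>M M2)"
proof -
  let ?A = "{(x, y). x \<in> \<Omega> \<and> y \<in> \<Omega> \<and> x \<noteq> y}"
  have "(\<lambda>p. if p \<in> ?A then (case p of (x, y) \<Rightarrow> G x y) else 0) \<in> borel_measurable borel"
    using G_meas offdiag_open by (subst (asm) measurable_restrict_space_iff) (auto simp: borel_open)
  then have *: "(\<lambda>p. if p \<in> ?A then (case p of (x, y) \<Rightarrow> G x y) else 0) \<in> borel_measurable (borel \<Otimes>\<^sub>M borel)"
    by (simp add: borel_prod)
  have "(\<lambda>p. (fst p, snd p)) \<in> M1 \<Otimes>\<^sub>M M2 \<rightarrow>\<^sub>M borel \<Otimes>\<^sub>M borel"
    using measurable_compose[OF measurable_fst id1] measurable_compose[OF measurable_snd id2]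
    by (intro measurable_Pair) auto
  from measurable_compose[OF this *]
  show ?thesis
    by (rule measurable_cong[THEN iffD1, rotated]) (use sp in \<open>auto simp: space_pair_measure \<kappa>_def\<close>)
qed

lemma id_M: "(\<lambda>x. x) \<in> M \<rightarrow>\<^sub>M borel"
  by (intro measurable_restrict_space1 measurable_completion) simp

lemma finite_M: "emeasure M \<Omega> < \<infinity>"
proof -
  have "emeasure lebesgue \<Omega> \<le> emeasure lebesgue (ball (0::'a) R)" by (rule emeasure_mono[OF bnd]) simp
  also have "\<dots> < \<infinity>" using emeasure_lborel_ball_finite[of "0::'a" R] by simp
  finally show ?thesis by (simp add: emeasure_restrict_space)
qed

lemma nn_integral_sing_M:
  assumes "0 < \<rho>"
  shows "(\<integral>\<^sup>+x. ennreal (dist x y powr (2 * s - real DIM('a))) * indicator (ball y \<rho>) x \<partial>M) \<le> ennreal (I * \<rho> powr (2 * s))"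
proof -
  have "(\<integral>\<^sup>+x. ennreal (dist x y powr (2 * s - real DIM('a))) * indicator (ball y \<rho>) x \<partial>M)
    = (\<integral>\<^sup>+x. ennreal (dist x y powr (2 * s - real DIM('a))) * indicator (ball y \<rho>) x * indicator \<Omega> x \<partial>lebesgue)"
    by (rule nn_integral_restrict_space) simp
  also have "\<dots> \<le> (\<integral>\<^sup>+x. ennreal (dist x y powr (2 * s - real DIM('a))) * indicator (ball y \<rho>) x \<partial>lebesgue)"
    by (intro nn_integral_mono) (auto simp: indicator_def)
  also have "\<dots> \<le> ennreal (I * \<rho> powr (2 * s))" by (rule sing[OF assms])
  finally show ?thesis .
qed

text \<open>The radius is kept free for three uses: the diameter scale for \<open>Kc\<close>, small
  radii for continuity of potentials, and an optimised radius in the weak-type estimate.\<close>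

lemma kernel_weight_ball:
  assumes x: "x \<in> \<Omega>" and "0 < \<rho>"
  shows "(\<integral>\<^sup>+y. ennreal (\<kappa> x y * w y) * indicator (ball x \<rho>) y \<partial>M) \<le> ennreal (c * 2 powr \<gamma> * I * \<rho> powr (2 * s) * w x)"
proof -
  have "(\<integral>\<^sup>+y. ennreal (\<kappa> x y * w y) * indicator (ball x \<rho>) y \<partial>M)
     \<le> (\<integral>\<^sup>+y. ennreal (c * 2 powr \<gamma> * w x) * (ennreal (dist y x powr (2 * s - real DIM('a))) * indicator (ball x \<rho>) y) \<partial>M)"
  proof (rule nn_integral_mono)
    fix y assume "y \<in> space M"
    then have y: "y \<in> \<Omega>" by simp
    have "ennreal (\<kappa> x y * w y) \<le> ennreal (c * 2 powr \<gamma> * w x * dist y x powr (2 * s - real DIM('a)))"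
      using kappa_weight[OF x y] by (intro ennreal_leI) (simp add: dist_commute)
    also have "\<dots> = ennreal (c * 2 powr \<gamma> * w x) * ennreal (dist y x powr (2 * s - real DIM('a)))"
      using c w_pos[OF x] by (intro ennreal_mult) auto
    finally show "ennreal (\<kappa> x y * w y) * indicator (ball x \<rho>) y
       \<le> ennreal (c * 2 powr \<gamma> * w x) * (ennreal (dist y x powr (2 * s - real DIM('a))) * indicator (ball x \<rho>) y)"
      by (auto simp: indicator_def)
  qed
  also have "\<dots> = ennreal (c * 2 powr \<gamma> * w x) * (\<integral>\<^sup>+y. ennreal (dist y x powr (2 * s - real DIM('a))) * indicator (ball x \<rho>) y \<partial>M)"
  proof (rule nn_integral_cmult)
    note [measurable] = id_M
    have [measurable]: "ball x \<rho> \<in> sets borel" by simp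
    have "(\<lambda>y. ennreal (dist y x powr (2 * s - real DIM('a))) * indicator (ball x \<rho>) y) \<in> borel_measurable borel" by measurable
    from measurable_compose[OF id_M this]
    show "(\<lambda>y. ennreal (dist y x powr (2 * s - real DIM('a))) * indicator (ball x \<rho>) y) \<in> borel_measurable M" .
  qed
  also have "\<dots> \<le> ennreal (c * 2 powr \<gamma> * w x) * ennreal (I * \<rho> powr (2 * s))"
    by (intro mult_left_mono nn_integral_sing_M assms) auto
  also have "\<dots> = ennreal (c * 2 powr \<gamma> * I * \<rho> powr (2 * s) * w x)"
    using c w_pos[OF x] I by (subst ennreal_mult[symmetric]) (auto simp: mult_ac)
  finally show ?thesis .
qed

lemma finite_measure_M: "finite_measure M"
  by (rule finite_measureI) (use finite_M in \<open>simp add: less_top\<close>)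

sublocale green_kernel M \<kappa> w Kc "(2 * R) powr \<gamma>"
proof (intro green_kernel.intro finite_measure_M green_kernel_axioms.intro)
  show "case_prod \<kappa> \<in> borel_measurable (M \<Otimes>\<^sub>M M)" by (intro kappa_measurable id_M) auto
  show "0 < Kc" using c I R_pos by (simp add: Kc_def)
  fix x assume "x \<in> space M"
  then have x: "x \<in> \<Omega>" by simp
  have "(\<integral>\<^sup>+y. ennreal (\<kappa> x y * w y) \<partial>M) = (\<integral>\<^sup>+y. ennreal (\<kappa> x y * w y) * indicator (ball x (2 * R)) y \<partial>M)"
    by (rule nn_integral_cong) (auto simp: indicator_def dist_lt x)
  also have "\<dots> \<le> ennreal (c * 2 powr \<gamma> * I * (2 * R) powr (2 * s) * w x)"
    by (rule kernel_weight_ball[OF x]) (simp add: R_pos)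
  finally show "(\<integral>\<^sup>+y. ennreal (\<kappa> x y * w y) \<partial>M) \<le> ennreal (Kc * w x)" by (simp add: Kc_def)
qed (auto intro: kappa_nonneg kappa_sym w_pos w_le)

text \<open>The lower counterpart of \<open>Kc\<close>: the constant of
  \<open>kernel_bound_lower\<close>, divided by \<open>c\<close> and integrated against the squared
  weight.\<close>

definition Kl :: real where
  "Kl = inverse c * (2 * R) powr (2 * s - real DIM('a) - 2 * \<gamma>) * (\<integral>x. w x * w x \<partial>M)"

lemma AE_neq: "AE y in M. y \<noteq> x"
proof -
  have "AE y in (lebesgue :: 'a measure). y \<noteq> x" by (rule AE_completion) (rule AE_lborel_singleton)
  then show ?thesis by (auto simp: AE_restrict_space_iff elim!: eventually_mono)
qed

lemma Kl_pos: "0 < Kl"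
proof -
  have i: "integrable M (\<lambda>x. w x * w x)" by (intro L1d_times_S S_subset_L1d weight_in_S)
  have "(\<integral>x. w x * w x \<partial>M) \<noteq> 0"
  proof
    assume "(\<integral>x. w x * w x \<partial>M) = 0"
    then have "AE x in M. w x * w x = 0" using integral_nonneg_eq_0_iff_AE[OF i] by simp
    then have "AE x in M. False" using AE_space
    proof eventually_elim
      case (elim x)
      then show ?case using w_pos[of x] by simp
    qed
    then have "AE x in lebesgue. x \<notin> \<Omega>" by (simp add: AE_restrict_space_iff)
    then have "\<Omega> \<in> null_sets lebesgue" by (subst AE_iff_null_sets) auto
    then have "negligible \<Omega>" by (simp add: negligible_iff_null_sets)
    then show False using open_not_negligible[OF opn ne] by simp
  qed
  moreover have "0 \<le> (\<integral>x. w x * w x \<partial>M)" by simp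
  ultimately have "0 < (\<integral>x. w x * w x \<partial>M)" by linarith
  then show ?thesis unfolding Kl_def using c R_pos by (intro mult_pos_pos) auto
qed

text \<open>Integrate \<open>kernel_bound_lower\<close> against the weight. This turns an estimate
  for |g(u)| tested against G[\<delta>^\<gamma>] into one for its weighted norm.\<close>

lemma green_weight_lower:
  assumes x: "x \<in> \<Omega>" shows "Kl * w x \<le> green w x"
proof -
  have "Kl * w x = (\<integral>y. (inverse c * (2 * R) powr (2 * s - real DIM('a) - 2 * \<gamma>) * w x) * (w y * w y) \<partial>M)"
    by (simp add: Kl_def)
  also have "\<dots> \<le> (\<integral>y. \<kappa> x y * w y \<partial>M)"
  proof (rule integral_mono_AE)
    show "integrable M (\<lambda>y. (inverse c * (2 * R) powr (2 * s - real DIM('a) - 2 * \<gamma>) * w x) * (w y * w y))"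
      by (intro integrable_mult_right L1d_times_S S_subset_L1d weight_in_S)
    show "integrable M (\<lambda>y. \<kappa> x y * w y)" by (rule integrable_kernel_weight) (simp add: x)
    show "AE y in M. inverse c * (2 * R) powr (2 * s - real DIM('a) - 2 * \<gamma>) * w x * (w y * w y) \<le> \<kappa> x y * w y"
      using AE_neq[of x] AE_space
    proof eventually_elim
      case (elim y)
      then have y: "y \<in> \<Omega>" "x \<noteq> y" by auto
      have "inverse c * ((2 * R) powr (2 * s - real DIM('a) - 2 * \<gamma>) * w x * w y) \<le> inverse c * kernel_bound \<Omega> s \<gamma> x y"
        using c by (intro mult_left_mono kernel_bound_lower x y) auto
      also have "\<dots> \<le> \<kappa> x y" using G_props[OF x y] y(2) by (simp add: \<kappa>_def)
      finally show ?case using mult_right_mono[of _ "\<kappa> x y" "w y"] w_pos[OF y(1)] by (simp add: mult_ac)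
    qed
  qed
  finally show ?thesis by (simp add: green_def)
qed

text \<open>The two integrands differ only at \<open>y = x\<close>. Writing the difference as a
  multiple of the indicator of \<open>{x}\<close> also gives measurability of the integrand with
  \<open>G\<close>.\<close>

lemma green_eq_green_fun: "x \<in> \<Omega> \<Longrightarrow> f \<in> borel_measurable M \<Longrightarrow> green f x = green_fun \<Omega> G f x"
proof -
  assume x: "x \<in> \<Omega>" and [measurable]: "f \<in> borel_measurable M"
  have xM: "x \<in> space M" using x by simp
  note [measurable] = kernel_section[OF xM]
  have eq: "(\<lambda>y. \<kappa> x y * f y + G x x * f x * indicator {x} y) = (\<lambda>y. G x y * f y)"
    by (auto simp: \<kappa>_def indicator_def)
  have "{x} \<in> sets M" using x by (simp add: sets_restrict_space_iff)
  then have [measurable]: "(\<lambda>y. \<kappa> x y * f y + G x x * f x * indicator {x} y) \<in> borel_measurable M"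
    by measurable
  have "green f x = (\<integral>y. G x y * f y \<partial>M)"
    unfolding green_def eq[symmetric]
  proof (rule integral_cong_AE)
    show "AE y in M. \<kappa> x y * f y = \<kappa> x y * f y + G x x * f x * indicator {x} y"
      using AE_neq[of x] by eventually_elim simp
  qed measurable
  then show ?thesis unfolding green_fun_def set_lebesgue_integral_def
    by (subst (asm) integral_restrict_space) (auto simp: mult_ac)
qed

text \<open>The truncations \<open>min \<kappa> k\<close> have continuous potentials, which converge uniformly; hence \<open>green q\<close> is continuous.\<close>

lemma green_truncation_error:
  assumes q: "\<And>y. y \<in> \<Omega> \<Longrightarrow> \<bar>q y\<bar> \<le> m * w y" "q \<in> borel_measurable M" and m: "0 < m" and rho: "0 < \<rho>" and x: "x \<in> \<Omega>"
  shows "\<bar>green q x - (\<integral>y. min (\<kappa> x y) (c * \<rho> powr (2 * s - real DIM('a))) * q y \<partial>M)\<bar>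
     \<le> m * (c * 2 powr \<gamma> * I * \<rho> powr (2 * s) * (2 * R) powr \<gamma>)"
proof -
  define k where "k = c * \<rho> powr (2 * s - real DIM('a))"
  have k: "0 \<le> k" using c by (simp add: k_def)
  have xM: "x \<in> space M" using x by simp
  have qS: "q \<in> S" by (rule S_I[where m=m]) (use q in auto)
  note [measurable] = kernel_section[OF xM] q(2)
  have [measurable]: "ball x \<rho> \<inter> space M \<in> sets M" by (simp add: sets_restrict_space_iff sets.Int)
  have i1: "integrable M (\<lambda>y. \<kappa> x y * q y)" by (rule integrable_kernel[OF xM qS])
  have i2: "integrable M (\<lambda>y. min (\<kappa> x y) k * q y)"
  proof (rule Bochner_Integration.integrable_bound[OF i1])
    show "AE y in M. norm (min (\<kappa> x y) k * q y) \<le> norm (\<kappa> x y * q y)"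
    proof (rule AE_I2)
      fix y assume "y \<in> space M"
      then have "0 \<le> \<kappa> x y" using kappa_nonneg[OF x] by simp
      then show "norm (min (\<kappa> x y) k * q y) \<le> norm (\<kappa> x y * q y)"
        using k by (auto simp: abs_mult intro!: mult_right_mono)
    qed
  qed measurable
  have i3: "integrable M (\<lambda>y. \<kappa> x y * w y * indicator (ball x \<rho>) y)"
  proof (rule Bochner_Integration.integrable_bound[OF integrable_kernel_weight(1)[OF xM]])
    have [measurable]: "(indicator (ball x \<rho>) :: 'a \<Rightarrow> real) \<in> borel_measurable M"
      by (rule measurable_compose[OF id_M]) (rule borel_measurable_indicator, simp)
    show "(\<lambda>y. \<kappa> x y * w y * indicator (ball x \<rho>) y) \<in> borel_measurable M" by measurable
  qed (auto simp: indicator_def)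
  have "\<bar>green q x - (\<integral>y. min (\<kappa> x y) k * q y \<partial>M)\<bar> = \<bar>\<integral>y. \<kappa> x y * q y - min (\<kappa> x y) k * q y \<partial>M\<bar>"
    using i1 i2 by (simp add: green_def)
  also have "\<dots> \<le> (\<integral>y. \<bar>\<kappa> x y * q y - min (\<kappa> x y) k * q y\<bar> \<partial>M)" by (rule integral_abs_bound)
  also have "\<dots> \<le> (\<integral>y. m * (\<kappa> x y * w y * indicator (ball x \<rho>) y) \<partial>M)"
  proof (rule integral_mono)
    fix y assume "y \<in> space M"
    then have y: "y \<in> \<Omega>" by simp
    show "\<bar>\<kappa> x y * q y - min (\<kappa> x y) k * q y\<bar> \<le> m * (\<kappa> x y * w y * indicator (ball x \<rho>) y)"
    \<comment> \<open>Truncation changes nothing where the kernel is below \<open>k\<close>. Where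
      it exceeds \<open>k\<close>, the singular bound \<open>kappa_le_sing\<close> puts y inside the
      ball of radius \<rho>, and that determines the choice of \<open>k\<close>.\<close>
    proof (cases "\<kappa> x y \<le> k")
      case True
      then show ?thesis using m kappa_nonneg[OF x y] w_pos[OF y] by simp
    next
      case False
      have "dist x y < \<rho>"
      proof (rule ccontr)
        assume "\<not> dist x y < \<rho>"
        then have "dist x y powr (2 * s - real DIM('a)) \<le> \<rho> powr (2 * s - real DIM('a))"
          using rho dim by (intro powr_mono2') auto
        then have "c * dist x y powr (2 * s - real DIM('a)) \<le> k" unfolding k_def using c by (intro mult_left_mono) auto
        then have "\<kappa> x y \<le> k" using kappa_le_sing[OF x y] by linarith
        then show False using False by simp
      qed
      moreover have "\<bar>\<kappa> x y * q y - min (\<kappa> x y) k * q y\<bar> \<le> \<kappa> x y * (m * w y)"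
      proof -
        have "\<bar>\<kappa> x y * q y - min (\<kappa> x y) k * q y\<bar> = \<bar>\<kappa> x y - min (\<kappa> x y) k\<bar> * \<bar>q y\<bar>"
          by (simp add: left_diff_distrib[symmetric] abs_mult)
        also have "\<dots> \<le> \<kappa> x y * (m * w y)"
          using False k q(1)[OF y] by (intro mult_mono) auto
        finally show ?thesis .
      qed
      ultimately show ?thesis by (simp add: indicator_def mult_ac)
    qed
  qed (use i1 i2 i3 in auto)
  also have "\<dots> = m * (\<integral>y. \<kappa> x y * w y * indicator (ball x \<rho>) y \<partial>M)" by simp
  also have "(\<integral>y. \<kappa> x y * w y * indicator (ball x \<rho>) y \<partial>M) \<le> c * 2 powr \<gamma> * I * \<rho> powr (2 * s) * w x"
  proof -
    have nn: "AE y in M. 0 \<le> \<kappa> x y * w y * indicator (ball x \<rho>) y"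
      using kappa_nonneg[OF x] w_pos by (auto intro!: AE_I2 mult_nonneg_nonneg simp: less_imp_le)
    have "ennreal (\<integral>y. \<kappa> x y * w y * indicator (ball x \<rho>) y \<partial>M)
       = (\<integral>\<^sup>+y. ennreal (\<kappa> x y * w y) * indicator (ball x \<rho>) y \<partial>M)"
      unfolding nn_integral_eq_integral[OF i3 nn, symmetric]
      by (rule nn_integral_cong) (auto simp: indicator_def)
    also have "\<dots> \<le> ennreal (c * 2 powr \<gamma> * I * \<rho> powr (2 * s) * w x)"
      by (rule kernel_weight_ball[OF x rho])
    finally show ?thesis using c I w_pos[OF x] by (subst (asm) ennreal_le_iff) auto
  qed
  also have "c * 2 powr \<gamma> * I * \<rho> powr (2 * s) * w x \<le> c * 2 powr \<gamma> * I * \<rho> powr (2 * s) * (2 * R) powr \<gamma>"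
    using c I w_le[OF x] by (intro mult_left_mono) auto
  finally show ?thesis using m by (simp add: k_def mult_left_mono)
qed

text \<open>The cap \<open>k\<close> supplies a majorant that does not depend on the point, and
  off-diagonal continuity of \<open>G\<close> gives convergence of the kernel for every y other than
  x.\<close>

lemma green_truncation_continuous:
  assumes q: "q \<in> S" and k: "0 \<le> k" and x: "x \<in> \<Omega>" and xn: "\<And>n. xn n \<in> \<Omega>" "xn \<longlonglongrightarrow> x"
  shows "(\<lambda>n. \<integral>y. min (\<kappa> (xn n) y) k * q y \<partial>M) \<longlonglongrightarrow> (\<integral>y. min (\<kappa> x y) k * q y \<partial>M)"
proof (rule integral_dominated_convergence)
  note [measurable] = S_measurable[OF q]
  have [measurable]: "\<kappa> z \<in> borel_measurable M" if "z \<in> \<Omega>" for z using kernel_section[of z] that by simp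
  show "(\<lambda>y. min (\<kappa> x y) k * q y) \<in> borel_measurable M" using x by measurable
  show "(\<lambda>y. min (\<kappa> (xn n) y) k * q y) \<in> borel_measurable M" for n using xn(1)[of n] by measurable
  obtain m where m: "0 < m" "\<And>x. x \<in> \<Omega> \<Longrightarrow> \<bar>q x\<bar> \<le> m * w x"
    using q by (auto elim!: S_E)
  have "integrable M (\<lambda>y. q y)"
  proof (rule integrable_const_bound[where B="m * (2 * R) powr \<gamma>"])
    show "AE y in M. norm (q y) \<le> m * (2 * R) powr \<gamma>"
      using m w_le by (auto intro!: AE_I2 order_trans[OF m(2)] mult_left_mono)
  qed measurable
  then show "integrable M (\<lambda>y. k * \<bar>q y\<bar>)" by simp
  show "AE y in M. norm (min (\<kappa> (xn n) y) k * q y) \<le> k * \<bar>q y\<bar>" for n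
    using kappa_nonneg[OF xn(1)] k by (auto intro!: AE_I2 mult_right_mono simp: abs_mult)
  show "AE y in M. (\<lambda>n. min (\<kappa> (xn n) y) k * q y) \<longlonglongrightarrow> min (\<kappa> x y) k * q y"
    using AE_neq[of x] AE_space
  proof eventually_elim
    case (elim y)
    then have y: "y \<in> \<Omega>" "x \<noteq> y" by auto
    have ev: "\<forall>\<^sub>F n in sequentially. xn n \<noteq> y"
      using tendsto_imp_eventually_ne[OF xn(2) y(2)] .
    let ?A = "{(x, y). x \<in> \<Omega> \<and> y \<in> \<Omega> \<and> x \<noteq> y}"
    have "isCont (\<lambda>(x, y). G x y) (x, y)"
      using bspec[OF continuous_on_eq_continuous_at[OF offdiag_open, THEN iffD1, OF G_cont], of "(x, y)"] x y by simp
    then have "(\<lambda>n. (case (xn n, y) of (x, y) \<Rightarrow> G x y)) \<longlonglongrightarrow> (case (x, y) of (x, y) \<Rightarrow> G x y)"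
      by (rule isCont_tendsto_compose) (intro tendsto_intros xn)
    then have "(\<lambda>n. G (xn n) y) \<longlonglongrightarrow> \<kappa> x y" using y by (simp add: \<kappa>_def)
    then have "(\<lambda>n. \<kappa> (xn n) y) \<longlonglongrightarrow> \<kappa> x y"
      by (rule Lim_transform_eventually) (use ev in eventually_elim, simp add: \<kappa>_def)
    then show ?case by (intro tendsto_intros)
  qed
qed

text \<open>A property valid almost everywhere holds somewhere in every ball around x, since
  nonempty open sets are not null.\<close>

lemma AE_dense_sequence:
  assumes "AE y in M. P y" "x \<in> \<Omega>" obtains xn where "\<And>n. xn n \<in> \<Omega>" "\<And>n. P (xn n)" "xn \<longlonglongrightarrow> x"
proof -
  have "\<exists>y\<in>\<Omega>. P y \<and> dist y x < inverse (real (Suc n))" for n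
  proof (rule ccontr)
    assume no: "\<not> ?thesis"
    define V where "V = \<Omega> \<inter> ball x (inverse (real (Suc n)))"
    have "AE y in lebesgue. y \<in> \<Omega> \<longrightarrow> P y" using assms(1) by (simp add: AE_restrict_space_iff)
    then have "AE y in lebesgue. y \<notin> V"
      by eventually_elim (use no in \<open>auto simp: V_def dist_commute\<close>)
    moreover have V: "open V" "V \<noteq> {}" using opn assms(2) by (auto simp: V_def)
    ultimately have "V \<in> null_sets lebesgue" by (subst AE_iff_null_sets) auto
    then show False using open_not_negligible[OF V] by (simp add: negligible_iff_null_sets)
  qed
  then obtain xn where xn: "\<And>n. xn n \<in> \<Omega>" "\<And>n. P (xn n)" "\<And>n. dist (xn n) x < inverse (real (Suc n))"
    by metis
  have "(\<lambda>n. dist (xn n) x) \<longlonglongrightarrow> 0"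
    by (rule tendsto_sandwich[OF _ _ tendsto_const LIMSEQ_inverse_real_of_nat])
      (use xn(3) in \<open>auto intro!: always_eventually less_imp_le\<close>)
  then have lim: "xn \<longlonglongrightarrow> x" by (rule tendsto_dist_iff[THEN iffD2])
  show thesis by (rule that[OF xn(1,2) lim])
qed

text \<open>Approach x through points where the potential is known to be nonnegative. The truncated
  potentials converge along this sequence, and the truncation error is uniform in the point and
  tends to 0 with \<rho>.\<close>

lemma green_nonneg_of_AE:
  assumes q: "q \<in> S" and ae: "AE y in M. 0 \<le> green q y" and x: "x \<in> \<Omega>"
  shows "0 \<le> green q x"
proof -
  obtain m where m: "0 < m" "\<And>x. x \<in> \<Omega> \<Longrightarrow> \<bar>q x\<bar> \<le> m * w x"
    using q by (auto elim!: S_E)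
  obtain xn where xn: "\<And>n. xn n \<in> \<Omega>" "\<And>n. 0 \<le> green q (xn n)" "xn \<longlonglongrightarrow> x"
    by (rule AE_dense_sequence[OF ae x], rule that) assumption+
  \<comment> \<open>The factor 2 accounts for two truncation errors, one along the sequence and one
    at the limit.\<close>
  define A where "A = 2 * (m * (c * 2 powr \<gamma> * I * (2 * R) powr \<gamma>))"
  have A: "0 < A" using m c I R_pos by (simp add: A_def)
  have le: "- green q x \<le> A * \<rho> powr (2 * s)" if rho: "0 < \<rho>" for \<rho>
  proof -
    define k where "k = c * \<rho> powr (2 * s - real DIM('a))"
    have "- (A / 2 * \<rho> powr (2 * s)) \<le> (\<integral>y. min (\<kappa> (xn n) y) k * q y \<partial>M)" for n
      using green_truncation_error[OF m(2) S_measurable[OF q] m(1) rho xn(1)[of n]] xn(2)[of n]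
      by (simp add: A_def k_def mult_ac)
    moreover have "(\<lambda>n. \<integral>y. min (\<kappa> (xn n) y) k * q y \<partial>M) \<longlonglongrightarrow> (\<integral>y. min (\<kappa> x y) k * q y \<partial>M)"
      by (rule green_truncation_continuous[OF q _ x xn(1,3)]) (use c in \<open>simp add: k_def\<close>)
    ultimately have "- (A / 2 * \<rho> powr (2 * s)) \<le> (\<integral>y. min (\<kappa> x y) k * q y \<partial>M)"
      by (intro LIMSEQ_le_const) auto
    then show ?thesis
      using green_truncation_error[OF m(2) S_measurable[OF q] m(1) rho x]
      by (simp add: A_def k_def mult_ac)
  qed
  have "- green q x \<le> 0"
  proof (rule field_le_epsilon)
    fix e :: real assume e: "0 < e"
    define \<rho> where "\<rho> = (e / A) powr (1 / (2 * s))"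
    have "0 < \<rho>" using e A by (simp add: \<rho>_def)
    have "\<rho> powr (2 * s) = e / A" using e A s by (simp add: \<rho>_def powr_powr)
    then have "A * \<rho> powr (2 * s) = e" using A by simp
    with le[OF \<open>0 < \<rho>\<close>] show "- green q x \<le> 0 + e" by linarith
  qed
  then show ?thesis by simp
qed

end

section \<open>Potentials of measures\<close>

context green_domain
begin

definition wfin :: "'a measure \<Rightarrow> bool" where
  "wfin \<alpha> \<longleftrightarrow> sets \<alpha> = sets (restrict_space borel \<Omega>) \<and> (\<integral>\<^sup>+x. ennreal (w x) \<partial>\<alpha>) < \<infinity>"

definition pot :: "'a measure \<Rightarrow> 'a \<Rightarrow> real" where
  "pot \<alpha> x = (\<integral>y. \<kappa> x y \<partial>\<alpha>)"

lemma wfin_space: "wfin \<alpha> \<Longrightarrow> space \<alpha> = \<Omega>"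
  unfolding wfin_def by (metis sets_eq_imp_space_eq space_restrict_space Int_UNIV_right space_borel)

lemma wfin_id: "wfin \<alpha> \<Longrightarrow> (\<lambda>x. x) \<in> \<alpha> \<rightarrow>\<^sub>M borel"
  unfolding wfin_def by (subst measurable_cong_sets[OF _ refl]) (auto intro: measurable_restrict_space1)

lemma wfin_borel: "wfin \<alpha> \<Longrightarrow> f \<in> borel_measurable borel \<Longrightarrow> f \<in> borel_measurable \<alpha>"
  using measurable_compose[OF wfin_id] by blast

lemma wfin_kappa: "wfin \<alpha> \<Longrightarrow> case_prod \<kappa> \<in> borel_measurable (M \<Otimes>\<^sub>M \<alpha>)"
  by (intro kappa_measurable id_M wfin_id) (auto simp: wfin_space)

lemma wfin_integrable: assumes "wfin \<alpha>" shows "integrable \<alpha> w"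
proof (rule integrableI_nonneg)
  show "w \<in> borel_measurable \<alpha>" by (rule wfin_borel[OF assms]) measurable
  show "AE x in \<alpha>. 0 \<le> w x" by (simp add: w_def)
qed (use assms in \<open>simp add: wfin_def\<close>)

lemma wfin_sigma_finite: assumes "wfin \<alpha>" shows "sigma_finite_measure \<alpha>"
proof
  define A where "A n = {x \<in> space \<alpha>. 1 / real (Suc n) \<le> w x}" for n
  note [measurable] = wfin_borel[OF assms w_borel]
  have "\<Union> (range A) = space \<alpha>"
  proof (intro equalityI subsetI)
    fix x assume x: "x \<in> space \<alpha>"
    then have "0 < w x" using w_pos wfin_space[OF assms] by auto
    then obtain n where "1 / real (Suc n) < w x" using nat_approx_posE by blast
    then show "x \<in> \<Union> (range A)" using x by (auto simp: A_def intro!: exI[of _ n])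
  qed (auto simp: A_def)
  moreover have "emeasure \<alpha> (A n) \<noteq> \<infinity>" for n
  proof -
    have "ennreal (1 / real (Suc n)) * emeasure \<alpha> (A n) = (\<integral>\<^sup>+x. ennreal (1 / real (Suc n)) * indicator (A n) x \<partial>\<alpha>)"
      by (rule nn_integral_cmult_indicator[symmetric]) (simp add: A_def)
    also have "\<dots> \<le> (\<integral>\<^sup>+x. ennreal (w x) \<partial>\<alpha>)"
      by (intro nn_integral_mono) (auto simp: A_def indicator_def intro: ennreal_leI)
    also have "\<dots> < \<infinity>" using assms by (simp add: wfin_def)
    finally show ?thesis by (auto simp: ennreal_mult_eq_top_iff)
  qed
  ultimately show "\<exists>B. countable B \<and> B \<subseteq> sets \<alpha> \<and> \<Union> B = space \<alpha> \<and> (\<forall>a\<in>B. emeasure \<alpha> a \<noteq> \<infinity>)"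
    by (intro exI[of _ "range A"]) (auto simp: A_def)
qed

lemma pot_duality:
  assumes "wfin \<alpha>"
  shows "AE x in M. integrable \<alpha> (\<kappa> x)" and "pot \<alpha> \<in> L1d"
    and "\<xi> \<in> S \<Longrightarrow> integrable \<alpha> (green \<xi>)"
    and "\<xi> \<in> S \<Longrightarrow> (\<integral>x. pot \<alpha> x * \<xi> x \<partial>M) = (\<integral>y. green \<xi> y \<partial>\<alpha>)"
  using green_duality[OF wfin_sigma_finite[OF assms] _ wfin_kappa[OF assms], of "\<lambda>_. 1"]
    wfin_integrable[OF assms] wfin_borel[OF assms w_borel] wfin_space[OF assms]
  by (auto simp: pot_def[abs_def] eta_contract_eq)

lemma pot_nonneg: "wfin \<alpha> \<Longrightarrow> x \<in> \<Omega> \<Longrightarrow> 0 \<le> pot \<alpha> x"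
  unfolding pot_def by (rule Bochner_Integration.integral_nonneg) (auto simp: wfin_space kappa_nonneg)

lemma pot_measurable [measurable]: "wfin \<alpha> \<Longrightarrow> pot \<alpha> \<in> borel_measurable M"
  by (rule L1d_measurable[OF pot_duality(2)])

text \<open>An inequality only: where \<open>\<kappa> x\<close> is not integrable the left-hand side
  is 0 by convention.\<close>

lemma pot_le_nn_integral:
  assumes "wfin \<alpha>" "x \<in> \<Omega>" shows "ennreal (pot \<alpha> x) \<le> (\<integral>\<^sup>+y. ennreal (\<kappa> x y) \<partial>\<alpha>)"
proof (cases "integrable \<alpha> (\<kappa> x)")
  case True
  then show ?thesis unfolding pot_def
    by (subst nn_integral_eq_integral) (auto simp: kappa_nonneg assms wfin_space intro!: AE_I2)
qed (simp add: pot_def not_integrable_integral_eq)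

text \<open>Apply Tonelli to the indicator of the diagonal: its sections in x are Lebesgue null, so
  its sections in y have \<alpha>-measure 0 for almost every x.\<close>

lemma AE_no_atom:
  assumes "wfin \<alpha>" shows "AE x in M. emeasure \<alpha> {x} = 0"
proof -
  interpret \<alpha>: sigma_finite_measure \<alpha> by (rule wfin_sigma_finite[OF assms])
  interpret P: pair_sigma_finite M \<alpha> ..
  have [measurable]: "(\<lambda>p. fst p) \<in> M \<Otimes>\<^sub>M \<alpha> \<rightarrow>\<^sub>M borel" "(\<lambda>p. snd p) \<in> M \<Otimes>\<^sub>M \<alpha> \<rightarrow>\<^sub>M borel"
    using measurable_compose[OF measurable_fst id_M] measurable_compose[OF measurable_snd wfin_id[OF assms]] by auto
  have dm: "(\<lambda>(x, y). indicator {0} (dist x y) :: ennreal) \<in> borel_measurable (M \<Otimes>\<^sub>M \<alpha>)"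
    unfolding split_beta' by measurable
  have sing: "{x} \<in> sets \<alpha>" if "x \<in> \<Omega>" for x
    using assms that by (auto simp: wfin_def sets_restrict_space_iff)
  have "(\<integral>\<^sup>+y. \<integral>\<^sup>+x. indicator {0} (dist x y) \<partial>M \<partial>\<alpha>) = (\<integral>\<^sup>+y. 0 \<partial>\<alpha>)"
  proof (rule nn_integral_cong)
    fix y
    have "(\<integral>\<^sup>+x. indicator {0} (dist x y) \<partial>M) = (\<integral>\<^sup>+x. 0 \<partial>M)"
      by (rule nn_integral_cong_AE) (use AE_neq[of y] in \<open>eventually_elim, auto simp: indicator_def\<close>)
    then show "(\<integral>\<^sup>+x. indicator {0} (dist x y) \<partial>M) = 0" by simp
  qed
  then have z: "(\<integral>\<^sup>+x. \<integral>\<^sup>+y. indicator {0} (dist x y) \<partial>\<alpha> \<partial>M) = 0"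
    unfolding P.Fubini'[OF dm] by simp
  have "(\<lambda>x. \<integral>\<^sup>+y. indicator {0} (dist x y) \<partial>\<alpha>) \<in> borel_measurable M"
    using \<alpha>.borel_measurable_nn_integral[OF dm] by simp
  then have "AE x in M. (\<integral>\<^sup>+y. indicator {0} (dist x y) \<partial>\<alpha>) = 0"
    using z by (subst (asm) nn_integral_0_iff_AE) auto
  then show ?thesis using AE_space
  proof eventually_elim
    case (elim x)
    have "emeasure \<alpha> {x} = (\<integral>\<^sup>+y. indicator {x} y \<partial>\<alpha>)" using sing elim(2) by simp
    also have "\<dots> = (\<integral>\<^sup>+y. indicator {0} (dist x y) \<partial>\<alpha>)"
      by (rule nn_integral_cong) (auto simp: indicator_def)
    finally show ?case using elim(1) by simp
  qed
qed

lemma pot_eq_green_meas: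
  assumes "wfin \<alpha>" shows "AE x in M. pot \<alpha> x = green_meas G \<alpha> x"
  using AE_no_atom[OF assms] AE_space
proof eventually_elim
  case (elim x)
  have x: "x \<in> \<Omega>" "{x} \<in> sets \<alpha>" using elim(2) assms by (auto simp: wfin_def sets_restrict_space_iff)
  have km: "\<kappa> x \<in> borel_measurable \<alpha>"
    using measurable_compose_Pair1[OF elim(2) wfin_kappa[OF assms]] by simp
  have eq: "(\<lambda>y. \<kappa> x y + G x x * indicator {x} y) = G x"
    by (auto simp: \<kappa>_def indicator_def)
  have "AE y in \<alpha>. y \<noteq> x" using elim(1) x(2) by (intro AE_I[of _ _ "{x}"]) auto
  then have ae: "AE y in \<alpha>. \<kappa> x y = \<kappa> x y + G x x * indicator {x} y"
    by eventually_elim simp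
  have m: "\<kappa> x \<in> borel_measurable \<alpha>" "(\<lambda>y. \<kappa> x y + G x x * indicator {x} y) \<in> borel_measurable \<alpha>"
    by (rule km) (intro borel_measurable_add borel_measurable_times borel_measurable_const borel_measurable_indicator x km)
  have "(\<integral>y. \<kappa> x y \<partial>\<alpha>) = (\<integral>y. \<kappa> x y + G x x * indicator {x} y \<partial>\<alpha>)"
    by (rule integral_cong_AE[OF m ae])
  then show ?case unfolding pot_def green_meas_def eq by (simp add: eta_contract_eq)
qed

text \<open>Integrate the potential over its superlevel set with the weight, exchange the order of
  integration, and split the inner integral at distance \<rho> from y. The near part is bounded by
  \<open>kernel_weight_ball\<close>, the far part by \<open>kappa_far\<close>; both are proportional
  to \<open>w y\<close>. The quantity \<open>m\<close> reappears on the right, to be absorbed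
  later.\<close>

lemma super_level_bound:
  assumes \<alpha>: "wfin \<alpha>" and t: "0 < t" and rho: "0 < \<rho>"
  defines "m \<equiv> (\<integral>\<^sup>+x. ennreal (w x) * indicator {x. t < pot \<alpha> x} x \<partial>M)"
  shows "ennreal t * m \<le> (\<integral>\<^sup>+x. ennreal (w x) \<partial>\<alpha>) *
     (ennreal (c * 2 powr \<gamma> * I * \<rho> powr (2 * s)) + ennreal (c * \<rho> powr (2 * s - real DIM('a) - \<gamma>)) * m)"
proof -
  interpret \<alpha>: sigma_finite_measure \<alpha> by (rule wfin_sigma_finite[OF \<alpha>])
  interpret P: pair_sigma_finite M \<alpha> ..
  note [measurable] = pot_measurable[OF \<alpha>] wfin_kappa[OF \<alpha>] wfin_borel[OF \<alpha> w_borel]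
  define E where "E = {x \<in> space M. t < pot \<alpha> x}"
  have E [measurable]: "E \<in> sets M" unfolding E_def by measurable
  have m: "m = (\<integral>\<^sup>+x. ennreal (w x) * indicator E x \<partial>M)"
    unfolding m_def by (rule nn_integral_cong) (auto simp: E_def indicator_def)
  define a where "a = c * 2 powr \<gamma> * I * \<rho> powr (2 * s)"
  define b where "b = c * \<rho> powr (2 * s - real DIM('a) - \<gamma>)"
  have ab: "0 \<le> a" "0 \<le> b" using c I by (auto simp: a_def b_def)
  have pm: "(\<lambda>(x, y). ennreal (\<kappa> x y) * (ennreal (w x) * indicator E x)) \<in> borel_measurable (M \<Otimes>\<^sub>M \<alpha>)"
    by measurable
  have "ennreal t * m = (\<integral>\<^sup>+x. ennreal t * (ennreal (w x) * indicator E x) \<partial>M)"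
    unfolding m by (rule nn_integral_cmult[symmetric]) measurable
  also have "\<dots> \<le> (\<integral>\<^sup>+x. (\<integral>\<^sup>+y. ennreal (\<kappa> x y) * (ennreal (w x) * indicator E x) \<partial>\<alpha>) \<partial>M)"
  proof (rule nn_integral_mono)
    fix x assume x: "x \<in> space M"
    have [measurable]: "\<kappa> x \<in> borel_measurable \<alpha>"
      using measurable_compose_Pair1[OF x wfin_kappa[OF \<alpha>]] by simp
    have "ennreal t \<le> (\<integral>\<^sup>+y. ennreal (\<kappa> x y) \<partial>\<alpha>)" if "x \<in> E"
    proof -
      have "ennreal t \<le> ennreal (pot \<alpha> x)" using that by (intro ennreal_leI) (simp add: E_def)
      also have "\<dots> \<le> (\<integral>\<^sup>+y. ennreal (\<kappa> x y) \<partial>\<alpha>)" using x by (intro pot_le_nn_integral[OF \<alpha>]) simp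
      finally show ?thesis .
    qed
    then have "ennreal t * (ennreal (w x) * indicator E x) \<le> (\<integral>\<^sup>+y. ennreal (\<kappa> x y) \<partial>\<alpha>) * (ennreal (w x) * indicator E x)"
      by (cases "x \<in> E") (auto intro!: mult_right_mono)
    then show "ennreal t * (ennreal (w x) * indicator E x)
        \<le> (\<integral>\<^sup>+y. ennreal (\<kappa> x y) * (ennreal (w x) * indicator E x) \<partial>\<alpha>)"
      by (simp add: nn_integral_multc)
  qed
  also have "\<dots> = (\<integral>\<^sup>+y. (\<integral>\<^sup>+x. ennreal (\<kappa> x y) * (ennreal (w x) * indicator E x) \<partial>M) \<partial>\<alpha>)"
    using P.Fubini'[OF pm] by simp
  also have "\<dots> \<le> (\<integral>\<^sup>+y. ennreal (w y) * (ennreal a + ennreal b * m) \<partial>\<alpha>)"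
  proof (rule nn_integral_mono)
    fix y assume "y \<in> space \<alpha>"
    then have y: "y \<in> \<Omega>" using wfin_space[OF \<alpha>] by simp
    note [measurable] = kernel_section[of y]
    have [measurable]: "\<kappa> y \<in> borel_measurable M" using y kernel_section[of y] by simp
    have [measurable]: "(indicator (ball y \<rho>) :: 'a \<Rightarrow> ennreal) \<in> borel_measurable M"
      by (rule measurable_compose[OF id_M]) (rule borel_measurable_indicator, simp)
    have "(\<integral>\<^sup>+x. ennreal (\<kappa> x y) * (ennreal (w x) * indicator E x) \<partial>M)
       \<le> (\<integral>\<^sup>+x. ennreal (\<kappa> y x * w x) * indicator (ball y \<rho>) x + ennreal (b * w y) * (ennreal (w x) * indicator E x) \<partial>M)"
    proof (rule nn_integral_mono)
      fix x assume "x \<in> space M"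
      then have x: "x \<in> \<Omega>" by simp
      have k: "ennreal (\<kappa> x y) * ennreal (w x) = ennreal (\<kappa> y x * w x)"
        using kappa_nonneg[OF y x] w_pos[OF x] by (simp add: kappa_sym[OF x y] ennreal_mult)
      show "ennreal (\<kappa> x y) * (ennreal (w x) * indicator E x)
        \<le> ennreal (\<kappa> y x * w x) * indicator (ball y \<rho>) x + ennreal (b * w y) * (ennreal (w x) * indicator E x)"
      proof (cases "x \<in> ball y \<rho>")
        case True
        then show ?thesis by (auto simp: indicator_def k intro: add_increasing2)
      next
        case False
        have "dist x y powr (2 * s - real DIM('a) - \<gamma>) \<le> \<rho> powr (2 * s - real DIM('a) - \<gamma>)"
          using False rho dim \<gamma> by (intro powr_mono2') (auto simp: dist_commute)
        then have "c * w y * dist x y powr (2 * s - real DIM('a) - \<gamma>) \<le> c * w y * \<rho> powr (2 * s - real DIM('a) - \<gamma>)"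
          using c w_pos[OF y] by (intro mult_left_mono) auto
        with kappa_far[OF x y] have "\<kappa> x y \<le> b * w y" by (simp add: b_def mult_ac)
        then have "ennreal (\<kappa> x y) * (ennreal (w x) * indicator E x) \<le> ennreal (b * w y) * (ennreal (w x) * indicator E x)"
          by (intro mult_right_mono ennreal_leI) auto
        then show ?thesis by (intro order_trans[OF _ add_increasing[OF zero_le order_refl]])
      qed
    qed
    also have "\<dots> = (\<integral>\<^sup>+x. ennreal (\<kappa> y x * w x) * indicator (ball y \<rho>) x \<partial>M) + ennreal (b * w y) * m"
      unfolding m by (subst nn_integral_add) (auto simp: nn_integral_cmult)
    also have "\<dots> \<le> ennreal (a * w y) + ennreal (b * w y) * m"
      using kernel_weight_ball[OF y rho] by (intro add_right_mono) (simp add: a_def)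
    also have "\<dots> = ennreal (w y) * (ennreal a + ennreal b * m)"
      using ab w_pos[OF y] by (simp add: ennreal_mult distrib_left mult_ac)
    finally show "(\<integral>\<^sup>+x. ennreal (\<kappa> x y) * (ennreal (w x) * indicator E x) \<partial>M)
       \<le> ennreal (w y) * (ennreal a + ennreal b * m)" .
  qed
  also have "\<dots> = (\<integral>\<^sup>+y. ennreal (w y) \<partial>\<alpha>) * (ennreal a + ennreal b * m)"
    by (rule nn_integral_multc) measurable
  finally show ?thesis by (simp add: a_def b_def)
qed

text \<open>Optimise the radius \<open>\<rho>\<close> in \<open>super_level_bound\<close>.\<close>

lemma pot_weak_type:
  assumes \<alpha>: "wfin \<alpha>"
  shows "\<exists>C\<ge>0. \<forall>t>0. (\<integral>\<^sup>+x. ennreal (w x) * indicator {x. t < pot \<alpha> x} x \<partial>M) \<le> ennreal (C * t powr (- p_star DIM('a) s \<gamma>))"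
proof -
  \<comment> \<open>The summand 1 keeps \<open>A\<close> positive even for the zero measure, so that
    it may be divided by.\<close>
  define A where "A = enn2real (\<integral>\<^sup>+x. ennreal (w x) \<partial>\<alpha>) + 1"
  have A: "0 < A" by (simp add: A_def add_nonneg_pos)
  have A': "(\<integral>\<^sup>+x. ennreal (w x) \<partial>\<alpha>) \<le> ennreal A"
    using \<alpha> by (auto simp: A_def wfin_def ennreal_enn2real_if intro: order_trans[OF _ ennreal_leI[of "enn2real _"]])
  \<comment> \<open>In these terms \<open>p_star\<close> is 1 + 2s/b: one power of t comes from
    Chebyshev's inequality, the remaining 2s/b from \<rho>^(2s) with \<rho> proportional to
    t^(-1/b).\<close>
  define b where "b = real DIM('a) + \<gamma> - 2 * s"
  have b: "0 < b" using dim \<gamma> by (simp add: b_def)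
  have p: "p_star DIM('a) s \<gamma> = 1 + 2 * s / b" using b by (simp add: p_star_def b_def field_simps)
  define C where "C = 2 * A * c * 2 powr \<gamma> * I * (2 * A * c) powr (2 * s / b)"
  have "(\<integral>\<^sup>+x. ennreal (w x) * indicator {x. t < pot \<alpha> x} x \<partial>M) \<le> ennreal (C * t powr (- p_star DIM('a) s \<gamma>))" if t: "0 < t" for t
  proof -
    define m where "m = (\<integral>\<^sup>+x. ennreal (w x) * indicator {x. t < pot \<alpha> x} x \<partial>M)"
    \<comment> \<open>Finiteness of \<open>m\<close> is established first; without it, it could not
      be moved to the left-hand side.\<close>
    have "m \<le> (\<integral>\<^sup>+x. ennreal (w x) \<partial>M)"
      unfolding m_def by (rule nn_integral_mono) (auto simp: indicator_def)
    also have "\<dots> \<le> (\<integral>\<^sup>+x. ennreal ((2 * R) powr \<gamma>) \<partial>M)"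
      by (rule nn_integral_mono) (auto intro!: ennreal_leI w_le)
    also have "\<dots> < \<infinity>" using finite_M by (simp add: ennreal_mult_less_top)
    finally have mfin: "m < \<infinity>" .
    define r where "r = enn2real m"
    have r: "m = ennreal r" "0 \<le> r" using mfin by (auto simp: r_def)
    \<comment> \<open>With this radius the far part is exactly half of the left-hand side.\<close>
    define \<rho> where "\<rho> = (2 * A * c / t) powr (1 / b)"
    have rho: "0 < \<rho>" using A c t by (simp add: \<rho>_def)
    have "ennreal t * m \<le> ennreal A * (ennreal (c * 2 powr \<gamma> * I * \<rho> powr (2 * s)) + ennreal (c * \<rho> powr (2 * s - real DIM('a) - \<gamma>)) * m)"
      unfolding m_def by (rule order_trans[OF super_level_bound[OF \<alpha> t rho]]) (intro mult_right_mono A', simp)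
    also have "\<dots> = ennreal (A * (c * 2 powr \<gamma> * I * \<rho> powr (2 * s) + c * \<rho> powr (2 * s - real DIM('a) - \<gamma>) * r))"
      unfolding r(1) using A c I r(2) by (simp add: ennreal_mult)
    finally have "ennreal (t * r) \<le> ennreal (A * (c * 2 powr \<gamma> * I * \<rho> powr (2 * s) + c * \<rho> powr (2 * s - real DIM('a) - \<gamma>) * r))"
      unfolding r(1) using t r(2) by (simp add: ennreal_mult)
    then have 1: "t * r \<le> A * (c * 2 powr \<gamma> * I * \<rho> powr (2 * s) + c * \<rho> powr (2 * s - real DIM('a) - \<gamma>) * r)"
      using A c I r(2) by (subst (asm) ennreal_le_iff) auto
    have "\<rho> powr (2 * s - real DIM('a) - \<gamma>) = (2 * A * c / t) powr (- 1)"
    proof -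
      have "1 / b * (2 * s - real DIM('a) - \<gamma>) = (- b) / b" by (simp add: b_def)
      also have "\<dots> = - 1" using b by simp
      finally show ?thesis unfolding \<rho>_def powr_powr by (simp only:)
    qed
    also have "\<dots> = t / (2 * A * c)" using A c t by (simp add: powr_minus_divide)
    finally have "A * c * \<rho> powr (2 * s - real DIM('a) - \<gamma>) * r = t * r / 2" using A c by simp
    moreover have "A * (c * 2 powr \<gamma> * I * \<rho> powr (2 * s) + c * \<rho> powr (2 * s - real DIM('a) - \<gamma>) * r)
        = A * c * 2 powr \<gamma> * I * \<rho> powr (2 * s) + A * c * \<rho> powr (2 * s - real DIM('a) - \<gamma>) * r"
      by (simp add: distrib_left mult.assoc)
    ultimately have "t * r / 2 \<le> A * c * 2 powr \<gamma> * I * \<rho> powr (2 * s)" using 1 by linarith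
    then have "r \<le> 2 * A * c * 2 powr \<gamma> * I * \<rho> powr (2 * s) / t" using t by (simp add: field_simps)
    also have "\<rho> powr (2 * s) = (2 * A * c) powr (2 * s / b) * t powr (- (2 * s / b))"
      unfolding \<rho>_def powr_powr using A c t by (simp add: powr_divide powr_minus_divide)
    also have "2 * A * c * 2 powr \<gamma> * I * ((2 * A * c) powr (2 * s / b) * t powr (- (2 * s / b))) / t = C * (t powr (- (2 * s / b)) * t powr (- 1))"
      using t by (simp add: C_def powr_minus_divide)
    also have "t powr (- (2 * s / b)) * t powr (- 1) = t powr (- p_star DIM('a) s \<gamma>)"
    proof -
      have "- (2 * s / b) + - 1 = - p_star DIM('a) s \<gamma>" by (simp add: p)
      then show ?thesis by (simp only: powr_add[symmetric])
    qed
    finally show ?thesis using r(1) by (simp add: m_def[symmetric] ennreal_leI)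
  qed
  moreover have "0 \<le> C" using A c I by (simp add: C_def)
  ultimately show ?thesis by blast
qed

text \<open>As \<open>h\<close> is only monotone, the layer-cake formula is replaced by an average
  over the interval from u to 2u, where \<open>h\<close> is at least \<open>h u\<close>; the factor
  2 makes up for t <= 2u in the denominator.\<close>

lemma nn_integral_average_lower:
  fixes h :: "real \<Rightarrow> real"
  assumes h: "\<And>t t'. 0 \<le> t \<Longrightarrow> t \<le> t' \<Longrightarrow> h t \<le> h t'" and u: "1 < u" and h0: "0 \<le> h 0"
  shows "ennreal (h u) \<le> (\<integral>\<^sup>+t. ennreal (2 * h t / t) * indicator {u..2 * u} t \<partial>lborel)"
proof -
  have hu: "0 \<le> h u" using h[of 0 u] u h0 by simp
  have "ennreal (h u) = ennreal (h u / u) * ennreal (2 * u - u)"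
    using u hu by (subst ennreal_mult[symmetric]) auto
  also have "\<dots> = (\<integral>\<^sup>+t. ennreal (h u / u) * indicator {u..2 * u} t \<partial>lborel)"
    using u by (simp add: nn_integral_cmult_indicator)
  also have "\<dots> \<le> (\<integral>\<^sup>+t. ennreal (2 * h t / t) * indicator {u..2 * u} t \<partial>lborel)"
  proof (rule nn_integral_mono)
    fix t :: real
    have "h u / u \<le> 2 * h t / t" if t: "u \<le> t" "t \<le> 2 * u"
    proof -
      have "h u * t \<le> h t * (2 * u)" using t u hu h[of u t] by (intro mult_mono) auto
      then show ?thesis using t u by (simp add: field_simps)
    qed
    then show "ennreal (h u / u) * indicator {u..2 * u} t \<le> ennreal (2 * h t / t) * indicator {u..2 * u} t"
      by (auto simp: indicator_def intro: ennreal_leI)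
  qed
  finally show ?thesis .
qed

text \<open>Average \<open>h\<close> over the interval from the potential to its double and exchange
  the integrals in x and t. For fixed t the relevant x have potential at least t/2, hence strictly
  above t/4, and the weak-type bound leaves \<open>h t\<close> times a power of t whose integral is
  finite by hypothesis. Points with potential at most 1 contribute at most \<open>h 1\<close> times
  the weight.\<close>

lemma pot_subcritical:
  fixes h :: "real \<Rightarrow> real"
  assumes \<alpha>: "wfin \<alpha>" and h: "\<And>t t'. 0 \<le> t \<Longrightarrow> t \<le> t' \<Longrightarrow> h t \<le> h t'" "0 \<le> h 0"
    and [measurable]: "h \<in> borel_measurable borel"
    and fin: "(\<integral>\<^sup>+t. ennreal (h t * t powr (- 1 - p_star DIM('a) s \<gamma>)) * indicator {1..} t \<partial>lborel) < \<infinity>"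
  shows "(\<lambda>x. h (pot \<alpha> x)) \<in> L1d"
proof -
  note [measurable] = pot_measurable[OF \<alpha>]
  obtain C where C: "0 \<le> C"
    "\<And>t. 0 < t \<Longrightarrow> (\<integral>\<^sup>+x. ennreal (w x) * indicator {x. t < pot \<alpha> x} x \<partial>M) \<le> ennreal (C * t powr (- p_star DIM('a) s \<gamma>))"
    using pot_weak_type[OF \<alpha>] by auto
  interpret P: pair_sigma_finite M lborel ..
  define F where "F x t = ennreal (w x) * (ennreal (2 * h t / t) * indicator {p. 1 < fst p \<and> fst p \<le> snd p \<and> snd p \<le> 2 * fst p} (pot \<alpha> x, t))" for x t
  have [measurable]: "{p :: real \<times> real. 1 < fst p \<and> fst p \<le> snd p \<and> snd p \<le> 2 * fst p} \<in> sets (borel \<Otimes>\<^sub>M borel)"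
  proof -
    have "{p \<in> space (borel \<Otimes>\<^sub>M borel). 1 < fst p \<and> fst p \<le> snd p \<and> snd p \<le> 2 * (fst p :: real)} \<in> sets (borel \<Otimes>\<^sub>M borel)"
      by measurable
    then show ?thesis by (simp add: space_pair_measure)
  qed
  have Fm: "case_prod F \<in> borel_measurable (M \<Otimes>\<^sub>M lborel)" unfolding F_def by measurable
  have h0: "0 \<le> h t" if "0 \<le> t" for t using h(1)[of 0 t] h(2) that by simp
  have "(\<integral>\<^sup>+x. ennreal (h (pot \<alpha> x) * w x) \<partial>M) \<le> (\<integral>\<^sup>+x. ennreal (h 1 * w x) + (\<integral>\<^sup>+t. F x t \<partial>lborel) \<partial>M)"
  proof (rule nn_integral_mono)
    fix x assume "x \<in> space M"
    then have x: "x \<in> \<Omega>" by simp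
    have p0: "0 \<le> pot \<alpha> x" by (rule pot_nonneg[OF \<alpha> x])
    show "ennreal (h (pot \<alpha> x) * w x) \<le> ennreal (h 1 * w x) + (\<integral>\<^sup>+t. F x t \<partial>lborel)"
    proof (cases "pot \<alpha> x \<le> 1")
      case True
      then have "ennreal (h (pot \<alpha> x) * w x) \<le> ennreal (h 1 * w x)"
        using h(1)[OF p0] w_pos[OF x] by (intro ennreal_leI mult_right_mono) auto
      then show ?thesis by (rule order_trans) simp
    next
      case False
      have "ennreal (h (pot \<alpha> x) * w x) = ennreal (w x) * ennreal (h (pot \<alpha> x))"
        using h0[OF p0] w_pos[OF x] by (simp add: ennreal_mult mult.commute)
      also have "\<dots> \<le> ennreal (w x) * (\<integral>\<^sup>+t. ennreal (2 * h t / t) * indicator {pot \<alpha> x..2 * pot \<alpha> x} t \<partial>lborel)"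
        using False by (intro mult_left_mono nn_integral_average_lower h) auto
      also have "\<dots> = (\<integral>\<^sup>+t. ennreal (w x) * (ennreal (2 * h t / t) * indicator {pot \<alpha> x..2 * pot \<alpha> x} t) \<partial>lborel)"
        by (rule nn_integral_cmult[symmetric]) measurable
      also have "\<dots> = (\<integral>\<^sup>+t. F x t \<partial>lborel)"
        by (rule nn_integral_cong) (use False in \<open>auto simp: F_def indicator_def\<close>)
      finally show ?thesis by (rule order_trans) simp
    qed
  qed
  also have "\<dots> = (\<integral>\<^sup>+x. ennreal (h 1 * w x) \<partial>M) + (\<integral>\<^sup>+x. \<integral>\<^sup>+t. F x t \<partial>lborel \<partial>M)"
    by (rule nn_integral_add) (use Fm in measurable)
  also have "(\<integral>\<^sup>+x. \<integral>\<^sup>+t. F x t \<partial>lborel \<partial>M) = (\<integral>\<^sup>+t. \<integral>\<^sup>+x. F x t \<partial>M \<partial>lborel)"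
    using P.Fubini'[OF Fm] by simp
  also have "\<dots> \<le> (\<integral>\<^sup>+t. ennreal (2 * C * 4 powr p_star DIM('a) s \<gamma>) * (ennreal (h t * t powr (- 1 - p_star DIM('a) s \<gamma>)) * indicator {1..} t) \<partial>lborel)"
  proof (rule nn_integral_mono)
    fix t :: real
    show "(\<integral>\<^sup>+x. F x t \<partial>M) \<le> ennreal (2 * C * 4 powr p_star DIM('a) s \<gamma>) * (ennreal (h t * t powr (- 1 - p_star DIM('a) s \<gamma>)) * indicator {1..} t)"
    proof (cases "1 \<le> t")
      case False
      then have "F x t = 0" for x by (auto simp: F_def indicator_def)
      then show ?thesis by simp
    next
      case True
      have ht: "0 \<le> 2 * h t / t" using h0[of t] True by simp
      have "(\<integral>\<^sup>+x. F x t \<partial>M) \<le> (\<integral>\<^sup>+x. ennreal (2 * h t / t) * (ennreal (w x) * indicator {x. t / 4 < pot \<alpha> x} x) \<partial>M)"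
        by (rule nn_integral_mono) (use True in \<open>auto simp: F_def indicator_def mult_ac\<close>)
      also have "\<dots> = ennreal (2 * h t / t) * (\<integral>\<^sup>+x. ennreal (w x) * indicator {x. t / 4 < pot \<alpha> x} x \<partial>M)"
      proof (rule nn_integral_cmult)
        have "(\<lambda>x. ennreal (w x) * indicator {r. t / 4 < r} (pot \<alpha> x)) \<in> borel_measurable M" by measurable
        then show "(\<lambda>x. ennreal (w x) * indicator {x. t / 4 < pot \<alpha> x} x) \<in> borel_measurable M"
          by (simp add: indicator_def)
      qed
      also have "\<dots> \<le> ennreal (2 * h t / t) * ennreal (C * (t / 4) powr (- p_star DIM('a) s \<gamma>))"
        using True by (intro mult_left_mono C) auto
      also have "\<dots> = ennreal ((2 * h t / t) * (C * (t / 4) powr (- p_star DIM('a) s \<gamma>)))"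
        using ht C(1) by (subst ennreal_mult) auto
      also have "(2 * h t / t) * (C * (t / 4) powr (- p_star DIM('a) s \<gamma>)) = (2 * C * 4 powr p_star DIM('a) s \<gamma>) * (h t * t powr (- 1 - p_star DIM('a) s \<gamma>))"
      proof -
        have "(t / 4) powr (- p_star DIM('a) s \<gamma>) = 4 powr p_star DIM('a) s \<gamma> * t powr (- p_star DIM('a) s \<gamma>)"
          using True by (simp add: powr_divide powr_minus_divide)
        moreover have "t powr (- 1 - p_star DIM('a) s \<gamma>) = t powr (- p_star DIM('a) s \<gamma>) / t"
          using True powr_diff[of t "- p_star DIM('a) s \<gamma>" 1] by (simp add: minus_diff_commute)
        ultimately show ?thesis by simp
      qed
      also have "ennreal \<dots> = ennreal (2 * C * 4 powr p_star DIM('a) s \<gamma>) * (ennreal (h t * t powr (- 1 - p_star DIM('a) s \<gamma>)) * indicator {1..} t)"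
        using True C(1) h0[of t] by (simp add: ennreal_mult)
      finally show ?thesis .
    qed
  qed
  also have "\<dots> = ennreal (2 * C * 4 powr p_star DIM('a) s \<gamma>) * (\<integral>\<^sup>+t. ennreal (h t * t powr (- 1 - p_star DIM('a) s \<gamma>)) * indicator {1..} t \<partial>lborel)"
    by (rule nn_integral_cmult) measurable
  also have "(\<integral>\<^sup>+x. ennreal (h 1 * w x) \<partial>M) + \<dots> < \<infinity>"
  proof -
    have "integrable M (\<lambda>x. h 1 * w x)"
      using weight_in_S L1d_times_S[of "\<lambda>_. h 1" w] S_subset_L1d[OF weight_in_S]
      by (intro integrable_mult_right integrable_const_bound[where B="(2 * R) powr \<gamma>"]) (auto intro!: AE_I2 w_le simp: w_def[symmetric] less_imp_le[OF w_pos])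
    then have "(\<integral>\<^sup>+x. ennreal (h 1 * w x) \<partial>M) < \<infinity>"
      using h0[of 1] by (subst nn_integral_eq_integral) (auto simp: w_def)
    then show ?thesis using fin by (simp add: ennreal_mult_less_top)
  qed
  finally have "(\<integral>\<^sup>+x. ennreal (h (pot \<alpha> x) * w x) \<partial>M) < \<infinity>" by simp
  then have "integrable M (\<lambda>x. h (pot \<alpha> x) * w x)"
    using h0 pot_nonneg[OF \<alpha>] by (intro integrableI_nonneg) (auto intro!: AE_I2 mult_nonneg_nonneg simp: less_imp_le[OF w_pos])
  then show ?thesis by (simp add: L1d_def)
qed

end

section \<open>Jordan decomposition of signed Radon measures\<close>

lemma relcompact_subset:
  assumes "A \<in> relcompact_borel \<Omega>" "B \<in> sets borel" "B \<subseteq> A" shows "B \<in> relcompact_borel \<Omega>"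
proof -
  have "closure B \<subseteq> closure A" by (rule closure_mono[OF assms(3)])
  moreover have "bounded A" using assms(1) by (simp add: relcompact_borel_def compact_closure)
  ultimately show ?thesis
    using assms bounded_subset[OF _ assms(3)] by (auto simp: relcompact_borel_def compact_closure)
qed

lemma relcompact_empty: "{} \<in> relcompact_borel \<Omega>"
  by (simp add: relcompact_borel_def)

lemma relcompact_Un: "A \<in> relcompact_borel \<Omega> \<Longrightarrow> B \<in> relcompact_borel \<Omega> \<Longrightarrow> A \<union> B \<in> relcompact_borel \<Omega>"
  by (auto simp: relcompact_borel_def intro: compact_Un)

lemma relcompact_sets: "A \<in> relcompact_borel \<Omega> \<Longrightarrow> A \<in> sets borel"
  by (simp add: relcompact_borel_def)

lemma signed_radon_uminus: "signed_radon \<Omega> \<mu> \<Longrightarrow> signed_radon \<Omega> (\<lambda>A. - \<mu> A)"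
  by (auto simp: signed_radon_def intro!: sums_minus)

lemma signed_radon_empty: assumes "signed_radon \<Omega> \<mu>" shows "\<mu> {} = 0"
proof -
  have "(\<lambda>i::nat. \<mu> {}) sums \<mu> (\<Union>i::nat. {})"
    using assms relcompact_empty[of \<Omega>] unfolding signed_radon_def
    by (auto dest!: spec[of _ "\<lambda>_. {}"] simp: disjoint_family_on_def)
  then have "summable (\<lambda>i::nat. \<mu> {})" by (rule sums_summable)
  then show ?thesis by (simp add: summable_const_iff)
qed

lemma signed_radon_Un:
  assumes \<mu>: "signed_radon \<Omega> \<mu>" and A: "A \<in> relcompact_borel \<Omega>" and B: "B \<in> relcompact_borel \<Omega>" and "A \<inter> B = {}"
  shows "\<mu> (A \<union> B) = \<mu> A + \<mu> B"
proof -
  have "range (binaryset A B) \<subseteq> relcompact_borel \<Omega>"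
    using A B relcompact_empty[of \<Omega>] by (auto simp: binaryset_def)
  moreover have "disjoint_family (binaryset A B)"
    using assms(4) by (auto simp: disjoint_family_on_def binaryset_def)
  moreover have "(\<Union>i. binaryset A B i) = A \<union> B" by (rule UN_binaryset_eq)
  ultimately have "(\<lambda>i. \<mu> (binaryset A B i)) sums \<mu> (\<Union>i. binaryset A B i)"
    using relcompact_Un[OF A B] by (intro \<mu>[unfolded signed_radon_def, rule_format]) simp
  then have "(\<lambda>i. \<mu> (binaryset A B i)) sums \<mu> (A \<union> B)" by (simp only: UN_binaryset_eq)
  moreover have "(\<lambda>i. \<mu> (binaryset A B i)) sums (\<mu> A + \<mu> B)"
    by (rule binaryset_sums) (rule signed_radon_empty[OF \<mu>])
  ultimately show ?thesis by (rule sums_unique2)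
qed

text \<open>The set function inside \<open>pos_part\<close>, considered before it is known to be a
  measure.\<close>

definition upper_var :: "'a::euclidean_space set \<Rightarrow> ('a set \<Rightarrow> real) \<Rightarrow> 'a set \<Rightarrow> ennreal" where
  "upper_var \<Omega> \<mu> A = (SUP B\<in>{B \<in> relcompact_borel \<Omega>. B \<subseteq> A}. ennreal (\<mu> B))"

lemma upper_var_ge: "B \<in> relcompact_borel \<Omega> \<Longrightarrow> B \<subseteq> A \<Longrightarrow> ennreal (\<mu> B) \<le> upper_var \<Omega> \<mu> A"
  unfolding upper_var_def by (rule SUP_upper) auto

lemma upper_var_least: "(\<And>B. B \<in> relcompact_borel \<Omega> \<Longrightarrow> B \<subseteq> A \<Longrightarrow> ennreal (\<mu> B) \<le> c) \<Longrightarrow> upper_var \<Omega> \<mu> A \<le> c"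
  unfolding upper_var_def by (rule SUP_least) auto

lemma upper_var_mono: "A \<subseteq> A' \<Longrightarrow> upper_var \<Omega> \<mu> A \<le> upper_var \<Omega> \<mu> A'"
  by (rule upper_var_least) (auto intro: upper_var_ge)

lemma upper_var_empty: "signed_radon \<Omega> \<mu> \<Longrightarrow> upper_var \<Omega> \<mu> {} = 0"
  using upper_var_least[of \<Omega> "{}" \<mu> 0] by (simp add: signed_radon_empty)

lemma upper_var_superadditive:
  assumes \<mu>: "signed_radon \<Omega> \<mu>" and "A \<inter> A' = {}"
  shows "upper_var \<Omega> \<mu> A + upper_var \<Omega> \<mu> A' \<le> upper_var \<Omega> \<mu> (A \<union> A')"
proof -
  have ne: "{B \<in> relcompact_borel \<Omega>. B \<subseteq> A} \<noteq> {}" for A using relcompact_empty[of \<Omega>] by auto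
  have "ennreal (\<mu> B) + ennreal (\<mu> B') \<le> upper_var \<Omega> \<mu> (A \<union> A')"
    if B: "B \<in> relcompact_borel \<Omega>" "B \<subseteq> A" and B': "B' \<in> relcompact_borel \<Omega>" "B' \<subseteq> A'" for B B'
  \<comment> \<open>A negative value is truncated to 0, and then the other set alone is a competitor
    for the union.\<close>
  proof (cases "0 \<le> \<mu> B \<and> 0 \<le> \<mu> B'")
    case True
    have "B \<inter> B' = {}" using B(2) B'(2) assms(2) by auto
    then have "ennreal (\<mu> B) + ennreal (\<mu> B') = ennreal (\<mu> (B \<union> B'))"
      using signed_radon_Un[OF \<mu> B(1) B'(1)] True by simp
    also have "\<dots> \<le> upper_var \<Omega> \<mu> (A \<union> A')"
      using B B' by (intro upper_var_ge relcompact_Un) auto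
    finally show ?thesis .
  next
    case False
    then have "ennreal (\<mu> B) = 0 \<or> ennreal (\<mu> B') = 0" by (auto simp: ennreal_neg)
    moreover have "B \<subseteq> A \<union> A'" "B' \<subseteq> A \<union> A'" using B(2) B'(2) by auto
    ultimately show ?thesis using upper_var_ge[OF B(1), of "A \<union> A'" \<mu>] upper_var_ge[OF B'(1), of "A \<union> A'" \<mu>] by auto
  qed
  then have "ennreal (\<mu> B) + upper_var \<Omega> \<mu> A' \<le> upper_var \<Omega> \<mu> (A \<union> A')"
    if "B \<in> relcompact_borel \<Omega>" "B \<subseteq> A" for B
    unfolding upper_var_def[of \<Omega> \<mu> A'] using that
    by (subst ennreal_SUP_add_right[OF ne]) (auto intro!: SUP_least)
  then show ?thesis
    unfolding upper_var_def[of \<Omega> \<mu> A]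
    by (subst ennreal_SUP_add_left[OF ne, symmetric]) (auto intro!: SUP_least)
qed

lemma ennreal_plus_le: "ennreal (a + b) \<le> ennreal a + ennreal b"
  by (cases "0 \<le> a"; cases "0 \<le> b")
    (auto simp: ennreal_neg ennreal_plus[symmetric] simp del: ennreal_plus intro!: ennreal_leI)

lemma ennreal_sum_le: "ennreal (sum f A) \<le> (\<Sum>i\<in>A. ennreal (f i))"
proof (induction A rule: infinite_finite_induct)
  case (insert x F)
  then show ?case by (auto intro: order_trans[OF ennreal_plus_le] add_left_mono)
qed auto

text \<open>One inequality is superadditivity on finite unions. For the other, cut a competitor
  \<open>B\<close> along the sets \<open>A i\<close>: the pieces are relatively compact, so \<mu> is
  additive on them, and truncating their negative values only increases the sum.\<close>

lemma upper_var_countably_additive: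
  assumes \<mu>: "signed_radon \<Omega> \<mu>"
  shows "countably_additive {A \<in> sets borel. A \<subseteq> \<Omega>} (upper_var \<Omega> \<mu>)"
proof (rule countably_additiveI)
  fix A :: "nat \<Rightarrow> 'a set"
  assume A: "range A \<subseteq> {A \<in> sets borel. A \<subseteq> \<Omega>}" and dis: "disjoint_family A"
  have fin: "(\<Sum>i<n. upper_var \<Omega> \<mu> (A i)) \<le> upper_var \<Omega> \<mu> (\<Union>i<n. A i)" for n
  proof (induction n)
    case (Suc n)
    have disj: "(\<Union>i<n. A i) \<inter> A n = {}" using disjoint_family_onD[OF dis, of _ n] by fastforce
    have "(\<Sum>i<Suc n. upper_var \<Omega> \<mu> (A i)) \<le> upper_var \<Omega> \<mu> (\<Union>i<n. A i) + upper_var \<Omega> \<mu> (A n)"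
      using Suc by (simp add: add_right_mono)
    also have "\<dots> \<le> upper_var \<Omega> \<mu> ((\<Union>i<n. A i) \<union> A n)"
      by (rule upper_var_superadditive[OF \<mu> disj])
    also have "(\<Union>i<n. A i) \<union> A n = (\<Union>i<Suc n. A i)" by (auto simp: less_Suc_eq)
    finally show ?case .
  qed simp
  show "(\<Sum>i. upper_var \<Omega> \<mu> (A i)) = upper_var \<Omega> \<mu> (\<Union>i. A i)"
  proof (rule antisym)
    show "(\<Sum>i. upper_var \<Omega> \<mu> (A i)) \<le> upper_var \<Omega> \<mu> (\<Union>i. A i)"
    proof (rule suminf_le_const[OF summableI])
      show "(\<Sum>i<n. upper_var \<Omega> \<mu> (A i)) \<le> upper_var \<Omega> \<mu> (\<Union>i. A i)" for n
        by (rule order_trans[OF fin upper_var_mono]) auto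
    qed
    show "upper_var \<Omega> \<mu> (\<Union>i. A i) \<le> (\<Sum>i. upper_var \<Omega> \<mu> (A i))"
    proof (rule upper_var_least)
      fix B assume B: "B \<in> relcompact_borel \<Omega>" "B \<subseteq> (\<Union>i. A i)"
      have BA: "B \<inter> A i \<in> relcompact_borel \<Omega>" for i
        using A B relcompact_sets[OF B(1)] by (intro relcompact_subset[OF B(1)]) auto
      have U: "(\<Union>i. B \<inter> A i) = B" using B(2) by auto
      have "disjoint_family (\<lambda>i. B \<inter> A i)" using dis by (auto simp: disjoint_family_on_def)
      then have "(\<lambda>i. \<mu> (B \<inter> A i)) sums \<mu> (\<Union>i. B \<inter> A i)"
        using BA B(1) by (intro \<mu>[unfolded signed_radon_def, rule_format]) (auto simp only: U image_subset_iff)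
      then have "(\<lambda>i. \<mu> (B \<inter> A i)) sums \<mu> B" unfolding U .
      then have lim: "(\<lambda>n. ennreal (\<Sum>i<n. \<mu> (B \<inter> A i))) \<longlonglongrightarrow> ennreal (\<mu> B)"
        unfolding sums_def by (rule tendsto_ennrealI)
      have "ennreal (\<Sum>i<n. \<mu> (B \<inter> A i)) \<le> (\<Sum>i. upper_var \<Omega> \<mu> (A i))" for n
      proof -
        have "ennreal (\<Sum>i<n. \<mu> (B \<inter> A i)) \<le> (\<Sum>i<n. ennreal (\<mu> (B \<inter> A i)))" by (rule ennreal_sum_le)
        also have "\<dots> \<le> (\<Sum>i<n. upper_var \<Omega> \<mu> (A i))" by (intro sum_mono upper_var_ge BA) auto
        also have "\<dots> \<le> (\<Sum>i. upper_var \<Omega> \<mu> (A i))" by (rule sum_le_suminf[OF summableI]) auto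
        finally show ?thesis .
      qed
      then show "ennreal (\<mu> B) \<le> (\<Sum>i. upper_var \<Omega> \<mu> (A i))"
        by (intro LIMSEQ_le_const2[OF lim]) auto
    qed
  qed
qed

lemma borel_trace_algebra: "open \<Omega> \<Longrightarrow> {A \<in> sets borel. A \<subseteq> \<Omega>} = sets (restrict_space borel \<Omega>)"
  by (auto simp: sets_restrict_space_iff)

lemma pos_part_sets: "open \<Omega> \<Longrightarrow> sets (pos_part \<Omega> \<mu>) = sets (restrict_space borel \<Omega>)"
  unfolding pos_part_def borel_trace_algebra
  using sets.sets_measure_of_eq[of "restrict_space borel \<Omega>"] by (simp add: space_restrict_space)

lemma pos_part_emeasure:
  assumes "open \<Omega>" "signed_radon \<Omega> \<mu>" "A \<in> sets borel" "A \<subseteq> \<Omega>"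
  shows "emeasure (pos_part \<Omega> \<mu>) A = upper_var \<Omega> \<mu> A"
proof -
  have sa: "sigma_algebra \<Omega> {A \<in> sets borel. A \<subseteq> \<Omega>}"
    unfolding borel_trace_algebra[OF assms(1)]
    using sets.sigma_algebra_axioms[of "restrict_space borel \<Omega>"] by (simp add: space_restrict_space)
  have "positive {A \<in> sets borel. A \<subseteq> \<Omega>} (upper_var \<Omega> \<mu>)"
    by (simp add: positive_def upper_var_empty[OF assms(2)])
  then show ?thesis
    unfolding pos_part_def upper_var_def[symmetric]
    by (rule emeasure_measure_of_sigma[OF sa _ upper_var_countably_additive[OF assms(2)]]) (use assms in simp)
qed

text \<open>For \<open>B\<close> inside \<open>A\<close> one has \<mu>(B) = \<mu>(A) - \<mu>(A - B),
  at most \<mu>(A) plus the upper variation of -\<mu>. The supremum over \<open>B\<close> gives one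
  inequality, and the same for -\<mu> gives the other.\<close>

lemma upper_var_jordan:
  assumes \<mu>: "signed_radon \<Omega> \<mu>" and A: "A \<in> relcompact_borel \<Omega>"
    and fin: "upper_var \<Omega> \<mu> A < \<infinity>" "upper_var \<Omega> (\<lambda>A. - \<mu> A) A < \<infinity>"
  shows "enn2real (upper_var \<Omega> \<mu> A) - enn2real (upper_var \<Omega> (\<lambda>A. - \<mu> A) A) = \<mu> A"
proof -
  have half: "enn2real (upper_var \<Omega> \<nu> A) \<le> \<nu> A + enn2real (upper_var \<Omega> (\<lambda>A. - \<nu> A) A)"
    if \<nu>: "signed_radon \<Omega> \<nu>" and f: "upper_var \<Omega> (\<lambda>A. - \<nu> A) A < \<infinity>" for \<nu>
  proof -
    define n where "n = enn2real (upper_var \<Omega> (\<lambda>A. - \<nu> A) A)"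
    have n: "- \<nu> C \<le> n" if "C \<in> relcompact_borel \<Omega>" "C \<subseteq> A" for C
    proof -
      have "ennreal (- \<nu> C) \<le> upper_var \<Omega> (\<lambda>A. - \<nu> A) A" by (rule upper_var_ge[OF that])
      also have "\<dots> = ennreal n" using f by (simp add: n_def)
      finally show ?thesis by (subst (asm) ennreal_le_iff) (simp_all add: n_def)
    qed
    have "upper_var \<Omega> \<nu> A \<le> ennreal (\<nu> A + n)"
    proof (rule upper_var_least)
      fix B assume B: "B \<in> relcompact_borel \<Omega>" "B \<subseteq> A"
      have AB: "A - B \<in> relcompact_borel \<Omega>"
        using relcompact_sets[OF A] relcompact_sets[OF B(1)] by (intro relcompact_subset[OF A]) auto
      have "B \<union> (A - B) = A" using B(2) by auto
      then have "\<nu> A = \<nu> B + \<nu> (A - B)" using signed_radon_Un[OF \<nu> B(1) AB] by auto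
      then show "ennreal (\<nu> B) \<le> ennreal (\<nu> A + n)" using n[OF AB] by (intro ennreal_leI) auto
    qed
    moreover have "0 \<le> \<nu> A + n" using n[OF A] by simp
    ultimately show ?thesis using enn2real_mono[of "upper_var \<Omega> \<nu> A" "ennreal (\<nu> A + n)"] by (simp add: n_def)
  qed
  show ?thesis using half[OF \<mu> fin(2)] half[OF signed_radon_uminus[OF \<mu>]] fin(1) by simp
qed

text \<open>An inequality between differences of measures is written with sums, as the differences
  may be undefined on sets of infinite mass. All four integrals are carried through one induction
  over measurable functions.\<close>

lemma nn_integral_sum_mono:
  assumes sets: "sets a' = sets a" "sets b = sets a" "sets b' = sets a"
    and le: "\<And>A. A \<in> sets a \<Longrightarrow> emeasure a A + emeasure b A \<le> emeasure a' A + emeasure b' A"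
    and h: "h \<in> borel_measurable a"
  shows "(\<integral>\<^sup>+x. h x \<partial>a) + (\<integral>\<^sup>+x. h x \<partial>b) \<le> (\<integral>\<^sup>+x. h x \<partial>a') + (\<integral>\<^sup>+x. h x \<partial>b')"
proof -
  have m: "f \<in> borel_measurable a \<Longrightarrow> f \<in> borel_measurable a' \<and> f \<in> borel_measurable b \<and> f \<in> borel_measurable b'"
    for f :: "'a \<Rightarrow> ennreal"
    by (simp add: measurable_cong_sets[OF sets(1) refl] measurable_cong_sets[OF sets(2) refl] measurable_cong_sets[OF sets(3) refl])
  have sp: "space a' = space a" "space b = space a" "space b' = space a"
    using sets by (auto dest: sets_eq_imp_space_eq)
  show ?thesis using h
  proof (induction h rule: borel_measurable_induct)
    case (cong f g)
    have "nn_integral M f = nn_integral M g" if "space M = space a" for M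
      using cong(3) that by (intro nn_integral_cong) auto
    then show ?case using cong(4) sp by simp
  next
    case (set A)
    then show ?case using le[OF set] sets by simp
  next
    case (mult u c)
    then show ?case using m[of u] by (simp add: nn_integral_cmult distrib_left[symmetric] mult_left_mono)
  next
    case (add u v)
    have "(\<integral>\<^sup>+x. v x + u x \<partial>M) = (\<integral>\<^sup>+x. v x \<partial>M) + (\<integral>\<^sup>+x. u x \<partial>M)" if "M \<in> {a, b, a', b'}" for M
      using m[of u] m[of v] add that by (intro nn_integral_add) auto
    note eq = this
    have "((\<integral>\<^sup>+x. v x \<partial>a) + (\<integral>\<^sup>+x. v x \<partial>b)) + ((\<integral>\<^sup>+x. u x \<partial>a) + (\<integral>\<^sup>+x. u x \<partial>b))
       \<le> ((\<integral>\<^sup>+x. v x \<partial>a') + (\<integral>\<^sup>+x. v x \<partial>b')) + ((\<integral>\<^sup>+x. u x \<partial>a') + (\<integral>\<^sup>+x. u x \<partial>b'))"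
      by (rule add_mono) (use add in auto)
    then show ?case using eq[of a] eq[of b] eq[of a'] eq[of b'] by (simp add: add_ac)
  next
    case (seq U)
    have lim: "(\<lambda>i. \<integral>\<^sup>+x. U i x \<partial>M) \<longlonglongrightarrow> (\<integral>\<^sup>+x. (SUP i. U i) x \<partial>M)" if M: "M \<in> {a, b, a', b'}" for M
    proof -
      have mono: "incseq (\<lambda>i. \<integral>\<^sup>+x. U i x \<partial>M)"
        using seq(3) by (auto simp: incseq_def le_fun_def intro!: nn_integral_mono)
      have "(\<integral>\<^sup>+x. (SUP i. U i) x \<partial>M) = (SUP i. \<integral>\<^sup>+x. U i x \<partial>M)"
        unfolding SUP_apply using seq(1) m[OF seq(1)] seq(3) M
        by (intro nn_integral_monotone_convergence_SUP) auto
      then show ?thesis using LIMSEQ_SUP[OF mono] by simp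
    qed
    show ?case
      by (rule LIMSEQ_le[OF tendsto_add[OF lim lim] tendsto_add[OF lim lim]]) (use seq in auto)
  qed
qed

section \<open>Weak-dual solutions\<close>

context green_domain
begin

section \<open>Measures of finite weighted variation and their order\<close>

lemma Mw_parts:
  assumes "\<mu> \<in> Mw \<Omega> \<gamma>"
  shows "signed_radon \<Omega> \<mu>" "wfin (pos_part \<Omega> \<mu>)" "wfin (neg_part \<Omega> \<mu>)"
    and "Mw_norm \<Omega> \<gamma> \<mu> = (\<integral>x. w x \<partial>pos_part \<Omega> \<mu>) + (\<integral>x. w x \<partial>neg_part \<Omega> \<mu>)"
proof -
  show "signed_radon \<Omega> \<mu>" using assms by (simp add: Mw_def)
  have fin: "(\<integral>\<^sup>+x. ennreal (w x) \<partial>pos_part \<Omega> \<mu>) < \<infinity>" "(\<integral>\<^sup>+x. ennreal (w x) \<partial>neg_part \<Omega> \<mu>) < \<infinity>"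
    using assms by (auto simp: Mw_def weighted_var_def w_def)
  then show p: "wfin (pos_part \<Omega> \<mu>)" "wfin (neg_part \<Omega> \<mu>)"
    by (auto simp: wfin_def neg_part_def pos_part_sets[OF opn])
  have "(\<integral>\<^sup>+x. ennreal (w x) \<partial>\<alpha>) = ennreal (\<integral>x. w x \<partial>\<alpha>)" if "wfin \<alpha>" for \<alpha>
    by (rule nn_integral_eq_integral[OF wfin_integrable[OF that]]) (simp add: w_def)
  moreover have "0 \<le> (\<integral>x. w x \<partial>\<alpha>)" for \<alpha> by (simp add: w_def)
  ultimately show "Mw_norm \<Omega> \<gamma> \<mu> = (\<integral>x. w x \<partial>pos_part \<Omega> \<mu>) + (\<integral>x. w x \<partial>neg_part \<Omega> \<mu>)"
    using p unfolding Mw_norm_def weighted_var_def w_def[symmetric] by (simp add: ennreal_plus[symmetric] del: ennreal_plus)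
qed

text \<open>These sets exhaust \<open>A\<close> when it lies in \<Omega>, and each of them is one on
  which a signed Radon measure has a value.\<close>

lemma interior_level_relcompact:
  assumes "A \<in> sets borel" shows "A \<inter> {x. 1 / real (Suc n) \<le> \<delta> x} \<in> relcompact_borel \<Omega>"
proof -
  let ?K = "{x. 1 / real (Suc n) \<le> \<delta> x}"
  have cont: "continuous_on UNIV \<delta>" unfolding bdist_def[abs_def] by (intro continuous_intros)
  have cl: "closed ?K" by (intro closed_Collect_le cont continuous_on_const)
  have sub: "?K \<subseteq> \<Omega>"
  proof
    fix x assume "x \<in> ?K"
    then have "0 < \<delta> x" by (auto intro: less_le_trans[rotated])
    then show "x \<in> \<Omega>" by (rule_tac ccontr) (simp add: bdist_def infdist_zero)
  qed
  have "bounded \<Omega>" by (rule bounded_subset[OF bounded_ball bnd])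
  then have "compact ?K" using cl bounded_subset[OF _ sub] unfolding compact_eq_bounded_closed by blast
  then have "?K \<in> relcompact_borel \<Omega>"
    unfolding relcompact_borel_def mem_Collect_eq closure_closed[OF cl] using borel_closed[OF cl] sub by blast
  then show ?thesis by (rule relcompact_subset) (use assms cl in auto)
qed

lemma wfin_level_finite:
  assumes "wfin \<alpha>" "A \<in> sets \<alpha>" shows "emeasure \<alpha> (A \<inter> {x. 1 / real (Suc n) \<le> \<delta> x}) < \<infinity>"
proof -
  define e where "e = (1 / real (Suc n)) powr \<gamma>"
  have e: "0 < e" by (simp add: e_def)
  let ?B = "A \<inter> {x. 1 / real (Suc n) \<le> \<delta> x}"
  have "{x \<in> space \<alpha>. 1 / real (Suc n) \<le> \<delta> x} \<in> sets \<alpha>"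
  proof -
    have "continuous_on UNIV \<delta>" unfolding bdist_def[abs_def] by (intro continuous_intros)
    then have [measurable]: "\<delta> \<in> borel_measurable \<alpha>"
      by (intro wfin_borel[OF assms(1)] borel_measurable_continuous_onI)
    show ?thesis by measurable
  qed
  moreover have "?B = A \<inter> {x \<in> space \<alpha>. 1 / real (Suc n) \<le> \<delta> x}" using sets.sets_into_space[OF assms(2)] by auto
  ultimately have B: "?B \<in> sets \<alpha>" using assms(2) by (simp add: sets.Int)
  have "ennreal e * emeasure \<alpha> ?B = (\<integral>\<^sup>+x. ennreal e * indicator ?B x \<partial>\<alpha>)"
    by (rule nn_integral_cmult_indicator[OF B, symmetric])
  also have "\<dots> \<le> (\<integral>\<^sup>+x. ennreal (w x) \<partial>\<alpha>)"
    using \<gamma> by (intro nn_integral_mono) (auto simp: e_def w_def indicator_def intro!: ennreal_leI powr_mono2)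
  also have "\<dots> < \<infinity>" using assms by (simp add: wfin_def)
  finally show ?thesis using e by (auto simp: ennreal_mult_less_top)
qed

text \<open>On the sets at distance at least 1/(n+1) from the complement all four masses are finite,
  so the order can be combined with the Jordan identity and rearranged; continuity from below then
  reaches \<open>A\<close>.\<close>

lemma signed_le_emeasure:
  assumes m: "\<mu>\<^sub>1 \<in> Mw \<Omega> \<gamma>" "\<mu>\<^sub>2 \<in> Mw \<Omega> \<gamma>" and le: "signed_le \<Omega> \<mu>\<^sub>1 \<mu>\<^sub>2" and A: "A \<in> sets borel" "A \<subseteq> \<Omega>"
  shows "emeasure (pos_part \<Omega> \<mu>\<^sub>1) A + emeasure (neg_part \<Omega> \<mu>\<^sub>2) A
     \<le> emeasure (pos_part \<Omega> \<mu>\<^sub>2) A + emeasure (neg_part \<Omega> \<mu>\<^sub>1) A"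
proof -
  define B where "B n = A \<inter> {x. 1 / real (Suc n) \<le> \<delta> x}" for n
  have BR: "B n \<in> relcompact_borel \<Omega>" for n unfolding B_def by (rule interior_level_relcompact[OF A(1)])
  have Bs: "B n \<in> sets borel" "B n \<subseteq> \<Omega>" for n using relcompact_sets[OF BR] A(2) by (auto simp: B_def)
  note w1 = Mw_parts[OF m(1)] and w2 = Mw_parts[OF m(2)]
  have setsA: "A \<in> sets \<alpha>" "B n \<in> sets \<alpha>" if "wfin \<alpha>" for \<alpha> n
    using that A Bs[of n] by (auto simp: wfin_def sets_restrict_space_iff)
  have em: "emeasure (pos_part \<Omega> \<mu>) (B n) = upper_var \<Omega> \<mu> (B n)"
    "emeasure (neg_part \<Omega> \<mu>) (B n) = upper_var \<Omega> (\<lambda>A. - \<mu> A) (B n)" if "signed_radon \<Omega> \<mu>" for \<mu> n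
    using pos_part_emeasure[OF opn that Bs] pos_part_emeasure[OF opn signed_radon_uminus[OF that] Bs]
    by (auto simp: neg_part_def)
  have fin: "emeasure \<alpha> (B n) < \<infinity>" if "wfin \<alpha>" for \<alpha> n
    unfolding B_def by (rule wfin_level_finite[OF that setsA(1)[OF that]])
  have jordan: "\<mu> (B n) = enn2real (emeasure (pos_part \<Omega> \<mu>) (B n)) - enn2real (emeasure (neg_part \<Omega> \<mu>) (B n))"
    if "\<mu> \<in> Mw \<Omega> \<gamma>" for \<mu> n
    using upper_var_jordan[OF Mw_parts(1)[OF that] BR, of n] fin[OF Mw_parts(2)[OF that], of n] fin[OF Mw_parts(3)[OF that], of n]
    by (simp add: em[OF Mw_parts(1)[OF that]])
  have step: "emeasure (pos_part \<Omega> \<mu>\<^sub>1) (B n) + emeasure (neg_part \<Omega> \<mu>\<^sub>2) (B n)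
     \<le> emeasure (pos_part \<Omega> \<mu>\<^sub>2) (B n) + emeasure (neg_part \<Omega> \<mu>\<^sub>1) (B n)" for n
  proof -
    have "\<mu>\<^sub>1 (B n) \<le> \<mu>\<^sub>2 (B n)" using le BR by (simp add: signed_le_def)
    then have "enn2real (emeasure (pos_part \<Omega> \<mu>\<^sub>1) (B n)) + enn2real (emeasure (neg_part \<Omega> \<mu>\<^sub>2) (B n))
      \<le> enn2real (emeasure (pos_part \<Omega> \<mu>\<^sub>2) (B n)) + enn2real (emeasure (neg_part \<Omega> \<mu>\<^sub>1) (B n))"
      using jordan[OF m(1), of n] jordan[OF m(2), of n] by linarith
    then have "ennreal (enn2real (emeasure (pos_part \<Omega> \<mu>\<^sub>1) (B n)) + enn2real (emeasure (neg_part \<Omega> \<mu>\<^sub>2) (B n)))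
      \<le> ennreal (enn2real (emeasure (pos_part \<Omega> \<mu>\<^sub>2) (B n)) + enn2real (emeasure (neg_part \<Omega> \<mu>\<^sub>1) (B n)))"
      by (rule ennreal_leI)
    then show ?thesis using fin[OF w1(2), of n] fin[OF w1(3), of n] fin[OF w2(2), of n] fin[OF w2(3), of n] by simp
  qed
  have inc: "incseq B"
  proof (intro incseq_SucI subsetI)
    fix n x assume "x \<in> B n"
    moreover have "1 / real (Suc (Suc n)) \<le> 1 / real (Suc n)" by (simp add: frac_le)
    ultimately show "x \<in> B (Suc n)" unfolding B_def by (blast intro: order_trans)
  qed
  have U: "(\<Union>n. B n) = A"
  proof (intro equalityI subsetI)
    fix x assume x: "x \<in> A"
    then have "0 < \<delta> x" using A(2) delta_pos by auto
    then obtain n where "1 / real (Suc n) < \<delta> x" using nat_approx_posE by blast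
    then show "x \<in> (\<Union>n. B n)" using x by (auto simp: B_def intro!: exI[of _ n])
  qed (auto simp: B_def)
  have lim: "(\<lambda>n. emeasure \<alpha> (B n)) \<longlonglongrightarrow> emeasure \<alpha> A" if "wfin \<alpha>" for \<alpha>
    using Lim_emeasure_incseq[of B \<alpha>] setsA[OF that] inc U by auto
  show ?thesis
    by (rule LIMSEQ_le[OF tendsto_add[OF lim lim] tendsto_add[OF lim lim]]) (use w1 w2 step in auto)
qed

lemma signed_le_integral:
  assumes m: "\<mu>\<^sub>1 \<in> Mw \<Omega> \<gamma>" "\<mu>\<^sub>2 \<in> Mw \<Omega> \<gamma>" and le: "signed_le \<Omega> \<mu>\<^sub>1 \<mu>\<^sub>2"
    and xi: "\<xi> \<in> S" "\<And>x. x \<in> \<Omega> \<Longrightarrow> 0 \<le> green \<xi> x"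
  shows "(\<integral>x. green \<xi> x \<partial>pos_part \<Omega> \<mu>\<^sub>1) - (\<integral>x. green \<xi> x \<partial>neg_part \<Omega> \<mu>\<^sub>1)
     \<le> (\<integral>x. green \<xi> x \<partial>pos_part \<Omega> \<mu>\<^sub>2) - (\<integral>x. green \<xi> x \<partial>neg_part \<Omega> \<mu>\<^sub>2)"
proof -
  note w1 = Mw_parts[OF m(1)] and w2 = Mw_parts[OF m(2)]
  have s: "sets \<alpha> = sets (restrict_space borel \<Omega>)" if "wfin \<alpha>" for \<alpha> using that by (simp add: wfin_def)
  have int: "integrable \<alpha> (green \<xi>)" if "wfin \<alpha>" for \<alpha> by (rule pot_duality(3)[OF that xi(1)])
  have eq: "(\<integral>\<^sup>+x. ennreal (green \<xi> x) \<partial>\<alpha>) = ennreal (\<integral>x. green \<xi> x \<partial>\<alpha>)" if "wfin \<alpha>" for \<alpha>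
    by (rule nn_integral_eq_integral[OF int[OF that]]) (auto simp: wfin_space[OF that] xi(2) intro!: AE_I2)
  have nn: "0 \<le> (\<integral>x. green \<xi> x \<partial>\<alpha>)" if "wfin \<alpha>" for \<alpha>
    by (rule Bochner_Integration.integral_nonneg) (auto simp: wfin_space[OF that] xi(2))
  have "(\<integral>\<^sup>+x. ennreal (green \<xi> x) \<partial>pos_part \<Omega> \<mu>\<^sub>1) + (\<integral>\<^sup>+x. ennreal (green \<xi> x) \<partial>neg_part \<Omega> \<mu>\<^sub>2)
     \<le> (\<integral>\<^sup>+x. ennreal (green \<xi> x) \<partial>pos_part \<Omega> \<mu>\<^sub>2) + (\<integral>\<^sup>+x. ennreal (green \<xi> x) \<partial>neg_part \<Omega> \<mu>\<^sub>1)"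
  proof (rule nn_integral_sum_mono)
    fix A assume "A \<in> sets (pos_part \<Omega> \<mu>\<^sub>1)"
    then have "A \<in> sets borel" "A \<subseteq> \<Omega>" by (auto simp: s[OF w1(2)] sets_restrict_space_iff)
    then show "emeasure (pos_part \<Omega> \<mu>\<^sub>1) A + emeasure (neg_part \<Omega> \<mu>\<^sub>2) A
      \<le> emeasure (pos_part \<Omega> \<mu>\<^sub>2) A + emeasure (neg_part \<Omega> \<mu>\<^sub>1) A"
      by (rule signed_le_emeasure[OF m le])
  qed (use int[OF w1(2)] in \<open>auto simp: s[OF w1(2)] s[OF w1(3)] s[OF w2(2)] s[OF w2(3)]\<close>)
  then have "ennreal ((\<integral>x. green \<xi> x \<partial>pos_part \<Omega> \<mu>\<^sub>1) + (\<integral>x. green \<xi> x \<partial>neg_part \<Omega> \<mu>\<^sub>2))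
     \<le> ennreal ((\<integral>x. green \<xi> x \<partial>pos_part \<Omega> \<mu>\<^sub>2) + (\<integral>x. green \<xi> x \<partial>neg_part \<Omega> \<mu>\<^sub>1))"
    using w1 w2 by (simp add: eq nn)
  then show ?thesis using nn w1 w2 by (subst (asm) ennreal_le_iff) (auto intro: add_nonneg_nonneg)
qed

section \<open>Translation into the abstract setting\<close>

lemma L1w_iff: "u \<in> L1w \<Omega> \<gamma> \<longleftrightarrow> u \<in> L1d"
proof -
  have "integrable M (\<lambda>x. \<bar>u x\<bar> * w x) \<longleftrightarrow> integrable M (\<lambda>x. u x * w x)" if [measurable]: "u \<in> borel_measurable M"
  proof -
    have "(\<lambda>x. u x * w x) \<in> borel_measurable M" by measurable
    then have "integrable M (\<lambda>x. \<bar>u x * w x\<bar>) \<longleftrightarrow> integrable M (\<lambda>x. u x * w x)"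
      using integrable_norm_iff[of "\<lambda>x. u x * w x" M] by simp
    then show ?thesis by (simp add: abs_mult w_def)
  qed
  then show ?thesis by (auto simp: L1w_def L1d_def restrict_iffs w_def[symmetric])
qed

lemma L1w_norm_eq: "L1w_norm \<Omega> \<gamma> u = (\<integral>x. \<bar>u x\<bar> * w x \<partial>M)"
  by (simp add: L1w_norm_def restrict_iffs w_def)

lemma S_weighted_Linf: assumes "\<xi> \<in> S" shows "\<xi> \<in> weighted_Linf \<Omega> \<gamma>"
proof -
  obtain m where m: "0 < m" "\<And>x. x \<in> \<Omega> \<Longrightarrow> \<bar>\<xi> x\<bar> \<le> m * w x"
    using assms by (auto elim!: S_E)
  note [measurable] = S_measurable[OF assms]
  have "(\<lambda>x. \<xi> x / w x) \<in> Linf \<Omega>"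
    unfolding Linf_def restrict_iffs(3)[OF Omega_sets(1)]
  proof (intro CollectI conjI exI[of _ m])
    show "AE x in lebesgue. x \<in> \<Omega> \<longrightarrow> \<bar>\<xi> x / w x\<bar> \<le> m"
    proof (intro AE_I2 impI)
      fix x assume "x \<in> \<Omega>"
      then show "\<bar>\<xi> x / w x\<bar> \<le> m" using m(2)[of x] w_pos[of x] by (simp add: divide_le_eq)
    qed
  qed measurable
  moreover have "\<forall>x\<in>\<Omega>. \<xi> x = bdist \<Omega> x powr \<gamma> * (\<xi> x / w x)"
  proof
    fix x assume "x \<in> \<Omega>"
    then show "\<xi> x = bdist \<Omega> x powr \<gamma> * (\<xi> x / w x)" using w_pos[of x] by (simp add: w_def[symmetric])
  qed
  ultimately show ?thesis unfolding weighted_Linf_def by (intro CollectI bexI[of _ "\<lambda>x. \<xi> x / w x"])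
qed

text \<open>Putting the bounded factor to 0 where it exceeds its essential bound turns an
  almost-everywhere bound into one at every point. The potential of the test function is not altered
  anywhere.\<close>

lemma weighted_Linf_S:
  assumes "\<xi> \<in> weighted_Linf \<Omega> \<gamma>"
  obtains \<eta> where "\<eta> \<in> S" "\<xi> \<in> borel_measurable M" "AE x in M. \<xi> x = \<eta> x"
proof -
  obtain v m where v: "set_borel_measurable lebesgue \<Omega> v" "AE x in lebesgue. x \<in> \<Omega> \<longrightarrow> \<bar>v x\<bar> \<le> m"
      "\<forall>x\<in>\<Omega>. \<xi> x = w x * v x"
    using assms by (auto simp: weighted_Linf_def Linf_def w_def)
  have [measurable]: "v \<in> borel_measurable M" using v(1) by (simp add: restrict_iffs)
  define \<eta> where "\<eta> x = w x * (if \<bar>v x\<bar> \<le> m then v x else 0)" for x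
  have "\<eta> \<in> S"
  proof (rule S_I[where m="\<bar>m\<bar>"])
    show "\<eta> \<in> borel_measurable M" unfolding \<eta>_def by measurable
    fix x assume "x \<in> space M"
    then show "\<bar>\<eta> x\<bar> \<le> \<bar>m\<bar> * w x" using w_pos[of x] by (auto simp: \<eta>_def abs_mult mult.commute intro!: mult_right_mono)
  qed
  moreover have "(\<lambda>x. w x * v x) \<in> borel_measurable M" by measurable
  then have "\<xi> \<in> borel_measurable M" by (rule measurable_cong[THEN iffD1, rotated]) (use v(3) in auto)
  moreover have "AE x in M. \<bar>v x\<bar> \<le> m" using v(2) by (simp add: AE_restrict_space_iff)
  then have "AE x in M. \<xi> x = \<eta> x"
    using AE_space by eventually_elim (use v(3) in \<open>auto simp: \<eta>_def\<close>)
  ultimately show thesis by (rule that)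
qed

end

section \<open>The operator together with its Green kernel\<close>

locale elliptic_problem = green_domain +
  fixes J :: "'a \<Rightarrow> 'a \<Rightarrow> real" and B :: "'a \<Rightarrow> real"
  assumes L1: "cond_L1 \<Omega> J B"
    and var: "\<And>f. f \<in> L2 \<Omega> \<Longrightarrow> variational_sol \<Omega> J B f (green_fun \<Omega> G f)"
begin

lemma S_L2: "\<xi> \<in> S \<Longrightarrow> \<xi> \<in> L2 \<Omega>"
  using L1d_times_S[OF S_subset_L1d, of \<xi> \<xi>] S_measurable[of \<xi>]
  by (simp add: L2_def restrict_iffs power2_eq_square)

sublocale green_operator M \<kappa> w Kc "(2 * R) powr \<gamma>"
proof
  fix \<xi> assume xi: "\<xi> \<in> S"
  interpret V: variational_problem \<Omega> J B \<xi> "green_fun \<Omega> G \<xi>"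
    by unfold_locales (use opn L1 S_L2[OF xi] var in auto)
  have eq: "green \<xi> x = green_fun \<Omega> G \<xi> x" if "x \<in> \<Omega>" for x
    by (rule green_eq_green_fun[OF that S_measurable[OF xi]])
  have "(\<integral>x. \<xi> x * green \<xi> x \<partial>M) = (\<integral>x. \<xi> x * green_fun \<Omega> G \<xi> x \<partial>M)"
    by (rule Bochner_Integration.integral_cong) (auto simp: eq)
  then show "0 \<le> (\<integral>x. \<xi> x * green \<xi> x \<partial>M)" using V.energy_nonneg by simp
  have "(\<integral>x. \<xi> x * max 0 (- green \<xi> x) \<partial>M) = (\<integral>x. \<xi> x * max 0 (- green_fun \<Omega> G \<xi> x) \<partial>M)"
    by (rule Bochner_Integration.integral_cong) (auto simp: eq)
  then show "(\<integral>x. \<xi> x * max 0 (- green \<xi> x) \<partial>M) \<le> 0" using V.negative_part_pairing by simp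
next
  fix \<xi> x assume a: "\<xi> \<in> S" "AE y in M. 0 \<le> green \<xi> y" "x \<in> space M"
  then have "x \<in> \<Omega>" by simp
  then show "0 \<le> green \<xi> x" by (rule green_nonneg_of_AE[OF a(1,2)])
qed

lemma potential_pot: assumes "wfin \<alpha>" shows "potential (pot \<alpha>)"
  unfolding potential_def
proof (intro conjI ballI impI)
  show "pot \<alpha> \<in> L1d" by (rule pot_duality(2)[OF assms])
  show "0 \<le> pot \<alpha> x" if "x \<in> space M" for x using pot_nonneg[OF assms, of x] that by simp
  fix \<xi> assume "\<xi> \<in> S" "\<forall>x\<in>space M. 0 \<le> green \<xi> x"
  then show "0 \<le> (\<integral>x. pot \<alpha> x * \<xi> x \<partial>M)"
    by (subst pot_duality(4)[OF assms]) (auto intro!: Bochner_Integration.integral_nonneg simp: wfin_space[OF assms])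
qed

abbreviation datum :: "('a set \<Rightarrow> real) \<Rightarrow> 'a \<Rightarrow> real" where
  "datum \<mu> x \<equiv> pot (pos_part \<Omega> \<mu>) x - pot (neg_part \<Omega> \<mu>) x"

lemma datum_pairing:
  assumes "\<mu> \<in> Mw \<Omega> \<gamma>" "\<xi> \<in> S"
  shows "(\<integral>x. datum \<mu> x * \<xi> x \<partial>M) = (\<integral>x. green \<xi> x \<partial>pos_part \<Omega> \<mu>) - (\<integral>x. green \<xi> x \<partial>neg_part \<Omega> \<mu>)"
  using potential_pairing_diff[OF potential_pot potential_pot assms(2)] Mw_parts[OF assms(1)]
  by (simp add: pot_duality(4)[OF _ assms(2)])

text \<open>Duality replaces the measure by its potential. The larger class of test functions is
  harmless: a change on a null set alters no value of the potential, so integrals against singular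
  measures stay the same too.\<close>

lemma weak_dual_sol_iff:
  assumes \<mu>: "\<mu> \<in> Mw \<Omega> \<gamma>"
  shows "weak_dual_sol \<Omega> \<gamma> G g \<mu> u \<longleftrightarrow> sol (\<lambda>_. g) (datum \<mu>) u"
proof -
  have rhs: "signed_integral \<Omega> \<mu> (green_fun \<Omega> G \<xi>) = (\<integral>x. datum \<mu> x * \<xi> x \<partial>M)" if xi: "\<xi> \<in> S" for \<xi>
  proof -
    have "(\<integral>x. green_fun \<Omega> G \<xi> x \<partial>\<alpha>) = (\<integral>x. green \<xi> x \<partial>\<alpha>)" if "wfin \<alpha>" for \<alpha>
      by (rule Bochner_Integration.integral_cong) (auto simp: wfin_space[OF that] green_eq_green_fun S_measurable[OF xi])
    then show ?thesis using Mw_parts[OF \<mu>] by (simp add: signed_integral_def datum_pairing[OF \<mu> xi])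
  qed
  have lhs: "(LINT x:\<Omega>|lebesgue. u x * \<xi> x) + (LINT x:\<Omega>|lebesgue. g (u x) * green_fun \<Omega> G \<xi> x)
     = (\<integral>x. u x * \<xi> x \<partial>M) + (\<integral>x. g (u x) * green \<xi> x \<partial>M)" if xi: "\<xi> \<in> borel_measurable M" for \<xi>
  proof -
    have "(\<integral>x. g (u x) * green_fun \<Omega> G \<xi> x \<partial>M) = (\<integral>x. g (u x) * green \<xi> x \<partial>M)"
      by (rule Bochner_Integration.integral_cong) (auto simp: green_eq_green_fun xi)
    then show ?thesis by (simp add: restrict_iffs)
  qed
  show ?thesis
  proof
    assume "weak_dual_sol \<Omega> \<gamma> G g \<mu> u"
    then show "sol (\<lambda>_. g) (datum \<mu>) u"
      using S_weighted_Linf lhs[OF S_measurable] rhs by (simp add: weak_dual_sol_def sol_def L1w_iff)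
  next
    assume s: "sol (\<lambda>_. g) (datum \<mu>) u"
    then have uL: "u \<in> L1d" "(\<lambda>x. g (u x)) \<in> L1d" by (auto simp: sol_def)
    note [measurable] = L1d_measurable[OF uL(1)]
    show "weak_dual_sol \<Omega> \<gamma> G g \<mu> u"
      unfolding weak_dual_sol_def L1w_iff
    proof (intro conjI uL ballI)
      fix \<xi> assume "\<xi> \<in> weighted_Linf \<Omega> \<gamma>"
      then obtain \<eta> where eta: "\<eta> \<in> S" and xi [measurable]: "\<xi> \<in> borel_measurable M" and ae: "AE x in M. \<xi> x = \<eta> x"
        by (rule weighted_Linf_S)
      note [measurable] = S_measurable[OF eta]
      have gr: "green \<xi> x = green \<eta> x" if "x \<in> \<Omega>" for x
        using that by (intro green_cong_AE ae) auto
      have "(\<integral>x. u x * \<xi> x \<partial>M) = (\<integral>x. u x * \<eta> x \<partial>M)"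
      proof (rule integral_cong_AE)
        show "AE x in M. u x * \<xi> x = u x * \<eta> x" using ae by eventually_elim simp
      qed measurable
      moreover have "(\<integral>x. g (u x) * green \<xi> x \<partial>M) = (\<integral>x. g (u x) * green \<eta> x \<partial>M)"
        by (rule Bochner_Integration.integral_cong) (auto simp: gr)
      moreover have "signed_integral \<Omega> \<mu> (green_fun \<Omega> G \<xi>) = signed_integral \<Omega> \<mu> (green_fun \<Omega> G \<eta>)"
      proof -
        have "(\<integral>x. green_fun \<Omega> G \<xi> x \<partial>\<alpha>) = (\<integral>x. green_fun \<Omega> G \<eta> x \<partial>\<alpha>)" if "wfin \<alpha>" for \<alpha>
          by (rule Bochner_Integration.integral_cong)
            (auto simp: wfin_space[OF that] green_eq_green_fun[symmetric] gr)
        then show ?thesis using Mw_parts[OF \<mu>] by (simp add: signed_integral_def)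
      qed
      ultimately show "(LINT x:\<Omega>|lebesgue. u x * \<xi> x) + (LINT x:\<Omega>|lebesgue. g (u x) * green_fun \<Omega> G \<xi> x)
         = signed_integral \<Omega> \<mu> (green_fun \<Omega> G \<xi>)"
        using s eta by (simp add: lhs rhs sol_def)
    qed
  qed
qed

context
  fixes g :: "real \<Rightarrow> real"
  assumes g_mono: "mono g" and g_cont: "continuous_on UNIV g" and g_0: "g 0 = 0"
    and g_sub: "set_integrable lborel {1..} (\<lambda>t. (g t - g (- t)) * t powr (- 1 - p_star DIM('a) s \<gamma>))"
begin

text \<open>Both \<open>g\<close> and \<open>\<lambda>t. - g (- t)\<close> are nondecreasing,
  nonnegative for t >= 0 and at most \<open>g t - g (- t)\<close> there, so the growth condition
  applies to each.\<close>

lemma g_pot: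
  assumes "wfin \<alpha>"
  shows "(\<lambda>x. g (pot \<alpha> x)) \<in> L1d" "(\<lambda>x. g (- pot \<alpha> x)) \<in> L1d"
proof -
  have [measurable]: "g \<in> borel_measurable borel" by (rule borel_measurable_continuous_onI[OF g_cont])
  have fin: "(\<integral>\<^sup>+t. ennreal (h t * t powr (- 1 - p_star DIM('a) s \<gamma>)) * indicator {1..} t \<partial>lborel) < \<infinity>"
    if "\<And>t. 0 \<le> t \<Longrightarrow> h t \<le> g t - g (- t)" for h :: "real \<Rightarrow> real"
  proof -
    have "(\<integral>\<^sup>+t. ennreal (h t * t powr (- 1 - p_star DIM('a) s \<gamma>)) * indicator {1..} t \<partial>lborel)
      \<le> (\<integral>\<^sup>+t. ennreal (norm (indicator {1..} t *\<^sub>R ((g t - g (- t)) * t powr (- 1 - p_star DIM('a) s \<gamma>)))) \<partial>lborel)"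
    proof (rule nn_integral_mono)
      fix t :: real
      have "h t * t powr (- 1 - p_star DIM('a) s \<gamma>) \<le> \<bar>(g t - g (- t)) * t powr (- 1 - p_star DIM('a) s \<gamma>)\<bar>" if "1 \<le> t"
        using that \<open>\<And>t. 0 \<le> t \<Longrightarrow> h t \<le> g t - g (- t)\<close>[of t]
        by (intro order_trans[OF mult_right_mono abs_ge_self]) auto
      then show "ennreal (h t * t powr (- 1 - p_star DIM('a) s \<gamma>)) * indicator {1..} t
        \<le> ennreal (norm (indicator {1..} t *\<^sub>R ((g t - g (- t)) * t powr (- 1 - p_star DIM('a) s \<gamma>))))"
        by (auto simp: indicator_def intro: ennreal_leI)
    qed
    also have "\<dots> < \<infinity>" using g_sub unfolding set_integrable_def integrable_iff_bounded by blast
    finally show ?thesis .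
  qed
  have g0: "g (- t) \<le> 0" "0 \<le> g t" if "0 \<le> t" for t
    using monoD[OF g_mono, of "- t" 0] monoD[OF g_mono, of 0 t] that g_0 by auto
  show "(\<lambda>x. g (pot \<alpha> x)) \<in> L1d"
    by (rule pot_subcritical[OF assms _ _ _ fin[of g]]) (auto intro!: monoD[OF g_mono] simp: g_0 g0)
  have "(\<lambda>x. - g (- pot \<alpha> x)) \<in> L1d"
    by (rule pot_subcritical[OF assms _ _ _ fin[of "\<lambda>t. - g (- t)"]]) (auto intro!: monoD[OF g_mono] simp: g_0 g0)
  from L1d_minus[OF this] show "(\<lambda>x. g (- pot \<alpha> x)) \<in> L1d" by simp
qed

lemma weak_dual_sol_mono:
  assumes \<mu>: "\<mu>\<^sub>1 \<in> Mw \<Omega> \<gamma>" "\<mu>\<^sub>2 \<in> Mw \<Omega> \<gamma>" "signed_le \<Omega> \<mu>\<^sub>1 \<mu>\<^sub>2"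
    and u: "weak_dual_sol \<Omega> \<gamma> G g \<mu>\<^sub>1 u\<^sub>1" "weak_dual_sol \<Omega> \<gamma> G g \<mu>\<^sub>2 u\<^sub>2"
  shows "AE x in M. u\<^sub>1 x \<le> u\<^sub>2 x"
proof (rule sol_le)
  show "sol (\<lambda>_. g) (datum \<mu>\<^sub>1) u\<^sub>1" "sol (\<lambda>_. g) (datum \<mu>\<^sub>2) u\<^sub>2"
    using u \<mu> by (simp_all add: weak_dual_sol_iff)
  show "AE x in M. u\<^sub>2 x \<le> u\<^sub>1 x \<longrightarrow> g (u\<^sub>2 x) \<le> g (u\<^sub>1 x)" by (auto intro: monoD[OF g_mono])
  fix \<xi> assume xi: "\<xi> \<in> S" "\<And>x. x \<in> space M \<Longrightarrow> 0 \<le> green \<xi> x"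
  show "(\<integral>x. datum \<mu>\<^sub>1 x * \<xi> x \<partial>M) \<le> (\<integral>x. datum \<mu>\<^sub>2 x * \<xi> x \<partial>M)"
    unfolding datum_pairing[OF \<mu>(1) xi(1)] datum_pairing[OF \<mu>(2) xi(1)]
    by (rule signed_le_integral[OF \<mu> xi(1)]) (use xi(2) in simp)
qed

lemma weak_dual_sol_unique:
  assumes "\<mu> \<in> Mw \<Omega> \<gamma>" "weak_dual_sol \<Omega> \<gamma> G g \<mu> u" "weak_dual_sol \<Omega> \<gamma> G g \<mu> v"
  shows "AE x in M. v x = u x"
proof -
  have le: "signed_le \<Omega> \<mu> \<mu>" by (simp add: signed_le_def)
  show ?thesis
    using weak_dual_sol_mono[OF assms(1,1) le assms(2,3)] weak_dual_sol_mono[OF assms(1,1) le assms(3,2)]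
    by eventually_elim simp
qed

text \<open>Both constants come from testing with the weight. \<open>Kc\<close> bounds the weighted
  norms of the two potentials and hence that of \<open>u\<close>; \<open>Kc / Kl\<close> arises from
  \<open>absorption_bound\<close> once \<open>green w\<close> is bounded below by
  \<open>Kl * w\<close>.\<close>

lemma weak_dual_sol_exists:
  assumes \<mu>: "\<mu> \<in> Mw \<Omega> \<gamma>"
  shows "\<exists>u. weak_dual_sol \<Omega> \<gamma> G g \<mu> u \<and>
    (AE x in M. - green_meas G (neg_part \<Omega> \<mu>) x \<le> u x \<and> u x \<le> green_meas G (pos_part \<Omega> \<mu>) x) \<and>
    L1w_norm \<Omega> \<gamma> u + L1w_norm \<Omega> \<gamma> (\<lambda>x. g (u x)) \<le> (Kc + Kc / Kl) * Mw_norm \<Omega> \<gamma> \<mu>"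
proof -
  define U where "U = pot (pos_part \<Omega> \<mu>)"
  define W where "W = pot (neg_part \<Omega> \<mu>)"
  note wf = Mw_parts[OF \<mu>]
  have P: "potential U" "potential W" unfolding U_def W_def by (intro potential_pot wf)+
  have gL: "(\<lambda>x. g (U x)) \<in> L1d" "(\<lambda>x. g (- W x)) \<in> L1d" unfolding U_def W_def by (intro g_pot wf)+
  have UL: "U \<in> L1d" "W \<in> L1d" using P by (auto simp: potential_def)
  obtain u where u: "sol (\<lambda>_. g) (\<lambda>x. U x - W x) u"
    using sol_exists[OF P g_mono g_cont g_0 gL] by blast
  then have uL: "u \<in> L1d" "(\<lambda>x. g (u x)) \<in> L1d" by (auto simp: sol_def)
  have g0: "t \<le> 0 \<Longrightarrow> g t \<le> 0" "0 \<le> t \<Longrightarrow> 0 \<le> g t" for t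
    using monoD[OF g_mono, of t 0] monoD[OF g_mono, of 0 t] g_0 by auto
  have bounds: "AE x in M. - W x \<le> u x \<and> u x \<le> U x"
    by (rule sol_bounds[OF P u]) (auto intro: g0)
  have pair: "(\<integral>x. pot \<alpha> x * w x \<partial>M) \<le> Kc * (\<integral>x. w x \<partial>\<alpha>)" if \<alpha>: "wfin \<alpha>" for \<alpha>
  proof -
    have "(\<integral>x. pot \<alpha> x * w x \<partial>M) = (\<integral>x. green w x \<partial>\<alpha>)" by (rule pot_duality(4)[OF \<alpha> weight_in_S])
    also have "\<dots> \<le> (\<integral>x. Kc * w x \<partial>\<alpha>)"
    proof (rule integral_mono)
      show "integrable \<alpha> (green w)" by (rule pot_duality(3)[OF \<alpha> weight_in_S])
      show "integrable \<alpha> (\<lambda>x. Kc * w x)" using wfin_integrable[OF \<alpha>] by simp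
      show "green w x \<le> Kc * w x" if "x \<in> space \<alpha>" for x
        using integrable_kernel_weight(2)[of x] that by (simp add: green_def wfin_space[OF \<alpha>])
    qed
    finally show ?thesis by simp
  qed
  have UW: "(\<integral>x. U x * w x \<partial>M) + (\<integral>x. W x * w x \<partial>M) \<le> Kc * Mw_norm \<Omega> \<gamma> \<mu>"
    using pair[OF wf(2)] pair[OF wf(3)] unfolding U_def W_def wf(4) by (simp add: distrib_left)
  have iUW: "integrable M (\<lambda>x. U x * w x)" "integrable M (\<lambda>x. W x * w x)" using UL by (auto simp: L1d_def)
  have 1: "L1w_norm \<Omega> \<gamma> u \<le> Kc * Mw_norm \<Omega> \<gamma> \<mu>"
  proof -
    have "L1w_norm \<Omega> \<gamma> u \<le> (\<integral>x. U x * w x + W x * w x \<partial>M)"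
      unfolding L1w_norm_eq
    proof (rule integral_mono_AE)
      show "integrable M (\<lambda>x. \<bar>u x\<bar> * w x)" using L1d_abs[OF uL(1)] by (simp add: L1d_def)
      show "AE x in M. \<bar>u x\<bar> * w x \<le> U x * w x + W x * w x"
        using bounds AE_space
      proof eventually_elim
        case (elim x)
        have "0 \<le> U x" "0 \<le> W x" using P elim(2) by (auto simp: potential_def)
        then have "\<bar>u x\<bar> \<le> U x + W x" using elim(1) by linarith
        then have "\<bar>u x\<bar> * w x \<le> (U x + W x) * w x" by (rule mult_right_mono) (simp add: w_def)
        then show ?case by (simp add: distrib_right)
      qed
    qed (use iUW in auto)
    then show ?thesis using UW iUW by simp
  qed
  have 2: "L1w_norm \<Omega> \<gamma> (\<lambda>x. g (u x)) \<le> Kc / Kl * Mw_norm \<Omega> \<gamma> \<mu>"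
  proof -
    have "Kl * L1w_norm \<Omega> \<gamma> (\<lambda>x. g (u x)) = (\<integral>x. Kl * (\<bar>g (u x)\<bar> * w x) \<partial>M)"
      unfolding L1w_norm_eq by simp
    also have "\<dots> \<le> (\<integral>x. \<bar>g (u x)\<bar> * green w x \<partial>M)"
    proof (rule integral_mono)
      show "integrable M (\<lambda>x. Kl * (\<bar>g (u x)\<bar> * w x))" using L1d_abs[OF uL(2)] by (simp add: L1d_def)
      show "integrable M (\<lambda>x. \<bar>g (u x)\<bar> * green w x)"
        by (rule L1d_times_S[OF L1d_abs[OF uL(2)] green_in_S[OF weight_in_S]])
      fix x assume "x \<in> space M"
      then have "\<bar>g (u x)\<bar> * (Kl * w x) \<le> \<bar>g (u x)\<bar> * green w x"
        by (intro mult_left_mono green_weight_lower) auto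
      then show "Kl * (\<bar>g (u x)\<bar> * w x) \<le> \<bar>g (u x)\<bar> * green w x" by (simp add: mult_ac)
    qed
    also have "\<dots> \<le> (\<integral>x. U x * w x \<partial>M) + (\<integral>x. W x * w x \<partial>M)"
      by (rule absorption_bound[OF P g_mono g_cont g_0 gL u weight_in_S]) (simp add: w_def)
    also have "\<dots> \<le> Kc * Mw_norm \<Omega> \<gamma> \<mu>" by (rule UW)
    finally show ?thesis using Kl_pos by (simp add: le_divide_eq mult.commute)
  qed
  have "AE x in M. - green_meas G (neg_part \<Omega> \<mu>) x \<le> u x \<and> u x \<le> green_meas G (pos_part \<Omega> \<mu>) x"
    using bounds pot_eq_green_meas[OF wf(2)] pot_eq_green_meas[OF wf(3)]
    by eventually_elim (simp add: U_def W_def)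
  moreover have "weak_dual_sol \<Omega> \<gamma> G g \<mu> u"
    unfolding weak_dual_sol_iff[OF \<mu>] using u by (simp add: U_def W_def)
  ultimately show ?thesis using 1 2 by (intro exI[of _ u]) (simp add: distrib_right)
qed

end

end

theorem theorem3p5:
  fixes \<Omega> :: "'a::euclidean_space set" and s \<gamma> c :: real
  assumes "DIM('a) \<ge> 3"
    and "bounded \<Omega>" and "C2_domain \<Omega>"
    and "0 < s" and "s \<le> 1" and "0 < \<gamma>" and "\<gamma> \<le> 1" and "real DIM('a) > 2 * s"
    and "c > 0"
  shows "\<exists>C>0. \<forall>(J :: 'a \<Rightarrow> 'a \<Rightarrow> real) (B :: 'a \<Rightarrow> real) (G :: 'a \<Rightarrow> 'a \<Rightarrow> real) (g :: real \<Rightarrow> real).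
    cond_L1 \<Omega> J B \<and> cond_L2 \<Omega> J B \<and> cond_L3 \<Omega> J B \<and> cond_L4 \<Omega> s J B \<and>
    cond_G1 \<Omega> s \<gamma> c J B G \<and> cond_G2 \<Omega> G \<and> cond_G3 \<Omega> \<gamma> G \<and>
    mono g \<and> continuous_on UNIV g \<and> g 0 = 0 \<and>
    set_integrable lborel {1..} (\<lambda>t. (g t - g (- t)) * t powr (- 1 - p_star DIM('a) s \<gamma>))
    \<longrightarrow>
    (\<forall>\<mu>\<in>Mw \<Omega> \<gamma>. \<exists>u.
       weak_dual_sol \<Omega> \<gamma> G g \<mu> u \<and>
       (\<forall>v. weak_dual_sol \<Omega> \<gamma> G g \<mu> v \<longrightarrow> (AE x in lebesgue. x \<in> \<Omega> \<longrightarrow> v x = u x)) \<and>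
       (AE x in lebesgue. x \<in> \<Omega> \<longrightarrow>
          - green_meas G (neg_part \<Omega> \<mu>) x \<le> u x \<and> u x \<le> green_meas G (pos_part \<Omega> \<mu>) x) \<and>
       L1w_norm \<Omega> \<gamma> u + L1w_norm \<Omega> \<gamma> (\<lambda>x. g (u x)) \<le> C * Mw_norm \<Omega> \<gamma> \<mu>) \<and>
    (\<forall>\<mu>\<^sub>1\<in>Mw \<Omega> \<gamma>. \<forall>\<mu>\<^sub>2\<in>Mw \<Omega> \<gamma>. \<forall>u\<^sub>1 u\<^sub>2.
       signed_le \<Omega> \<mu>\<^sub>1 \<mu>\<^sub>2 \<and> weak_dual_sol \<Omega> \<gamma> G g \<mu>\<^sub>1 u\<^sub>1 \<and> weak_dual_sol \<Omega> \<gamma> G g \<mu>\<^sub>2 u\<^sub>2 \<longrightarrow>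
       (AE x in lebesgue. x \<in> \<Omega> \<longrightarrow> u\<^sub>1 x \<le> u\<^sub>2 x))"
proof -
  obtain R where R: "\<Omega> \<subseteq> ball 0 R"
    using bounded_subset_ballD[OF assms(2), of 0] by auto
  obtain I where I: "0 < I" "\<And>(y::'a) \<rho>. 0 < \<rho> \<Longrightarrow>
       (\<integral>\<^sup>+x. ennreal (dist x y powr (2 * s - real DIM('a))) * indicator (ball y \<rho>) x \<partial>lebesgue) \<le> ennreal (I * \<rho> powr (2 * s))"
    using singular_integral[of "2 * s", where 'a='a] assms(4,8) by auto
  have opn: "open \<Omega>" "\<Omega> \<noteq> {}" using assms(3) by (auto simp: C2_domain_def)
  have R0: "0 < R" using opn(2) R by (auto simp: subset_eq dest: order_le_less_trans[OF norm_ge_zero])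
  \<comment> \<open>\<open>K\<close> and \<open>L\<close> are the later \<open>Kc\<close> and
    \<open>Kl\<close>, spelled out because the constant must be fixed before the operator, the
    kernel and the nonlinearity are introduced.\<close>
  define K where "K = c * 2 powr \<gamma> * I * (2 * R) powr (2 * s)"
  define L where "L = inverse c * (2 * R) powr (2 * s - real DIM('a) - 2 * \<gamma>)
      * (\<integral>x. bdist \<Omega> x powr \<gamma> * bdist \<Omega> x powr \<gamma> \<partial>lebesgue_on \<Omega>)"
  \<comment> \<open>The absolute value secures \<open>0 < C\<close> at once; positivity of
    \<open>L\<close> becomes available as \<open>Kl_pos\<close> after the interpretation, and the
    bars then disappear.\<close>
  define C where "C = K + \<bar>K / L\<bar>"
  have K: "0 < K" using assms(9) I(1) R0 by (simp add: K_def)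
  show ?thesis
  proof (intro exI[of _ C] conjI allI impI)
    show "0 < C" using K by (simp add: C_def add_pos_nonneg)
    fix J :: "'a \<Rightarrow> 'a \<Rightarrow> real" and B :: "'a \<Rightarrow> real" and G :: "'a \<Rightarrow> 'a \<Rightarrow> real" and g :: "real \<Rightarrow> real"
    assume H: "cond_L1 \<Omega> J B \<and> cond_L2 \<Omega> J B \<and> cond_L3 \<Omega> J B \<and> cond_L4 \<Omega> s J B \<and>
      cond_G1 \<Omega> s \<gamma> c J B G \<and> cond_G2 \<Omega> G \<and> cond_G3 \<Omega> \<gamma> G \<and>
      mono g \<and> continuous_on UNIV g \<and> g 0 = 0 \<and>
      set_integrable lborel {1..} (\<lambda>t. (g t - g (- t)) * t powr (- 1 - p_star DIM('a) s \<gamma>))"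
    then have G1: "cond_G1 \<Omega> s \<gamma> c J B G" and G2: "cond_G2 \<Omega> G" and L1: "cond_L1 \<Omega> J B" by auto
    interpret elliptic_problem \<Omega> s \<gamma> c R I G J B
    proof
      show "continuous_on {(x, y). x \<in> \<Omega> \<and> y \<in> \<Omega> \<and> x \<noteq> y} (\<lambda>(x, y). G x y)"
        using G2 by (simp add: cond_G2_def)
      show "(\<lambda>(x, y). G x y) \<in> borel_measurable (restrict_space borel {(x, y). x \<in> \<Omega> \<and> y \<in> \<Omega> \<and> x \<noteq> y})"
        using G1 by (simp add: cond_G1_def)
    qed (use assms opn R I G1 L1 in \<open>auto simp: cond_G1_def\<close>)
    have eq: "Kc = K" "Kl = L" by (simp_all add: Kc_def K_def Kl_def L_def w_def)
    then have C: "C = Kc + Kc / Kl" using K Kl_pos by (simp add: C_def)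
    have ae: "(AE x in lebesgue. x \<in> \<Omega> \<longrightarrow> P x) \<longleftrightarrow> (AE x in lebesgue_on \<Omega>. P x)" for P
      using opn by (simp add: AE_restrict_space_iff)
    have gs: "mono g" "continuous_on UNIV g" "g 0 = 0"
      "set_integrable lborel {1..} (\<lambda>t. (g t - g (- t)) * t powr (- 1 - p_star DIM('a) s \<gamma>))" using H by auto
    show "\<forall>\<mu>\<in>Mw \<Omega> \<gamma>. \<exists>u.
       weak_dual_sol \<Omega> \<gamma> G g \<mu> u \<and>
       (\<forall>v. weak_dual_sol \<Omega> \<gamma> G g \<mu> v \<longrightarrow> (AE x in lebesgue. x \<in> \<Omega> \<longrightarrow> v x = u x)) \<and>
       (AE x in lebesgue. x \<in> \<Omega> \<longrightarrow>
          - green_meas G (neg_part \<Omega> \<mu>) x \<le> u x \<and> u x \<le> green_meas G (pos_part \<Omega> \<mu>) x) \<and>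
       L1w_norm \<Omega> \<gamma> u + L1w_norm \<Omega> \<gamma> (\<lambda>x. g (u x)) \<le> C * Mw_norm \<Omega> \<gamma> \<mu>"
    proof
      fix \<mu> assume \<mu>: "\<mu> \<in> Mw \<Omega> \<gamma>"
      obtain u where u: "weak_dual_sol \<Omega> \<gamma> G g \<mu> u"
        "AE x in lebesgue_on \<Omega>. - green_meas G (neg_part \<Omega> \<mu>) x \<le> u x \<and> u x \<le> green_meas G (pos_part \<Omega> \<mu>) x"
        "L1w_norm \<Omega> \<gamma> u + L1w_norm \<Omega> \<gamma> (\<lambda>x. g (u x)) \<le> C * Mw_norm \<Omega> \<gamma> \<mu>"
        using weak_dual_sol_exists[OF gs \<mu>] unfolding C by blast
      have "AE x in lebesgue_on \<Omega>. v x = u x" if "weak_dual_sol \<Omega> \<gamma> G g \<mu> v" for v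
        by (rule weak_dual_sol_unique[OF gs \<mu> u(1) that])
      with u show "\<exists>u.
         weak_dual_sol \<Omega> \<gamma> G g \<mu> u \<and>
         (\<forall>v. weak_dual_sol \<Omega> \<gamma> G g \<mu> v \<longrightarrow> (AE x in lebesgue. x \<in> \<Omega> \<longrightarrow> v x = u x)) \<and>
         (AE x in lebesgue. x \<in> \<Omega> \<longrightarrow>
            - green_meas G (neg_part \<Omega> \<mu>) x \<le> u x \<and> u x \<le> green_meas G (pos_part \<Omega> \<mu>) x) \<and>
         L1w_norm \<Omega> \<gamma> u + L1w_norm \<Omega> \<gamma> (\<lambda>x. g (u x)) \<le> C * Mw_norm \<Omega> \<gamma> \<mu>"
        unfolding ae by blast
    qed
    show "\<forall>\<mu>\<^sub>1\<in>Mw \<Omega> \<gamma>. \<forall>\<mu>\<^sub>2\<in>Mw \<Omega> \<gamma>. \<forall>u\<^sub>1 u\<^sub>2.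
       signed_le \<Omega> \<mu>\<^sub>1 \<mu>\<^sub>2 \<and> weak_dual_sol \<Omega> \<gamma> G g \<mu>\<^sub>1 u\<^sub>1 \<and> weak_dual_sol \<Omega> \<gamma> G g \<mu>\<^sub>2 u\<^sub>2 \<longrightarrow>
       (AE x in lebesgue. x \<in> \<Omega> \<longrightarrow> u\<^sub>1 x \<le> u\<^sub>2 x)"
      unfolding ae using weak_dual_sol_mono[OF gs] by blast
  qed
qed

end
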